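(* Every quasiconformal tree is quasisymmetrically equivalent to a geodesic tree. That is, if $(\mathbf{T},d)$ is a quasiconformal tree, then there exist a metric tree $(T,\varrho)$ that is a geodesic metric space and a quasisymmetry $f\colon (\mathbf{T},d)\to (T,\varrho)$.
   Context: A (metric) tree is a compact, connected, and locally connected metric space that contains at least two distinct points and has the property that for any two points $x,y$ there exists a unique arc $[x,y]$ in the space with endpoints $x$ and $y$ (for $x=y$ one sets $[x,y]=\{x\}$, a degenerate arc). A metric space is doubling if there is a constant $N\in\mathbb{N}$ such that each ball of radius $R>0$ can be covered by at most $N$ balls of radius $R/2$. A metric space $(X,d)$ is of bounded turning if there is a constant $K\ge 1$ such that for all $x,y\in X$ there exists a compact connected set $E\subset X$ with $x,y\in E$ and $\operatorname{diam}(E)\le K d(x,y)$. A quasiconformal tree is a metric tree that is doubling and of bounded turning. A metric space is geodesic if any two points $x,y$ can be joined by an arc with endpoints $x,y$ whose length equals the distance of $x$ and $y$. A geodesic tree is a metric tree that is geodesic as a metric space. A homeomorphism $f\colon (X,d_X)\to(Y,d_Y)$ is a quasisymmetry if there is a homeomorphism $\eta\colon[0,\infty)\to[0,\infty)$ with $\frac{d_Y(f(x),f(y))}{d_Y(f(x),f(z))}\le \eta\left(\frac{d_X(x,y)}{d_X(x,z)}\right)$ for all distinct $x,y,z\in X$; two spaces are quasisymmetrically equivalent if there is a quasisymmetry between them. *)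

theory Defs
  imports "HOL-Analysis.Analysis"
begin

section \<open>Arcs and metric trees\<close>

text \<open>A path \<open>\<gamma>\<close> on \<open>[0,1]\<close> that parametrizes an arc with endpoints \<open>x\<close> and \<open>y\<close>. For \<open>x = y\<close> the
  only arc is the degenerate one, the singleton \<open>{x}\<close>, parametrized by the constant path. For
  \<open>x \<noteq> y\<close> the library notion of an embedding already forces the image of \<open>\<gamma>\<close> to lie in \<open>X\<close>.\<close>

definition arc_path :: "'a topology \<Rightarrow> 'a \<Rightarrow> 'a \<Rightarrow> (real \<Rightarrow> 'a) \<Rightarrow> bool" where
  "arc_path X x y \<gamma> \<longleftrightarrow> \<gamma> 0 = x \<and> \<gamma> 1 = y \<and>
     (if x = y then x \<in> topspace X \<and> (\<forall>t\<in>{0..1}. \<gamma> t = x)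
      else embedding_map (top_of_set {0..1}) X \<gamma>)"

definition arc_between :: "'a topology \<Rightarrow> 'a \<Rightarrow> 'a \<Rightarrow> 'a set \<Rightarrow> bool" where
  "arc_between X x y A \<longleftrightarrow> (\<exists>\<gamma>. arc_path X x y \<gamma> \<and> A = \<gamma> ` {0..1})"

definition metric_tree :: "'a metric \<Rightarrow> bool" where
  "metric_tree X \<longleftrightarrow>
     compact_space (mtopology_of X) \<and>
     connected_space (mtopology_of X) \<and>
     locally_connected_space (mtopology_of X) \<and>
     (\<exists>x\<in>mspace X. \<exists>y\<in>mspace X. x \<noteq> y) \<and>
     (\<forall>x\<in>mspace X. \<forall>y\<in>mspace X. \<exists>!A. arc_between (mtopology_of X) x y A)"

section \<open>Quasiconformal trees\<close>

definition doubling_metric :: "'a metric \<Rightarrow> bool" where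
  "doubling_metric X \<longleftrightarrow>
     (\<exists>N::nat. \<forall>x\<in>mspace X. \<forall>R>0. \<exists>C\<subseteq>mspace X.
        finite C \<and> card C \<le> N \<and> mball_of X x R \<subseteq> (\<Union>c\<in>C. mball_of X c (R/2)))"

text \<open>Analogue of \<^const>\<open>diameter\<close> for a set in an abstract metric space. As there, the
  supremum is a real number, hence meaningful only for bounded \<open>E\<close>; it is used only for compact
  sets.\<close>

definition metric_diameter :: "'a metric \<Rightarrow> 'a set \<Rightarrow> real" where
  "metric_diameter X E = (if E = {} then 0 else SUP (x,y)\<in>E\<times>E. mdist X x y)"

definition bounded_turning :: "'a metric \<Rightarrow> bool" where
  "bounded_turning X \<longleftrightarrow>
     (\<exists>K::real. K \<ge> 1 \<and> (\<forall>x\<in>mspace X. \<forall>y\<in>mspace X. \<exists>E.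
        compactin (mtopology_of X) E \<and> connectedin (mtopology_of X) E \<and>
        x \<in> E \<and> y \<in> E \<and> metric_diameter X E \<le> K * mdist X x y))"

definition quasiconformal_tree :: "'a metric \<Rightarrow> bool" where
  "quasiconformal_tree X \<longleftrightarrow> metric_tree X \<and> doubling_metric X \<and> bounded_turning X"

section \<open>Geodesic trees\<close>

text \<open>The length of \<open>\<gamma>\<close> on \<open>[0,1]\<close>: the supremum over all partitions
  \<open>0 \<le> t 0 \<le> \<dots> \<le> t n \<le> 1\<close>, possibly infinite.\<close>

definition curve_length :: "'a metric \<Rightarrow> (real \<Rightarrow> 'a) \<Rightarrow> ereal" where
  "curve_length X \<gamma> =
     (SUP (n, t) \<in> {(n::nat, t::nat \<Rightarrow> real).
                      (\<forall>i\<le>n. t i \<in> {0..1}) \<and> (\<forall>i<n. t i \<le> t (Suc i))}.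
        ereal (\<Sum>i<n. mdist X (\<gamma> (t i)) (\<gamma> (t (Suc i)))))"

definition geodesic_metric :: "'a metric \<Rightarrow> bool" where
  "geodesic_metric X \<longleftrightarrow>
     (\<forall>x\<in>mspace X. \<forall>y\<in>mspace X. \<exists>\<gamma>.
        arc_path (mtopology_of X) x y \<gamma> \<and> curve_length X \<gamma> = ereal (mdist X x y))"

definition geodesic_tree :: "'a metric \<Rightarrow> bool" where
  "geodesic_tree X \<longleftrightarrow> metric_tree X \<and> geodesic_metric X"

section \<open>Quasisymmetries\<close>

definition quasisymmetry :: "'a metric \<Rightarrow> 'b metric \<Rightarrow> ('a \<Rightarrow> 'b) \<Rightarrow> bool" where
  "quasisymmetry X Y f \<longleftrightarrow>
     homeomorphic_map (mtopology_of X) (mtopology_of Y) f \<and>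
     (\<exists>\<eta>::real \<Rightarrow> real. homeomorphic_map (top_of_set {0..}) (top_of_set {0..}) \<eta> \<and>
        (\<forall>x\<in>mspace X. \<forall>y\<in>mspace X. \<forall>z\<in>mspace X. x \<noteq> y \<longrightarrow> x \<noteq> z \<longrightarrow> y \<noteq> z \<longrightarrow>
           mdist Y (f x) (f y) / mdist Y (f x) (f z) \<le> \<eta> (mdist X x y / mdist X x z)))"

end

(* Bounded turning allows one to replace the metric by D(x,y) = diam [x,y], which is monotone along
   arcs. After choosing a root, a geodesic metric amounts to a height function h through
   rho(x,y) = h(x) + h(y) - 2 h(x /\ y), where x /\ y is the meet. The heights are built on an increasing
   sequence of finite subtrees: every step cuts an edge, attaches a hair, or both. A cut keeps the
   density of h with respect to D at both ends of the edge, and a hair receives a small multiple epsilon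
   of the density at its base. Hence densities at vertices never change, densities of adjacent edges are
   comparable except across the base of a hair, and the heights of nested hairs decay geometrically. As
   doubling bounds the number of vertices at a given scale, D(x,y) <= 2 D(x,z) implies
   rho(x,y) <= Theta rho(x,z), and additivity of rho along arcs upgrades this weak quasisymmetry to a
   power quasisymmetry. *)

theory Submission
  imports Defs "HOL-Probability.Discrete_Topology"
begin

section \<open>Rooted trees\<close>

text \<open>The obstacle is that every cut may change densities by a bounded factor, so that no
  comparison of densities survives infinitely many steps. What can be bounded is the number of
  factors that matter at one scale, and for this the order of the choices is decisive. The vertex
  sets are chosen from \<open>D\<close> alone, before any height exists; doubling bounds the
  vertices of a segment at the current scale by some \<open>N\<close>, and only then is \<epsilon>
  chosen, small in terms of \<open>N\<close>. Inside a hair the comparison constants do not involve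
  \<epsilon>, which makes this choice possible. Crossing the base of a hair costs a factor 1 /
  \<epsilon>, harmless once \<epsilon> is fixed, because a segment crosses boundedly many bases.
  Hairs attached much later inside an old edge escape such comparisons. They are controlled through
  heights instead: the density at their base times their length is at most a multiple of the density
  of the old edge times the old mesh. All constants are independent of the stage, so the estimates
  on vertices pass to the limit.\<close>

text \<open>
  \<open>D\<close> is not the metric of the tree itself but stands for the diameter of the arc between two points,
  which is what makes \<open>mono\<close> and \<open>mono2\<close> hold.
\<close>

locale rooted_tree =
  fixes S :: "'a set" and le :: "'a \<Rightarrow> 'a \<Rightarrow> bool" (infix "\<sqsubseteq>" 50)
    and mt :: "'a \<Rightarrow> 'a \<Rightarrow> 'a" and rt :: 'a and D :: "'a \<Rightarrow> 'a \<Rightarrow> real"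
  assumes le_S: "x \<sqsubseteq> y \<Longrightarrow> x \<in> S \<and> y \<in> S"
    and le_refl: "x \<in> S \<Longrightarrow> x \<sqsubseteq> x"
    and le_trans: "x \<sqsubseteq> y \<Longrightarrow> y \<sqsubseteq> z \<Longrightarrow> x \<sqsubseteq> z"
    and le_antisym: "x \<sqsubseteq> y \<Longrightarrow> y \<sqsubseteq> x \<Longrightarrow> x = y"
    and le_rt: "x \<in> S \<Longrightarrow> rt \<sqsubseteq> x"
    and rt_S: "rt \<in> S"
    and chain: "x \<sqsubseteq> z \<Longrightarrow> y \<sqsubseteq> z \<Longrightarrow> x \<sqsubseteq> y \<or> y \<sqsubseteq> x"
    and mt1: "x \<in> S \<Longrightarrow> y \<in> S \<Longrightarrow> mt x y \<sqsubseteq> x"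
    and mt2: "x \<in> S \<Longrightarrow> y \<in> S \<Longrightarrow> mt x y \<sqsubseteq> y"
    and mt_greatest: "w \<sqsubseteq> x \<Longrightarrow> w \<sqsubseteq> y \<Longrightarrow> w \<sqsubseteq> mt x y"
    and D_nonneg: "D x y \<ge> 0"
    and D_zero: "x \<in> S \<Longrightarrow> y \<in> S \<Longrightarrow> D x y = 0 \<longleftrightarrow> x = y"
    and D_sym: "D x y = D y x"
    and D_tri: "x \<in> S \<Longrightarrow> y \<in> S \<Longrightarrow> z \<in> S \<Longrightarrow> D x z \<le> D x y + D y z"
    and mono: "x \<sqsubseteq> u \<Longrightarrow> u \<sqsubseteq> v \<Longrightarrow> v \<sqsubseteq> y \<Longrightarrow> D u v \<le> D x y"
    and mono2: "x \<in> S \<Longrightarrow> y \<in> S \<Longrightarrow> mt x y \<sqsubseteq> u \<Longrightarrow> u \<sqsubseteq> x \<Longrightarrow> mt x y \<sqsubseteq> v \<Longrightarrow> v \<sqsubseteq> y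
                \<Longrightarrow> D u v \<le> D x y"
    and ivt_up: "x \<sqsubseteq> y \<Longrightarrow> 0 \<le> s \<Longrightarrow> s \<le> D x y \<Longrightarrow> \<exists>z. x \<sqsubseteq> z \<and> z \<sqsubseteq> y \<and> D x z = s"
    and ivt_down: "x \<sqsubseteq> y \<Longrightarrow> 0 \<le> s \<Longrightarrow> s \<le> D x y \<Longrightarrow> \<exists>z. x \<sqsubseteq> z \<and> z \<sqsubseteq> y \<and> D z y = s"
    and bounded: "\<exists>\<Delta>. \<forall>x\<in>S. \<forall>y\<in>S. D x y \<le> \<Delta>"
    and doubling: "\<exists>M::nat. \<forall>z\<in>S. \<forall>r>0. \<forall>F\<subseteq>S. finite F \<longrightarrow> (\<forall>f\<in>F. D f z \<le> L * r) \<longrightarrow>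
                 (\<forall>f\<in>F. \<forall>g\<in>F. f \<noteq> g \<longrightarrow> r \<le> D f g) \<longrightarrow> card F \<le> M"
    and nontriv: "\<exists>x\<in>S. x \<noteq> rt"
begin

definition lt (infix "\<sqsubset>" 50) where "x \<sqsubset> y \<longleftrightarrow> x \<sqsubseteq> y \<and> x \<noteq> y"

definition edge where
  "edge V u v \<longleftrightarrow> u \<in> V \<and> v \<in> V \<and> u \<sqsubset> v \<and> (\<forall>w\<in>V. w \<sqsubset> v \<longrightarrow> w \<sqsubseteq> u)"

definition down where "down V = {x. \<exists>v\<in>V. x \<sqsubseteq> v}"

definition proj where
  "proj V q x \<longleftrightarrow> q \<in> down V \<and> q \<sqsubseteq> x \<and> (\<forall>w\<in>down V. w \<sqsubseteq> x \<longrightarrow> w \<sqsubseteq> q)"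

definition tset where
  "tset V \<longleftrightarrow> finite V \<and> V \<subseteq> S \<and> rt \<in> V \<and> (\<forall>x\<in>V. \<forall>y\<in>V. mt x y \<in> V)"

text \<open>The largest element of \<open>V\<close> below \<open>x\<close>; \<open>proj V q x\<close> says the same of \<open>down V\<close> in place of \<open>V\<close>.\<close>

definition ap where
  "ap V x = (THE a. a \<in> V \<and> a \<sqsubseteq> x \<and> (\<forall>w\<in>V. w \<sqsubseteq> x \<longrightarrow> w \<sqsubseteq> a))"

section \<open>Order and meets in a rooted tree\<close>

lemma le_S1: "x \<sqsubseteq> y \<Longrightarrow> x \<in> S" and le_S2: "x \<sqsubseteq> y \<Longrightarrow> y \<in> S"
  using le_S by blast+

lemma lt_le: "x \<sqsubset> y \<Longrightarrow> x \<sqsubseteq> y" by (simp add: lt_def)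

lemma le_lt_trans: "x \<sqsubseteq> y \<Longrightarrow> y \<sqsubset> z \<Longrightarrow> x \<sqsubset> z"
  unfolding lt_def using le_antisym le_trans by blast

lemma lt_le_trans: "x \<sqsubset> y \<Longrightarrow> y \<sqsubseteq> z \<Longrightarrow> x \<sqsubset> z"
  unfolding lt_def using le_antisym le_trans by blast

lemma lt_irrefl: "\<not> x \<sqsubset> x" by (simp add: lt_def)

lemma not_le_lt: "x \<sqsubset> y \<Longrightarrow> \<not> y \<sqsubseteq> x"
  unfolding lt_def using le_antisym by blast

lemma chain_cases: "x \<sqsubseteq> z \<Longrightarrow> y \<sqsubseteq> z \<Longrightarrow> x \<sqsubseteq> y \<or> y \<sqsubset> x"
  using chain lt_def le_S le_refl by metis

lemma D_pos: "x \<in> S \<Longrightarrow> y \<in> S \<Longrightarrow> x \<noteq> y \<Longrightarrow> 0 < D x y"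
  using D_nonneg[of x y] D_zero[of x y] by linarith

lemma lt_D_pos: "x \<sqsubset> y \<Longrightarrow> 0 < D x y"
  using D_pos le_S lt_def by blast

lemma mt_S: "x \<in> S \<Longrightarrow> y \<in> S \<Longrightarrow> mt x y \<in> S"
  using mt1 le_S by blast

lemma mt_eq_le: "x \<sqsubseteq> y \<Longrightarrow> mt x y = x"
  by (meson le_S le_antisym le_refl mt1 mt_greatest)

lemma mt_commute: "x \<in> S \<Longrightarrow> y \<in> S \<Longrightarrow> mt x y = mt y x"
  by (meson le_antisym mt1 mt2 mt_greatest)

lemma D_mt: "x \<in> S \<Longrightarrow> y \<in> S \<Longrightarrow> D (mt x y) x \<le> D x y"
  using mono2[of x y x "mt x y"] mt1 mt2 mt_S le_refl D_sym[of x] by metis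

section \<open>Finite meet-closed vertex sets: edges, last vertices, projections\<close>

lemma tsetD:
  assumes "tset V"
  shows "finite V" "V \<subseteq> S" "rt \<in> V" "\<And>x y. x \<in> V \<Longrightarrow> y \<in> V \<Longrightarrow> mt x y \<in> V"
  using assms by (auto simp: tset_def)

lemma finite_chain_greatest:
  assumes "finite A" "A \<noteq> {}" "\<And>x. x \<in> A \<Longrightarrow> x \<sqsubseteq> z"
  shows "\<exists>m\<in>A. \<forall>x\<in>A. x \<sqsubseteq> m"
  using assms
proof (induction A rule: finite_ne_induct)
  case (singleton x)
  then show ?case using le_S le_refl by blast
next
  case (insert x F)
  then obtain m where m: "m \<in> F" "\<forall>y\<in>F. y \<sqsubseteq> m" by auto
  then show ?case using chain[of x z m] insert.prems le_trans le_refl le_S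
    by (metis insert_iff)
qed

text \<open>Serves to find the least vertex above a point: closure under meets gives the set of
  vertices above it an infimum inside \<open>V\<close>.\<close>

lemma finite_meet:
  assumes "finite A" "A \<noteq> {}" "A \<subseteq> V" "tset V"
  shows "\<exists>m\<in>V. (\<forall>x\<in>A. m \<sqsubseteq> x) \<and> (\<forall>c. (\<forall>x\<in>A. c \<sqsubseteq> x) \<longrightarrow> c \<sqsubseteq> m)"
  using assms
proof (induction A rule: finite_ne_induct)
  case (singleton x)
  then show ?case using le_refl tsetD(2)[of V] by (metis insert_subset singleton_iff subsetD)
next
  case (insert x F)
  then obtain m where m: "m \<in> V" "\<forall>y\<in>F. m \<sqsubseteq> y" "\<forall>c. (\<forall>x\<in>F. c \<sqsubseteq> x) \<longrightarrow> c \<sqsubseteq> m" by auto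
  have xV: "x \<in> V" "x \<in> S" "m \<in> S" using insert.prems m tsetD(2) by auto
  have "mt x m \<in> V" using xV m tsetD(4) insert.prems by blast
  moreover have "\<forall>y\<in>insert x F. mt x m \<sqsubseteq> y"
    using m mt1[OF xV(2,3)] mt2[OF xV(2,3)] le_trans by blast
  moreover have "\<forall>c. (\<forall>y\<in>insert x F. c \<sqsubseteq> y) \<longrightarrow> c \<sqsubseteq> mt x m"
    using m mt_greatest by blast
  ultimately show ?case by blast
qed

lemma edgeD:
  assumes "edge V u v"
  shows "u \<in> V" "v \<in> V" "u \<sqsubset> v" "u \<sqsubseteq> v" "\<And>w. w \<in> V \<Longrightarrow> w \<sqsubset> v \<Longrightarrow> w \<sqsubseteq> u"
  using assms by (auto simp: edge_def lt_def)

lemma edge_ex: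
  assumes "tset V" "v \<in> V" "v \<noteq> rt"
  shows "\<exists>u. edge V u v"
proof -
  have v: "v \<in> S" using assms tsetD(2) by blast
  have "rt \<in> {w\<in>V. w \<sqsubset> v}" using assms tsetD(3) le_rt v by (auto simp: lt_def)
  moreover have "finite {w\<in>V. w \<sqsubset> v}" using assms tsetD(1) by simp
  ultimately obtain m where "m\<in>{w\<in>V. w \<sqsubset> v}" "\<forall>x\<in>{w\<in>V. w \<sqsubset> v}. x \<sqsubseteq> m"
    using finite_chain_greatest[of "{w\<in>V. w \<sqsubset> v}" v] lt_le by blast
  then show ?thesis using assms unfolding edge_def by auto
qed

lemma edge_unique: "edge V u v \<Longrightarrow> edge V u' v \<Longrightarrow> u = u'"
  using edgeD le_antisym by metis

lemma ap_props:
  assumes "tset V" "x \<in> S"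
  shows "ap V x \<in> V" "ap V x \<sqsubseteq> x" "\<And>w. w \<in> V \<Longrightarrow> w \<sqsubseteq> x \<Longrightarrow> w \<sqsubseteq> ap V x"
proof -
  have "rt \<in> {w\<in>V. w \<sqsubseteq> x}" using assms tsetD(3) le_rt by auto
  moreover have "finite {w\<in>V. w \<sqsubseteq> x}" using assms tsetD(1) by simp
  ultimately obtain m where m: "m\<in>{w\<in>V. w \<sqsubseteq> x}" "\<forall>y\<in>{w\<in>V. w \<sqsubseteq> x}. y \<sqsubseteq> m"
    using finite_chain_greatest[of "{w\<in>V. w \<sqsubseteq> x}" x] by blast
  have "ap V x = m" unfolding ap_def
  proof (rule the_equality)
    show "m \<in> V \<and> m \<sqsubseteq> x \<and> (\<forall>w\<in>V. w \<sqsubseteq> x \<longrightarrow> w \<sqsubseteq> m)" using m by auto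
    fix a assume "a \<in> V \<and> a \<sqsubseteq> x \<and> (\<forall>w\<in>V. w \<sqsubseteq> x \<longrightarrow> w \<sqsubseteq> a)"
    then show "a = m" using m le_antisym by blast
  qed
  then show "ap V x \<in> V" "ap V x \<sqsubseteq> x" "\<And>w. w \<in> V \<Longrightarrow> w \<sqsubseteq> x \<Longrightarrow> w \<sqsubseteq> ap V x"
    using m by auto
qed

lemma above_ex:
  assumes "tset V" "x \<in> down V"
  shows "\<exists>v\<in>V. x \<sqsubseteq> v \<and> (\<forall>w\<in>V. x \<sqsubseteq> w \<longrightarrow> v \<sqsubseteq> w)"
proof -
  have "{w\<in>V. x \<sqsubseteq> w} \<noteq> {}" using assms by (auto simp: down_def)
  moreover have "finite {w\<in>V. x \<sqsubseteq> w}" using assms tsetD(1) by simp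
  ultimately obtain m where m: "m\<in>V" "\<forall>y\<in>{w\<in>V. x \<sqsubseteq> w}. m \<sqsubseteq> y"
    "\<forall>c. (\<forall>y\<in>{w\<in>V. x \<sqsubseteq> w}. c \<sqsubseteq> y) \<longrightarrow> c \<sqsubseteq> m"
    using finite_meet[of "{w\<in>V. x \<sqsubseteq> w}" V] assms by auto
  then show ?thesis by auto
qed

lemma down_S: "x \<in> down V \<Longrightarrow> x \<in> S"
  using le_S by (auto simp: down_def)

lemma down_le: "x \<in> down V \<Longrightarrow> y \<sqsubseteq> x \<Longrightarrow> y \<in> down V"
  using le_trans by (auto simp: down_def)

lemma down_sup: "V \<subseteq> S \<Longrightarrow> V \<subseteq> down V"
  using le_refl by (auto simp: down_def)

lemma down_mono: "V \<subseteq> W \<Longrightarrow> down V \<subseteq> down W"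
  by (auto simp: down_def)

lemma down_cases:
  assumes "tset V" "x \<in> down V" "x \<notin> V"
  obtains u v where "edge V u v" "u \<sqsubset> x" "x \<sqsubset> v"
proof -
  obtain v where v: "v \<in> V" "x \<sqsubseteq> v" "\<forall>w\<in>V. x \<sqsubseteq> w \<longrightarrow> v \<sqsubseteq> w" using above_ex assms by blast
  have xv: "x \<sqsubset> v" using v assms(3) by (auto simp: lt_def)
  have "v \<noteq> rt" using not_le_lt[OF xv] le_rt[OF down_S[OF assms(2)]] by blast
  then obtain u where u: "edge V u v" using edge_ex[OF assms(1) v(1)] by blast
  have "u \<sqsubseteq> x \<or> x \<sqsubset> u" using chain_cases[OF edgeD(4)[OF u] v(2)] .
  moreover have "\<not> x \<sqsubseteq> u" using v(3) edgeD(1)[OF u] not_le_lt[OF edgeD(3)[OF u]] by blast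
  ultimately have "u \<sqsubset> x" using assms(3) edgeD(1)[OF u] unfolding lt_def by auto
  then show ?thesis using that u xv by blast
qed

text \<open>The vertex \<open>mt v w\<close> is above \<open>x\<close>, hence not below
  \<open>u\<close>, so it cannot lie strictly below \<open>v\<close> and must be \<open>v\<close>
  itself.\<close>

lemma edge_above:
  assumes "tset V" "edge V u v" "u \<sqsubset> x" "x \<sqsubseteq> v" "x \<sqsubseteq> w" "w \<in> V"
  shows "v \<sqsubseteq> w"
proof -
  have S: "v \<in> S" "w \<in> S" using assms(4,5) le_S2 by auto
  have m: "mt v w \<in> V" "mt v w \<sqsubseteq> v" using tsetD(4)[OF assms(1)] edgeD(2)[OF assms(2)] assms(6) mt1[OF S] by auto
  have "x \<sqsubseteq> mt v w" using mt_greatest assms by blast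
  then have "\<not> mt v w \<sqsubset> v" using edgeD(5)[OF assms(2)] m assms le_trans not_le_lt by blast
  then have "mt v w = v" using m lt_def by blast
  then show ?thesis using mt2 S by metis
qed

text \<open>The vertex \<open>mt v y\<close> is below \<open>v\<close> but not above
  \<open>x\<close>, hence strictly below \<open>v\<close> and so below \<open>u\<close>. Common
  lower bounds of \<open>x\<close> and \<open>y\<close> lie below it.\<close>

lemma edge_below:
  assumes "tset V" "edge V u v" "u \<sqsubset> x" "x \<sqsubset> v" "y \<in> down V" "\<not> x \<sqsubseteq> y" "w \<sqsubseteq> x" "w \<sqsubseteq> y" "y \<in> V"
  shows "w \<sqsubseteq> u"
proof -
  have S: "v \<in> S" "y \<in> S" using lt_le[OF assms(4)] le_S2 tsetD(2)[OF assms(1)] assms(9) by auto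
  have m: "mt v y \<in> V" "mt v y \<sqsubseteq> v" using tsetD(4)[OF assms(1)] edgeD(2)[OF assms(2)] assms(9) mt1[OF S] by auto
  have "\<not> x \<sqsubseteq> mt v y" using assms(6) mt2[OF S] le_trans by blast
  then have "mt v y \<sqsubset> v" using m(2) lt_le[OF assms(4)] unfolding lt_def by auto
  then have "mt v y \<sqsubseteq> u" using edgeD(5)[OF assms(2)] m by blast
  moreover have "w \<sqsubseteq> mt v y" using mt_greatest assms le_trans lt_le by blast
  ultimately show ?thesis using le_trans by blast
qed

text \<open>A vertex lies above \<open>v\<close> or branches off at or below \<open>u\<close>, so
  the arc to it from inside the edge passes an end of the edge. This keeps the centres of pure cuts
  apart when steps are counted.\<close>

lemma edge_sep:
  assumes "tset V" "edge V u v" "u \<sqsubset> x" "x \<sqsubset> v" "y \<in> V" "s \<le> D u x" "s \<le> D x v"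
  shows "s \<le> D x y"
proof (cases "x \<sqsubseteq> y")
  case True
  have "v \<sqsubseteq> y" using edge_above[OF assms(1-3) lt_le[OF assms(4)] True assms(5)] .
  then have "D x v \<le> D x y" using mono[of x x v y] lt_le[OF assms(4)] le_refl[OF le_S1] by blast
  then show ?thesis using assms by simp
next
  case False
  have S: "x \<in> S" "y \<in> S" using lt_le[OF assms(4)] le_S1 tsetD(2)[OF assms(1)] assms(5) by auto
  have "mt x y \<sqsubseteq> u"
    using edge_below[OF assms(1-4) _ False mt1[OF S] mt2[OF S] assms(5)] down_sup assms tsetD(2) by blast
  then have "D u x \<le> D (mt x y) x" using mono[of "mt x y" u x x] assms lt_le le_refl S by blast
  then show ?thesis using D_mt[OF S] assms by simp
qed

text \<open>The meets of \<open>x\<close> with the finitely many vertices all lie below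
  \<open>x\<close>, hence form a chain; the greatest of them is the projection.\<close>

lemma proj_ex:
  assumes "tset V" "x \<in> S"
  shows "\<exists>q. proj V q x"
proof -
  let ?A = "(\<lambda>v. mt x v) ` V"
  have "finite ?A" "?A \<noteq> {}" using assms tsetD by auto
  moreover have "\<And>y. y \<in> ?A \<Longrightarrow> y \<sqsubseteq> x" using mt1 assms tsetD(2) by blast
  ultimately obtain m where m: "m \<in> ?A" "\<forall>y\<in>?A. y \<sqsubseteq> m" using finite_chain_greatest by metis
  then obtain v where v: "v \<in> V" "m = mt x v" by blast
  have vS: "v \<in> S" using v assms tsetD by blast
  have "m \<in> down V" using v mt2[OF assms(2) vS] by (auto simp: down_def)
  moreover have "m \<sqsubseteq> x" using v mt1[OF assms(2) vS] by simp
  moreover have "w \<sqsubseteq> m" if w: "w \<in> down V" "w \<sqsubseteq> x" for w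
  proof -
    obtain v' where "v' \<in> V" "w \<sqsubseteq> v'" using w by (auto simp: down_def)
    then have "w \<sqsubseteq> mt x v'" "mt x v' \<in> ?A" using mt_greatest w by auto
    then show ?thesis using m le_trans by blast
  qed
  ultimately show ?thesis unfolding proj_def by blast
qed

lemma projD:
  assumes "proj V q x"
  shows "q \<in> down V" "q \<sqsubseteq> x" "\<And>w. w \<in> down V \<Longrightarrow> w \<sqsubseteq> x \<Longrightarrow> w \<sqsubseteq> q"
  using assms by (auto simp: proj_def)

text \<open>The meet of \<open>q\<close> with a point of the subtree lies in the subtree and below
  \<open>p\<close>, hence below the base \<open>c\<close>. So the arc from \<open>q\<close> to that
  point first runs down to \<open>c\<close>.\<close>

lemma proj_sep:
  assumes "proj V c p" "c \<sqsubseteq> q" "q \<sqsubseteq> p" "y \<in> down V"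
  shows "D c q \<le> D q y"
proof -
  have S: "q \<in> S" "y \<in> S" using assms le_S1 down_S by auto
  have "mt q y \<in> down V" using down_le[OF assms(4) mt2[OF S]] .
  then have "mt q y \<sqsubseteq> c" using projD(3)[OF assms(1)] mt1[OF S] assms(3) le_trans by blast
  then have "D c q \<le> D (mt q y) q" using mono[of "mt q y" c q q] assms(2) le_refl[OF S(1)] by blast
  then show ?thesis using D_mt[OF S] by simp
qed

section \<open>Refining finite subtrees\<close>

text \<open>
  An edge is cut at \<open>c\<close> together with two further points \<open>a\<close> and \<open>b\<close>: the end pieces then keep the
  density of the edge, and only the two middle pieces absorb the excess of \<open>D\<close> under subdivision.
  Thus densities next to old vertices never change.
\<close>

definition cutpts where
  "cutpts V u a c b v \<longleftrightarrow> edge V u v \<and> u \<sqsubset> a \<and> a \<sqsubset> c \<and> c \<sqsubset> b \<and> b \<sqsubset> v \<and>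
     D u a = D u c / 4 \<and> D b v = D c v / 4"

definition gaps where
  "gaps V = {D u v |u v. edge V u v} \<union> {D q x |q x. x \<in> S \<and> proj V q x}"

text \<open>
  The factor \<open>1 / 2\<close> leaves room to realise \<open>msh V\<close> exactly: some gap is at least \<open>msh V\<close>, so by
  continuity a hair of \<open>D\<close>-length equal to \<open>msh V\<close> can be attached.
\<close>

definition msh where "msh V = Sup (gaps V) / 2"

lemma cutpts_ex:
  assumes "edge V u v" "u \<sqsubset> c" "c \<sqsubset> v"
  shows "\<exists>a b. cutpts V u a c b v"
proof -
  have p: "0 < D u c" "0 < D c v" using lt_D_pos assms by auto
  obtain a where a: "u \<sqsubseteq> a" "a \<sqsubseteq> c" "D u a = D u c / 4"
    using ivt_up[of u c "D u c / 4"] lt_le[OF assms(2)] p by auto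
  obtain b where b: "c \<sqsubseteq> b" "b \<sqsubseteq> v" "D b v = D c v / 4"
    using ivt_down[of c v "D c v / 4"] lt_le[OF assms(3)] p by auto
  have z: "D u u = 0" "D v v = 0" using D_zero le_S1 le_S2 a b by auto
  have "u \<noteq> a" "a \<noteq> c" "c \<noteq> b" "b \<noteq> v" using a b z p by auto
  then show ?thesis using a b assms(1) unfolding cutpts_def lt_def by auto
qed

lemma cutptsD:
  assumes "cutpts V u a c b v"
  shows "edge V u v" "u \<sqsubset> a" "a \<sqsubset> c" "c \<sqsubset> b" "b \<sqsubset> v" "D u a = D u c / 4" "D b v = D c v / 4"
    "u \<sqsubset> c" "c \<sqsubset> v" "a \<sqsubset> v" "u \<sqsubset> b" "a \<sqsubset> b"
  using assms le_lt_trans lt_le unfolding cutpts_def by blast+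

lemma not_in_edge: "edge V u v \<Longrightarrow> u \<sqsubset> x \<Longrightarrow> x \<sqsubset> v \<Longrightarrow> x \<notin> V"
  using edgeD(5) not_le_lt by blast

text \<open>For a vertex \<open>y\<close> not above \<open>x\<close>, the meet with \<open>x\<close>
  equals the meet with the lower end \<open>u\<close> of the edge, which is already in
  \<open>V\<close>.\<close>

lemma tset_insert_down:
  assumes "tset V" "edge V u v" "u \<sqsubset> x" "x \<sqsubset> v"
  shows "tset (insert x V)"
proof -
  have xS: "x \<in> S" using lt_le[OF assms(4)] le_S1 by blast
  note V = tsetD[OF assms(1)]
  have "mt x y \<in> insert x V \<and> mt y x \<in> insert x V" if y: "y \<in> V" for y
  proof (cases "x \<sqsubseteq> y")
    case True
    then show ?thesis using mt_eq_le mt_commute[of x y] xS V(2) y by auto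
  next
    case False
    have yS: "y \<in> S" using y V by blast
    have vV: "u \<in> V" "v \<in> V" using edgeD[OF assms(2)] by auto
    then have uS: "u \<in> S" using V by auto
    have "mt x y \<sqsubseteq> u"
      using edge_below[OF assms(1-4) _ False mt1[OF xS yS] mt2[OF xS yS] y] down_sup V y by blast
    then have "mt x y \<sqsubseteq> mt u y" using mt_greatest mt2[OF xS yS] by blast
    moreover have "mt u y \<sqsubseteq> mt x y"
      using mt_greatest mt1[OF uS yS] mt2[OF uS yS] lt_le[OF assms(3)] le_trans by blast
    ultimately have "mt x y = mt u y" using le_antisym by blast
    then show ?thesis using V(4)[OF vV(1) y] mt_commute[OF xS yS] by auto
  qed
  moreover have "mt x x = x" using mt_eq_le le_refl xS by blast
  ultimately show ?thesis using V xS unfolding tset_def by auto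
qed

lemma edge_insert:
  assumes "tset V" "edge V u v" "u \<sqsubset> x" "x \<sqsubset> v"
  shows "edge (insert x V) y z \<longleftrightarrow> (edge V y z \<and> z \<noteq> v) \<or> (y = u \<and> z = x) \<or> (y = x \<and> z = v)"
proof -
  have xV: "x \<notin> V" using not_in_edge assms by blast
  have ux: "edge (insert x V) u x"
    using assms(2-4) xV lt_irrefl unfolding edge_def by (metis insert_iff le_lt_trans lt_le)
  have xu: "x \<sqsubseteq> x" "u \<sqsubseteq> x" using assms lt_le le_S1 le_refl by blast+
  have xv: "edge (insert x V) x v"
    unfolding edge_def using assms(4) edgeD[OF assms(2)] xu le_trans by blast
  have 1: "edge (insert x V) y z" if e: "edge V y z" "z \<noteq> v" for y z
  proof -
    have "\<not> x \<sqsubset> z \<or> x \<sqsubseteq> y"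
    proof -
      have "x \<sqsubseteq> y" if "x \<sqsubset> z"
      proof -
        have "v \<sqsubseteq> z" using edge_above[OF assms(1-3) lt_le[OF assms(4)] lt_le[OF that]] edgeD(2)[OF e(1)] .
        then have "v \<sqsubset> z" using e unfolding lt_def by auto
        then have "v \<sqsubseteq> y" using edgeD(5)[OF e(1)] edgeD(2)[OF assms(2)] by blast
        then show "x \<sqsubseteq> y" using lt_le[OF assms(4)] le_trans by blast
      qed
      then show ?thesis by blast
    qed
    then show ?thesis using e(1) unfolding edge_def by blast
  qed
  have 2: "(edge V y z \<and> z \<noteq> v) \<or> (y = u \<and> z = x) \<or> (y = x \<and> z = v)" if e: "edge (insert x V) y z"
  proof -
    consider "z = x" | "z = v" | "z \<noteq> x" "z \<noteq> v" by blast
    then show ?thesis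
    proof cases
      case 1
      then show ?thesis using edge_unique ux e by blast
    next
      case 2
      then show ?thesis using edge_unique xv e by blast
    next
      case 3
      then have zV: "z \<in> V" using edgeD[OF e] by blast
      have "z \<noteq> rt" using edgeD(3)[OF e] edgeD(1)[OF e] not_le_lt le_rt lt_le le_S1 by blast
      then obtain y' where y': "edge V y' z" using edge_ex[OF assms(1) zV] by blast
      then have "edge (insert x V) y' z" using 1 3 by blast
      then show ?thesis using edge_unique e y' 3 by blast
    qed
  qed
  show ?thesis using 1 2 ux xv by blast
qed

lemma cut_facts:
  assumes V: "tset V" and c: "cutpts V u a c b v"
  shows "tset (V \<union> {a, c, b})"
    "edge (V \<union> {a, c, b}) y z \<longleftrightarrow> (edge V y z \<and> z \<noteq> v) \<or> (y = u \<and> z = a) \<or> (y = a \<and> z = c)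
       \<or> (y = c \<and> z = b) \<or> (y = b \<and> z = v)"
    "a \<notin> V" "c \<notin> V" "b \<notin> V" "a \<noteq> c" "a \<noteq> b" "b \<noteq> c" "down (V \<union> {a, c, b}) = down V"
proof -
  note C = cutptsD[OF c]
  show n: "a \<notin> V" "c \<notin> V" "b \<notin> V"
    using not_in_edge[OF C(1)] C(2,5,8-11) by auto
  show n2: "a \<noteq> c" "a \<noteq> b" "b \<noteq> c" using C unfolding lt_def by auto
  have vV: "v \<in> V" using edgeD[OF C(1)] by blast
  have t1: "tset (insert a V)" using tset_insert_down[OF V C(1,2,10)] .
  have e1: "edge (insert a V) y z \<longleftrightarrow> (edge V y z \<and> z \<noteq> v) \<or> (y = u \<and> z = a) \<or> (y = a \<and> z = v)" for y z
    using edge_insert[OF V C(1,2,10)] .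
  have av: "edge (insert a V) a v" using e1 by blast
  have t2: "tset (insert c (insert a V))"
    using tset_insert_down[OF t1 av C(3,9)] .
  have e2: "edge (insert c (insert a V)) y z \<longleftrightarrow> (edge (insert a V) y z \<and> z \<noteq> v) \<or> (y = a \<and> z = c) \<or> (y = c \<and> z = v)" for y z
    using edge_insert[OF t1 av C(3,9)] .
  have cv: "edge (insert c (insert a V)) c v" using e2 by blast
  have t3: "tset (insert b (insert c (insert a V)))"
    using tset_insert_down[OF t2 cv C(4,5)] .
  have e3: "edge (insert b (insert c (insert a V))) y z \<longleftrightarrow> (edge (insert c (insert a V)) y z \<and> z \<noteq> v) \<or> (y = c \<and> z = b) \<or> (y = b \<and> z = v)" for y z
    using edge_insert[OF t2 cv C(4,5)] .
  have eq: "insert b (insert c (insert a V)) = V \<union> {a, c, b}" by auto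
  show "tset (V \<union> {a, c, b})" using t3 eq by simp
  show "edge (V \<union> {a, c, b}) y z \<longleftrightarrow> (edge V y z \<and> z \<noteq> v) \<or> (y = u \<and> z = a) \<or> (y = a \<and> z = c)
       \<or> (y = c \<and> z = b) \<or> (y = b \<and> z = v)"
    unfolding eq[symmetric] e3 e2 e1 using n vV C n2 by blast
  show "down (V \<union> {a, c, b}) = down V"
    unfolding down_def using vV C(5,9,10) lt_le le_trans by blast
qed

lemma hair_facts:
  assumes V: "tset V" and c: "proj V c p" "c \<in> V" "p \<noteq> c"
  shows "tset (insert p V)"
    "edge (insert p V) y z \<longleftrightarrow> edge V y z \<or> (y = c \<and> z = p)"
    "p \<notin> down V" "p \<notin> V"
proof -
  note W = tsetD[OF V]
  have pS: "p \<in> S" using projD(2)[OF c(1)] le_S2 by blast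
  have cp: "c \<sqsubset> p" using projD(2)[OF c(1)] c(3) unfolding lt_def by auto
  show ph: "p \<notin> down V" using projD(3)[OF c(1)] le_refl[OF pS] cp not_le_lt by blast
  then show "p \<notin> V" using down_sup W by blast
  have "mt p y \<in> insert p V \<and> mt y p \<in> insert p V" if y: "y \<in> V" for y
  proof -
    have yS: "y \<in> S" "c \<in> S" using y W c by blast+
    have "mt p y \<in> down V" using down_le mt2[OF pS yS(1)] down_sup W y by blast
    then have "mt p y \<sqsubseteq> c" using projD(3)[OF c(1)] mt1[OF pS yS(1)] by blast
    then have "mt p y \<sqsubseteq> mt c y" using mt_greatest mt2[OF pS yS(1)] by blast
    moreover have "mt c y \<sqsubseteq> mt p y"
      using mt_greatest mt1[OF yS(2,1)] mt2[OF yS(2,1)] lt_le[OF cp] le_trans by blast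
    ultimately have "mt p y = mt c y" using le_antisym by blast
    then show ?thesis using W(4)[OF c(2) y] mt_commute[OF pS yS(1)] by auto
  qed
  moreover have "mt p p = p" using mt_eq_le le_refl pS by blast
  ultimately show "tset (insert p V)" using W pS unfolding tset_def by auto
  have cpe: "edge (insert p V) c p"
  proof -
    have "w \<sqsubseteq> c" if "w \<in> insert p V" "w \<sqsubset> p" for w
      using that projD(3)[OF c(1)] down_sup[OF W(2)] lt_le lt_irrefl by blast
    then show ?thesis unfolding edge_def using cp c by blast
  qed
  have 1: "edge (insert p V) y z" if e: "edge V y z"
  proof -
    have "\<not> p \<sqsubset> z" using ph edgeD(2)[OF e] lt_le unfolding down_def by blast
    then show ?thesis using e unfolding edge_def by blast
  qed
  have "edge V y z" if e: "edge (insert p V) y z" "z \<noteq> p"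
  proof -
    have zV: "z \<in> V" using edgeD[OF e(1)] e by blast
    have "z \<noteq> rt" using edgeD(3)[OF e(1)] edgeD(1)[OF e(1)] not_le_lt le_rt lt_le le_S1 by blast
    then obtain y' where y': "edge V y' z" using edge_ex[OF V zV] by blast
    then show ?thesis using edge_unique e 1
      by (metis (no_types, lifting) edgeD(1-4) edge_def le_antisym insert_iff ph y' down_def mem_Collect_eq)
  qed
  then show "edge (insert p V) y z \<longleftrightarrow> edge V y z \<or> (y = c \<and> z = p)"
    using 1 cpe edge_unique by blast
qed

lemma gaps_bdd: "bdd_above (gaps V)"
proof -
  obtain \<Delta> where \<Delta>: "\<forall>x\<in>S. \<forall>y\<in>S. D x y \<le> \<Delta>" using bounded by blast
  have "g \<le> \<Delta>" if "g \<in> gaps V" for g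
    using that \<Delta> edgeD(4) projD(2) le_S1 le_S2 unfolding gaps_def by blast
  then show ?thesis by (rule bdd_aboveI)
qed

lemma msh_bounds:
  shows "edge V u v \<Longrightarrow> D u v \<le> 2 * msh V" "proj V q x \<Longrightarrow> D q x \<le> 2 * msh V"
proof -
  assume "edge V u v"
  then have "D u v \<in> gaps V" unfolding gaps_def by blast
  then show "D u v \<le> 2 * msh V" using cSup_upper[OF _ gaps_bdd] unfolding msh_def by force
next
  assume "proj V q x"
  then have "D q x \<in> gaps V" unfolding gaps_def using projD(2) le_S2 by blast
  then show "D q x \<le> 2 * msh V" using cSup_upper[OF _ gaps_bdd] unfolding msh_def by force
qed

lemma msh_least:
  assumes "tset V" "v \<in> V" "v \<noteq> rt"
    "\<And>u v. edge V u v \<Longrightarrow> D u v \<le> s" "\<And>q x. proj V q x \<Longrightarrow> D q x \<le> s"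
  shows "2 * msh V \<le> s"
proof -
  obtain u where u: "edge V u v" using edge_ex assms by blast
  then have "gaps V \<noteq> {}" unfolding gaps_def by blast
  moreover have "\<And>g. g \<in> gaps V \<Longrightarrow> g \<le> s" using assms unfolding gaps_def by blast
  ultimately show ?thesis using cSup_least[of "gaps V" s] unfolding msh_def by auto
qed

lemma msh_pos:
  assumes "tset V" "v \<in> V" "v \<noteq> rt"
  shows "0 < msh V"
proof -
  obtain u where u: "edge V u v" using edge_ex assms by blast
  then show ?thesis using msh_bounds(1)[OF u] lt_D_pos[OF edgeD(3)[OF u]] by linarith
qed

lemma msh_witness:
  assumes "tset V" "v \<in> V" "v \<noteq> rt"
  shows "(\<exists>u v. edge V u v \<and> msh V < D u v) \<or> (\<exists>q x. proj V q x \<and> msh V < D q x)"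
proof (rule ccontr)
  assume "\<not> ?thesis"
  then have "2 * msh V \<le> msh V" using msh_least[OF assms, of "msh V"] by force
  then show False using msh_pos[OF assms] by linarith
qed

text \<open>In the first alternative for \<open>V'\<close> the centre \<open>c\<close> lies strictly
  inside an edge, which excludes \<open>c \<in> V\<close> and forces the cut; the bounds
  \<open>msh V / 2\<close> keep such centres apart. In the second a hair of length
  \<open>msh V\<close> grows from \<open>c\<close>, after a cut at \<open>c\<close> if
  \<open>c\<close> is not yet a vertex.\<close>

definition gstep where
  "gstep V c V' \<longleftrightarrow> (\<exists>V1.
     (V1 = V \<and> c \<in> V \<or> (\<exists>u a b v. cutpts V u a c b v \<and> V1 = V \<union> {a, c, b})) \<and>
     (V' = V1 \<and> (\<exists>u v. edge V u v \<and> u \<sqsubset> c \<and> c \<sqsubset> v \<and> msh V / 2 \<le> D u c \<and> msh V / 2 \<le> D c v) \<or>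
      (\<exists>p. proj V c p \<and> p \<noteq> c \<and> D c p = msh V \<and> V' = insert p V1)))"

lemma proj_cut:
  assumes "down V1 = down V" "proj V c p"
  shows "proj V1 c p"
  using assms unfolding proj_def by simp

lemma gstep_ex:
  assumes V: "tset V" "v0 \<in> V" "v0 \<noteq> rt"
  shows "\<exists>c V'. gstep V c V'"
proof -
  have m: "0 < msh V" using msh_pos assms by blast
  consider (e) u v where "edge V u v" "msh V < D u v" | (h) q x where "proj V q x" "msh V < D q x"
    using msh_witness[OF assms] by blast
  then show ?thesis
  proof cases
    case e
    \<comment> \<open>\<open>c\<close> halves \<open>D u v\<close> as seen from \<open>u\<close>; by
      the triangle inequality the upper part is at least as long.\<close>
    obtain c where c: "u \<sqsubseteq> c" "c \<sqsubseteq> v" "D u c = D u v / 2"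
      using ivt_up[of u v "D u v / 2"] edgeD(4)[OF e(1)] e m by auto
    have S: "u \<in> S" "c \<in> S" "v \<in> S" using c le_S1 le_S2 by blast+
    have "D u v \<le> D u c + D c v" using D_tri S by blast
    then have d: "msh V / 2 \<le> D u c" "msh V / 2 \<le> D c v" using c(3) e(2) by auto
    then have "u \<noteq> c" "c \<noteq> v" using D_zero S m by fastforce+
    then have l: "u \<sqsubset> c" "c \<sqsubset> v" using c unfolding lt_def by auto
    then obtain a b where ab: "cutpts V u a c b v" using cutpts_ex e by blast
    have "gstep V c (V \<union> {a,c,b})" unfolding gstep_def
      by (rule exI[of _ "V \<union> {a,c,b}"]) (use ab e l d in blast)
    then show ?thesis by blast
  next
    case h
    obtain p where p: "q \<sqsubseteq> p" "p \<sqsubseteq> x" "D q p = msh V"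
      using ivt_up[of q x "msh V"] projD(2)[OF h(1)] h m by auto
    have "q \<in> S" using p le_S1 by blast
    then have "p \<noteq> q" using p(3) m D_zero by fastforce
    have pp: "proj V q p" using h(1) p le_trans unfolding proj_def by blast
    show ?thesis
    proof (cases "q \<in> V")
      case True
      then have "gstep V q (insert p V)" unfolding gstep_def using pp p \<open>p \<noteq> q\<close> by blast
      then show ?thesis by blast
    next
      case False
      then obtain u v where e: "edge V u v" "u \<sqsubset> q" "q \<sqsubset> v" using down_cases[OF V(1) projD(1)[OF h(1)]] by blast
      then obtain a b where ab: "cutpts V u a q b v" using cutpts_ex by blast
      have "gstep V q (insert p (V \<union> {a,q,b}))" unfolding gstep_def
        by (rule exI[of _ "V \<union> {a,q,b}"]) (use ab p pp \<open>p \<noteq> q\<close> in blast)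
      then show ?thesis by blast
    qed
  qed
qed

text \<open>What the counting of vertices needs: few new vertices per step, new vertices close to
  the centre when measured against old comparable ones, and either a centre far from the old
  vertices or a hair whose points are far from the old subtree.\<close>

lemma gstep_facts:
  assumes V: "tset V" "v0 \<in> V" "v0 \<noteq> rt" and g: "gstep V c V'"
  shows "tset V'" "V \<subseteq> V'" "c \<in> V'" "msh V' \<le> msh V" "card (V' - V) \<le> 4"
    "\<And>x y. x \<in> V' \<Longrightarrow> x \<notin> V \<Longrightarrow> y \<in> V \<Longrightarrow> x \<sqsubseteq> y \<or> y \<sqsubseteq> x \<Longrightarrow> D x c \<le> 4 * D x y"
    "(\<forall>y\<in>V. msh V / 2 \<le> D c y) \<or>
     (\<forall>s. 0 \<le> s \<longrightarrow> s \<le> msh V \<longrightarrow> (\<exists>q\<in>down V'. D c q = s \<and> (\<forall>y\<in>down V. s \<le> D q y)))"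
proof -
  have m: "0 < msh V" using msh_pos V by blast
  obtain V1 where V1: "V1 = V \<and> c \<in> V \<or> (\<exists>u a b v. cutpts V u a c b v \<and> V1 = V \<union> {a, c, b})"
    and V2: "V' = V1 \<and> (\<exists>u v. edge V u v \<and> u \<sqsubset> c \<and> c \<sqsubset> v \<and> msh V / 2 \<le> D u c \<and> msh V / 2 \<le> D c v) \<or>
      (\<exists>p. proj V c p \<and> p \<noteq> c \<and> D c p = msh V \<and> V' = insert p V1)"
    using g unfolding gstep_def by (elim exE conjE) (rule that)
  have V1f: "tset V1 \<and> V \<subseteq> V1 \<and> c \<in> V1 \<and> down V1 = down V \<and> card (V1 - V) \<le> 3 \<and>
     (\<forall>x z. edge V1 x z \<longrightarrow> D x z \<le> 2 * msh V) \<and>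
     (\<forall>x y. x \<in> V1 \<longrightarrow> x \<notin> V \<longrightarrow> y \<in> V \<longrightarrow> x \<sqsubseteq> y \<or> y \<sqsubseteq> x \<longrightarrow> D x c \<le> 4 * D x y)"
    using V1
  proof (elim disjE exE conjE)
    assume "V1 = V" "c \<in> V"
    then show ?thesis using V msh_bounds by auto
  next
    fix u a b v assume C: "cutpts V u a c b v" and eq: "V1 = V \<union> {a, c, b}"
    note F = cut_facts[OF V(1) C]
    note CC = cutptsD[OF C]
    have uv: "D u v \<le> 2 * msh V" using msh_bounds CC by blast
    have bd: "D x z \<le> D u v" if "u \<sqsubseteq> x" "x \<sqsubset> z" "z \<sqsubseteq> v" for x z
      using mono that lt_le by blast
    have uuvv: "u \<sqsubseteq> u" "v \<sqsubseteq> v"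
      using le_refl[OF le_S1[OF edgeD(4)[OF CC(1)]]] le_refl[OF le_S2[OF edgeD(4)[OF CC(1)]]] by auto
    note CL = CC(2-5,8-12)[THEN lt_le]
    have pieces: "D u a \<le> D u v" "D a c \<le> D u v" "D c b \<le> D u v" "D b v \<le> D u v"
      using bd[OF uuvv(1) CC(2) CL(7)] bd[OF CL(1) CC(3) CL(6)] bd[OF CL(5) CC(4) CL(4)]
        bd[OF CL(8) CC(5) uuvv(2)] by auto
    have "D x z \<le> 2 * msh V" if "edge V1 x z" for x z
      using that[unfolded eq F(2)]
    proof (elim disjE)
      assume "edge V x z \<and> z \<noteq> v" then show ?thesis using msh_bounds(1) by blast
    qed (use pieces uv in auto)
    then have "\<forall>x z. edge V1 x z \<longrightarrow> D x z \<le> 2 * msh V" by blast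
    \<comment> \<open>The factor 4 stems from the position of \<open>a\<close> and \<open>b\<close>:
      the piece next to an old vertex is a quarter of the distance from that vertex to
      \<open>c\<close>.\<close>
    moreover have "D x c \<le> 4 * D x y" if x: "x \<in> V1" "x \<notin> V" and y: "y \<in> V" and xy: "x \<sqsubseteq> y \<or> y \<sqsubseteq> x" for x y
    proof -
      have xx: "x \<in> {a,c,b}" using x eq by auto
      have uxv: "u \<sqsubset> x" "x \<sqsubset> v" using xx CC by auto
      have S: "u \<in> S" "a \<in> S" "b \<in> S" "c \<in> S" "v \<in> S" "x \<in> S" "y \<in> S"
        using CL(1,2,3,4) lt_le[OF uxv(1)] le_S1 le_S2 y tsetD(2)[OF V(1)] by auto
      have D0: "D c c = 0" using D_zero S by simp
      have up: "v \<sqsubseteq> y" if "x \<sqsubseteq> y" using edge_above[OF V(1) CC(1) uxv(1) lt_le[OF uxv(2)] that y] .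
      have dn: "y \<sqsubseteq> u" if "y \<sqsubseteq> x"
        using edgeD(5)[OF CC(1) y] le_lt_trans[OF that uxv(2)] .
      consider "x = c" | "x = a" | "x = b" using xx by blast
      then show ?thesis
      proof cases
        case 1 then show ?thesis using D0 D_nonneg[of x y] by simp
      next
        case 2
        show ?thesis
        proof (cases "x \<sqsubseteq> y")
          case True
          then have "D a c \<le> D a y" using mono[OF le_refl[OF S(2)] CL(2) le_trans[OF CL(6)]] 2 up[OF True] by blast
          then show ?thesis using 2 D_nonneg[of x y] by simp
        next
          case False
          then have "y \<sqsubseteq> u" using dn xy by blast
          then have "D u a \<le> D y a" using mono[OF _ CL(1) le_refl[OF S(2)]] by blast
          moreover have "D a c \<le> D u c" using mono[OF CL(1,2) le_refl[OF S(4)]] by blast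
          ultimately show ?thesis using CC(6) 2 D_sym[of x y] by simp
        qed
      next
        case 3
        show ?thesis
        proof (cases "x \<sqsubseteq> y")
          case True
          then have "D b v \<le> D b y" using mono[OF le_refl[OF S(3)] CL(4)] up[OF True] by blast
          moreover have "D c b \<le> D c v" using mono[OF le_refl[OF S(4)] CL(3,4)] by blast
          ultimately show ?thesis using CC(7) 3 D_sym[of x c] by simp
        next
          case False
          then have "y \<sqsubseteq> u" using dn xy by blast
          then have "y \<sqsubseteq> c" using CL(5) le_trans by blast
          then have "D c b \<le> D y b" using mono[OF _ CL(3) le_refl[OF S(3)]] by blast
          then show ?thesis using 3 D_sym[of x y] D_sym[of x c] D_nonneg[of x y] by simp
        qed
      qed
    qed
    moreover have "card (V1 - V) \<le> 3"
    proof -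
      have "V1 - V \<subseteq> {a,c,b}" using eq by blast
      then have "card (V1 - V) \<le> card {a,c,b}" using card_mono[of "{a,c,b}"] by blast
      then show ?thesis using F by simp
    qed
    ultimately show ?thesis using F(1,9) eq by auto
  qed
  have v1: "v0 \<in> V1" using V1f V by blast
  have W: "tset V' \<and> V \<subseteq> V' \<and> c \<in> V' \<and> msh V' \<le> msh V \<and> card (V' - V) \<le> 4 \<and>
    (\<forall>x y. x \<in> V' \<longrightarrow> x \<notin> V \<longrightarrow> y \<in> V \<longrightarrow> x \<sqsubseteq> y \<or> y \<sqsubseteq> x \<longrightarrow> D x c \<le> 4 * D x y) \<and>
    ((\<forall>y\<in>V. msh V / 2 \<le> D c y) \<or>
     (\<forall>s. 0 \<le> s \<longrightarrow> s \<le> msh V \<longrightarrow> (\<exists>q\<in>down V'. D c q = s \<and> (\<forall>y\<in>down V. s \<le> D q y))))"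
    using V2
  proof (elim disjE exE conjE)
    fix u v assume a: "V' = V1" "edge V u v" "u \<sqsubset> c" "c \<sqsubset> v" "msh V / 2 \<le> D u c" "msh V / 2 \<le> D c v"
    have "2 * msh V1 \<le> 2 * msh V"
    proof (rule msh_least)
      show "tset V1" "v0 \<in> V1" "v0 \<noteq> rt" using V1f v1 V by auto
      show "\<And>u v. edge V1 u v \<Longrightarrow> D u v \<le> 2 * msh V" using V1f by blast
      fix q x assume "proj V1 q x"
      then have "proj V q x" using V1f unfolding proj_def by simp
      then show "D q x \<le> 2 * msh V" by (rule msh_bounds)
    qed
    moreover have "\<forall>y\<in>V. msh V / 2 \<le> D c y" using edge_sep[OF V(1) a(2-4)] a by blast
    moreover have "card (V' - V) \<le> 4" using V1f a(1) by simp
    ultimately show ?thesis using V1f unfolding a(1) by simp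
  next
    fix p assume p: "proj V c p" "p \<noteq> c" "D c p = msh V" "V' = insert p V1"
    have p1: "proj V1 c p" using proj_cut p V1f by blast
    have c1: "c \<in> V1" "tset V1" using V1f by auto
    note H = hair_facts[OF c1(2) p1 c1(1) p(2)]
    have ee: "D x z \<le> 2 * msh V" if "edge V' x z" for x z
      using that H(2) V1f p m unfolding p(4) by auto
    \<comment> \<open>A larger subtree moves the projection of \<open>x\<close> up towards
      \<open>x\<close>, so this gap can only shrink.\<close>
    have pp: "D q x \<le> 2 * msh V" if qx: "proj V' q x" for q x
    proof -
      have xS: "x \<in> S" using projD(2)[OF qx] le_S2 by blast
      obtain q' where q': "proj V q' x" using proj_ex V xS by blast
      have "down V \<subseteq> down V'" using down_mono V1f p by blast
      then have "q' \<sqsubseteq> q" using projD[OF q'] projD(3)[OF qx] by blast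
      then have "D q x \<le> D q' x" using mono[of q' q x x] projD(2)[OF qx] le_refl xS by blast
      then show ?thesis using msh_bounds(2)[OF q'] by simp
    qed
    have "2 * msh V' \<le> 2 * msh V"
      using msh_least[of V' v0 "2 * msh V"] ee pp H(1) p v1 V by auto
    moreover have "D x c \<le> 4 * D x y" if x: "x \<in> V'" "x \<notin> V" and y: "y \<in> V" and xy: "x \<sqsubseteq> y \<or> y \<sqsubseteq> x" for x y
    proof (cases "x = p")
      case True
      have yd: "y \<in> down V" using y down_sup V tsetD by blast
      have "\<not> x \<sqsubseteq> y" using H(3) V1f True y unfolding down_def by blast
      then have "y \<sqsubseteq> x" using xy by blast
      then have "y \<sqsubseteq> c" using projD(3)[OF p(1)] yd True by blast
      then have "D c p \<le> D y p" using mono[of y c p p] projD(2)[OF p(1)] le_refl le_S2 by blast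
      then show ?thesis using True D_sym[of x c] D_sym[of x y] D_nonneg[of x y] by simp
    next
      case False
      then show ?thesis using x y xy p V1f by blast
    qed
    moreover have "card (V' - V) \<le> 4"
    proof -
      have "card (V' - V) \<le> card (insert p (V1 - V))"
        using p c1 tsetD by (intro card_mono) auto
      also have "\<dots> \<le> Suc (card (V1 - V))" by (rule card_insert_le_m1) auto
      finally show ?thesis using V1f by simp
    qed
    moreover have "\<exists>q\<in>down V'. D c q = s \<and> (\<forall>y\<in>down V. s \<le> D q y)" if s: "0 \<le> s" "s \<le> msh V" for s
    proof -
      obtain q where q: "c \<sqsubseteq> q" "q \<sqsubseteq> p" "D c q = s" using ivt_up[OF projD(2)[OF p(1)], of s] s p by auto
      then show ?thesis using proj_sep[OF p(1) q(1,2)] p unfolding down_def by blast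
    qed
    moreover have "tset V'" "V \<subseteq> V'" "c \<in> V'" using H(1) p(4) V1f by auto
    ultimately show ?thesis by simp
  qed
  show "tset V'" "V \<subseteq> V'" "c \<in> V'" "msh V' \<le> msh V" "card (V' - V) \<le> 4"
    "\<And>x y. x \<in> V' \<Longrightarrow> x \<notin> V \<Longrightarrow> y \<in> V \<Longrightarrow> x \<sqsubseteq> y \<or> y \<sqsubseteq> x \<Longrightarrow> D x c \<le> 4 * D x y"
    "(\<forall>y\<in>V. msh V / 2 \<le> D c y) \<or>
     (\<forall>s. 0 \<le> s \<longrightarrow> s \<le> msh V \<longrightarrow> (\<exists>q\<in>down V'. D c q = s \<and> (\<forall>y\<in>down V. s \<le> D q y)))"
    using W by blast+
qed

section \<open>Counting vertices\<close>

definition gseq where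
  "gseq V c \<longleftrightarrow> tset (V 0) \<and> (\<exists>v\<in>V 0. v \<noteq> rt) \<and> (\<forall>l. gstep (V l) (c l) (V (Suc l)))"

lemma initial_tset:
  assumes "x \<in> S"
  shows "tset {rt, x}"
proof -
  have "mt rt x = rt" "mt x rt = rt" "mt rt rt = rt" "mt x x = x"
    using mt_eq_le le_rt le_refl assms rt_S mt_commute by metis+
  then show ?thesis unfolding tset_def using assms rt_S by auto
qed

lemma gseq_ex:
  assumes "x0 \<in> S" "x0 \<noteq> rt"
  shows "\<exists>V c. gseq V c \<and> V 0 = {rt, x0}"
proof -
  \<comment> \<open>Each state carries the centre of the step that led to it. The centre in the
    initial state is therefore a dummy, and the centres are read off with a shift by one.\<close>
  let ?P = "\<lambda>(n::nat) (s :: 'a set \<times> 'a). tset (fst s) \<and> x0 \<in> fst s \<and> (n = 0 \<longrightarrow> fst s = {rt, x0})"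
  let ?Q = "\<lambda>(n::nat) (s :: 'a set \<times> 'a) (s' :: 'a set \<times> 'a). gstep (fst s) (snd s') (fst s')"
  have "\<exists>f. \<forall>n. ?P n (f n) \<and> ?Q n (f n) (f (Suc n))"
  proof (rule dependent_nat_choice)
    show "\<exists>s. ?P 0 s" using initial_tset[OF assms(1)] by (intro exI[of _ "({rt,x0}, rt)"]) auto
    fix s :: "'a set \<times> 'a" and n assume s: "?P n s"
    then obtain c V' where g: "gstep (fst s) c V'" using gstep_ex assms by blast
    have "tset V'" "fst s \<subseteq> V'" using gstep_facts(1,2)[OF _ _ _ g] s assms by blast+
    then show "\<exists>s'. ?P (Suc n) s' \<and> ?Q n s s'" using g s by (intro exI[of _ "(V', c)"]) auto
  qed
  then obtain f where f: "\<forall>n. ?P n (f n) \<and> ?Q n (f n) (f (Suc n))" by blast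
  then have "gseq (\<lambda>n. fst (f n)) (\<lambda>n. snd (f (Suc n)))" unfolding gseq_def using assms by auto
  then show ?thesis using f by (intro exI) auto
qed

context
  fixes V :: "nat \<Rightarrow> 'a set" and c :: "nat \<Rightarrow> 'a"
  assumes gs: "gseq V c"
begin

lemma gseq_inv: "tset (V n) \<and> (\<exists>v\<in>V n. v \<noteq> rt)"
proof (induction n)
  case 0 then show ?case using gs unfolding gseq_def by blast
next
  case (Suc n)
  then obtain v where v: "v \<in> V n" "v \<noteq> rt" by blast
  have "gstep (V n) (c n) (V (Suc n))" using gs unfolding gseq_def by blast
  then show ?case using gstep_facts(1,2)[OF _ v] Suc v by blast
qed

lemma gseq_tset: "tset (V n)" using gseq_inv by blast

lemma gseq_step:
  shows "V n \<subseteq> V (Suc n)" "c n \<in> V (Suc n)" "msh (V (Suc n)) \<le> msh (V n)"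
    "card (V (Suc n) - V n) \<le> 4" "0 < msh (V n)"
    "\<And>x y. x \<in> V (Suc n) \<Longrightarrow> x \<notin> V n \<Longrightarrow> y \<in> V n \<Longrightarrow> x \<sqsubseteq> y \<or> y \<sqsubseteq> x \<Longrightarrow> D x (c n) \<le> 4 * D x y"
    "(\<forall>y\<in>V n. msh (V n) / 2 \<le> D (c n) y) \<or>
     (\<forall>s. 0 \<le> s \<longrightarrow> s \<le> msh (V n) \<longrightarrow>
        (\<exists>q\<in>down (V (Suc n)). D (c n) q = s \<and> (\<forall>y\<in>down (V n). s \<le> D q y)))"
proof -
  obtain v where v: "v \<in> V n" "v \<noteq> rt" "tset (V n)" using gseq_inv by blast
  have g: "gstep (V n) (c n) (V (Suc n))" using gs unfolding gseq_def by blast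
  note F = gstep_facts[OF v(3,1,2) g]
  show "V n \<subseteq> V (Suc n)" "c n \<in> V (Suc n)" "msh (V (Suc n)) \<le> msh (V n)"
    "card (V (Suc n) - V n) \<le> 4" using F by blast+
  show "0 < msh (V n)" using msh_pos v by blast
  show "\<And>x y. x \<in> V (Suc n) \<Longrightarrow> x \<notin> V n \<Longrightarrow> y \<in> V n \<Longrightarrow> x \<sqsubseteq> y \<or> y \<sqsubseteq> x \<Longrightarrow> D x (c n) \<le> 4 * D x y"
    by (rule F(6))
  show "(\<forall>y\<in>V n. msh (V n) / 2 \<le> D (c n) y) \<or>
     (\<forall>s. 0 \<le> s \<longrightarrow> s \<le> msh (V n) \<longrightarrow>
        (\<exists>q\<in>down (V (Suc n)). D (c n) q = s \<and> (\<forall>y\<in>down (V n). s \<le> D q y)))" by (rule F(7))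
qed

lemma gseq_mono: "m \<le> n \<Longrightarrow> V m \<subseteq> V n"
  using lift_Suc_mono_le[of V] gseq_step(1) by blast

lemma msh_mono: "m \<le> n \<Longrightarrow> msh (V n) \<le> msh (V m)"
  using lift_Suc_antimono_le[of "\<lambda>n. msh (V n)"] gseq_step(3) by blast

lemma gseq_S: "x \<in> V n \<Longrightarrow> x \<in> S"
  using gseq_tset tsetD(2) by blast

lemma separated_card:
  fixes f :: "nat \<Rightarrow> 'a"
  assumes "0 < s" "finite L" "f ` L \<subseteq> S" "\<And>l m. l \<in> L \<Longrightarrow> m \<in> L \<Longrightarrow> l < m \<Longrightarrow> s \<le> D (f m) (f l)"
    and M: "\<forall>F\<subseteq>S. finite F \<longrightarrow> (\<forall>x\<in>F. D x z \<le> t) \<longrightarrow>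
                 (\<forall>x\<in>F. \<forall>y\<in>F. x \<noteq> y \<longrightarrow> s \<le> D x y) \<longrightarrow> card F \<le> M"
    and t: "\<And>l. l \<in> L \<Longrightarrow> D (f l) z \<le> t"
  shows "card L \<le> M"
proof -
  have sep: "s \<le> D (f l) (f m)" if "l \<in> L" "m \<in> L" "l \<noteq> m" for l m
    using that assms(4)[of l m] assms(4)[of m l] D_sym[of "f l" "f m"] by (cases "l < m") auto
  have "inj_on f L"
  proof (rule inj_onI, rule ccontr)
    fix l m assume a: "l \<in> L" "m \<in> L" "f l = f m" "l \<noteq> m"
    then have "f l \<in> S" using assms(3) by blast
    then have "D (f l) (f m) = 0" using a D_zero by simp
    then show False using sep a assms(1) by fastforce
  qed
  then have "card L = card (f ` L)" by (simp add: card_image)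
  also have "\<dots> \<le> M"
  proof (rule M[rule_format])
    show "f ` L \<subseteq> S" "finite (f ` L)" using assms by auto
    show "\<And>x. x \<in> f ` L \<Longrightarrow> D x z \<le> t" using t by blast
    show "\<And>x y. x \<in> f ` L \<Longrightarrow> y \<in> f ` L \<Longrightarrow> x \<noteq> y \<Longrightarrow> s \<le> D x y" using sep by blast
  qed
  finally show ?thesis .
qed

text \<open>
  Steps with centre far from all previous vertices are counted by their centres, the others, which all
  attach a hair, by points of the hairs at distance \<open>r\<close> from the base.
\<close>

lemma count_centres:
  "\<exists>M::nat. \<forall>i z r. z \<in> S \<longrightarrow> 0 < r \<longrightarrow> (\<forall>l<i. r \<le> msh (V l)) \<longrightarrow> card {l. l < i \<and> D (c l) z \<le> L * r} \<le> M"
proof -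
  \<comment> \<open>\<open>M1\<close> is used at scale \<open>r / 2\<close>, whence
    \<open>2 * L\<close>. \<open>M2\<close> counts points at distance \<open>r\<close> from their
    centres, whence \<open>L + 1\<close>.\<close>
  obtain M1 :: nat where M1: "\<forall>z\<in>S. \<forall>r>0. \<forall>F\<subseteq>S. finite F \<longrightarrow> (\<forall>f\<in>F. D f z \<le> (2 * L) * r) \<longrightarrow>
                 (\<forall>f\<in>F. \<forall>g\<in>F. f \<noteq> g \<longrightarrow> r \<le> D f g) \<longrightarrow> card F \<le> M1" using doubling[of "2 * L"] by (elim exE) (rule that)
  obtain M2 :: nat where M2: "\<forall>z\<in>S. \<forall>r>0. \<forall>F\<subseteq>S. finite F \<longrightarrow> (\<forall>f\<in>F. D f z \<le> (L + 1) * r) \<longrightarrow>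
                 (\<forall>f\<in>F. \<forall>g\<in>F. f \<noteq> g \<longrightarrow> r \<le> D f g) \<longrightarrow> card F \<le> M2" using doubling[of "L + 1"] by (elim exE) (rule that)
  have "card {l. l < i \<and> D (c l) z \<le> L * r} \<le> M1 + M2"
    if z: "z \<in> S" and r: "0 < r" "\<forall>l<i. r \<le> msh (V l)" for i z r
  proof -
    let ?L = "{l. l < i \<and> D (c l) z \<le> L * r}"
    let ?A = "{l\<in>?L. \<forall>y\<in>V l. msh (V l) / 2 \<le> D (c l) y}"
    let ?B = "?L - ?A"
    have "card ?A \<le> M1"
    proof (rule separated_card)
      show "0 < r / 2" using r by simp
      show "finite ?A" by simp
      show "c ` ?A \<subseteq> S" using gseq_step(2) gseq_S by blast
      show "r / 2 \<le> D (c m) (c l)" if "l \<in> ?A" "m \<in> ?A" "l < m" for l m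
      proof -
        have "c l \<in> V m" using gseq_step(2)[of l] gseq_mono[of "Suc l" m] that by auto
        then have "msh (V m) / 2 \<le> D (c m) (c l)" using that by blast
        moreover have "r \<le> msh (V m)" using r that by blast
        ultimately show ?thesis by linarith
      qed
      show "\<forall>F\<subseteq>S. finite F \<longrightarrow> (\<forall>x\<in>F. D x z \<le> L * r) \<longrightarrow>
                 (\<forall>x\<in>F. \<forall>y\<in>F. x \<noteq> y \<longrightarrow> r / 2 \<le> D x y) \<longrightarrow> card F \<le> M1"
        using M1[rule_format, OF z, of "r / 2"] r(1) by simp
    qed auto
    moreover have "card ?B \<le> M2"
    proof -
      have "\<forall>l\<in>?B. \<exists>q\<in>down (V (Suc l)). D (c l) q = r \<and> (\<forall>y\<in>down (V l). r \<le> D q y)"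
      proof
        fix l assume l: "l \<in> ?B"
        then have "0 \<le> r" "r \<le> msh (V l)" using r by auto
        then show "\<exists>q\<in>down (V (Suc l)). D (c l) q = r \<and> (\<forall>y\<in>down (V l). r \<le> D q y)"
          using gseq_step(7)[of l] l by blast
      qed
      then have "\<exists>q. \<forall>l\<in>?B. q l \<in> down (V (Suc l)) \<and> D (c l) (q l) = r \<and> (\<forall>y\<in>down (V l). r \<le> D (q l) y)"
        using bchoice[of ?B "\<lambda>l q. q \<in> down (V (Suc l)) \<and> D (c l) q = r \<and> (\<forall>y\<in>down (V l). r \<le> D q y)"]
        by blast
      then obtain q where q: "\<And>l. l \<in> ?B \<Longrightarrow> q l \<in> down (V (Suc l)) \<and> D (c l) (q l) = r \<and> (\<forall>y\<in>down (V l). r \<le> D (q l) y)"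
        by (elim exE) (rule that, rule bspec)
      have qS: "q l \<in> S" if "l \<in> ?B" for l using q[OF that] down_S by blast
      show ?thesis
      proof (rule separated_card)
        show "0 < r" using r by simp
        show "finite ?B" by simp
        show "q ` ?B \<subseteq> S" using qS by blast
        show "r \<le> D (q m) (q l)" if lm: "l \<in> ?B" "m \<in> ?B" "l < m" for l m
        proof -
          have "V (Suc l) \<subseteq> V m" using gseq_mono lm by simp
          then have "q l \<in> down (V m)" using q[OF lm(1)] down_mono by blast
          then show ?thesis using q[OF lm(2)] by blast
        qed
        show "\<forall>F\<subseteq>S. finite F \<longrightarrow> (\<forall>x\<in>F. D x z \<le> (L + 1) * r) \<longrightarrow>
                 (\<forall>x\<in>F. \<forall>y\<in>F. x \<noteq> y \<longrightarrow> r \<le> D x y) \<longrightarrow> card F \<le> M2"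
          using bspec[OF M2 z] r(1) by blast
        show "D (q l) z \<le> (L + 1) * r" if l: "l \<in> ?B" for l
        proof -
          have "D (q l) z \<le> D (q l) (c l) + D (c l) z"
            by (rule D_tri[OF qS[OF l] gseq_S[OF gseq_step(2)] z])
          then show ?thesis using q[OF l] l D_sym[of "q l"] by (simp add: algebra_simps)
        qed
      qed
    qed
    moreover have "card ?L \<le> card ?A + card ?B"
      by (metis (no_types, lifting) Diff_partition card_Un_le mem_Collect_eq subsetI)
    ultimately show ?thesis by linarith
  qed
  then show ?thesis by blast
qed

text \<open>A step that adds a vertex to a segment already containing one has its centre near the
  segment, since a new vertex is closer to its centre than 4 times its distance to an old comparable
  one. \<open>count_centres\<close> bounds the number of such steps, and each adds at most 4
  vertices.\<close>

lemma count_vertices: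
  "\<exists>N::nat. \<forall>i y z r. y \<sqsubseteq> z \<longrightarrow> 0 < r \<longrightarrow> (\<forall>l<i. r \<le> msh (V l)) \<longrightarrow> D y z \<le> L * r \<longrightarrow>
     card {v\<in>V i. y \<sqsubseteq> v \<and> v \<sqsubseteq> z} \<le> N"
proof -
  \<comment> \<open>\<open>4 * L\<close> for the distance from the new vertex to its centre and
    \<open>L\<close> for its distance to \<open>z\<close>.\<close>
  obtain M where M: "\<forall>i z r. z \<in> S \<longrightarrow> 0 < r \<longrightarrow> (\<forall>l<i. r \<le> msh (V l)) \<longrightarrow>
      card {l. l < i \<and> D (c l) z \<le> (5 * L) * r} \<le> M"
    using count_centres[of "5 * L"] by (elim exE) (rule that)
  have "card {v\<in>V i. y \<sqsubseteq> v \<and> v \<sqsubseteq> z} \<le> card (V 0) + 4 * (M + 1)"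
    if yz: "y \<sqsubseteq> z" "D y z \<le> L * r" and r: "0 < r" "\<forall>l<i. r \<le> msh (V l)" for i y z r
  proof -
    define A where "A l = {v\<in>V l. y \<sqsubseteq> v \<and> v \<sqsubseteq> z}" for l
    have fin: "finite (A l)" for l unfolding A_def using tsetD(1)[OF gseq_tset] by simp
    have zS: "z \<in> S" using yz le_S2 by blast
    have "card (A j) \<le> card (V 0) + 4 * card {l. l < j \<and> A (Suc l) \<noteq> A l}" for j
    proof (induction j)
      case 0
      have "A 0 \<subseteq> V 0" unfolding A_def by blast
      then show ?case using card_mono[OF tsetD(1)[OF gseq_tset]] by simp
    next
      case (Suc j)
      show ?case
      proof (cases "A (Suc j) = A j")
        case True
        then have "{l. l < Suc j \<and> A (Suc l) \<noteq> A l} = {l. l < j \<and> A (Suc l) \<noteq> A l}"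
          using less_Suc_eq by auto
        then show ?thesis using Suc True by simp
      next
        case False
        then have eq: "{l. l < Suc j \<and> A (Suc l) \<noteq> A l} = insert j {l. l < j \<and> A (Suc l) \<noteq> A l}"
          using less_Suc_eq by auto
        have "card (A (Suc j)) \<le> card (A j \<union> (V (Suc j) - V j))"
          using fin tsetD(1)[OF gseq_tset] by (intro card_mono) (auto simp: A_def)
        also have "\<dots> \<le> card (A j) + 4" using card_Un_le[of "A j" "V (Suc j) - V j"] gseq_step(4)[of j] by linarith
        finally show ?thesis using Suc unfolding eq by simp
      qed
    qed
    then have "card (A i) \<le> card (V 0) + 4 * card {l. l < i \<and> A (Suc l) \<noteq> A l}" by blast
    moreover have "card {l. l < i \<and> A (Suc l) \<noteq> A l} \<le> M + 1"
    proof -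
      let ?C = "{l. l < i \<and> D (c l) z \<le> (5 * L) * r}"
      \<comment> \<open>The step that brings the first vertex into the segment has no old vertex to
        be compared with; there is at most one such step.\<close>
      let ?E = "{l. l < i \<and> A l = {} \<and> A (Suc l) \<noteq> {}}"
      have sub: "A l \<subseteq> A m" if "l \<le> m" for l m using gseq_mono[OF that] unfolding A_def by blast
      have "{l. l < i \<and> A (Suc l) \<noteq> A l} \<subseteq> ?C \<union> ?E"
      proof
        fix l assume l: "l \<in> {l. l < i \<and> A (Suc l) \<noteq> A l}"
        have "D (c l) z \<le> (5 * L) * r" if ne: "A l \<noteq> {}"
        proof -
          obtain w where w: "w \<in> A l" using ne by blast
          obtain x where x: "x \<in> A (Suc l)" "x \<notin> A l" using l sub[of l "Suc l"] by auto
          have wx: "w \<in> V l" "y \<sqsubseteq> w" "w \<sqsubseteq> z" "x \<in> V (Suc l)" "x \<notin> V l" "y \<sqsubseteq> x" "x \<sqsubseteq> z"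
            using w x unfolding A_def by auto
          have cmp: "x \<sqsubseteq> w \<or> w \<sqsubseteq> x" using chain[OF wx(7,3)] .
          have 1: "D x (c l) \<le> 4 * D x w" using gseq_step(6)[OF wx(4,5,1) cmp] .
          have 2: "D x w \<le> D y z" using cmp mono[OF wx(6) _ wx(3)] mono[OF wx(2) _ wx(7)] D_sym[of x w] by auto
          have 3: "D x z \<le> D y z" using mono[OF wx(6,7) le_refl[OF zS]] .
          have "D (c l) z \<le> D (c l) x + D x z"
            by (rule D_tri[OF gseq_S[OF gseq_step(2)] le_S1[OF wx(7)] zS])
          then show ?thesis using 1 2 3 yz(2) D_sym[of x "c l"] by linarith
        qed
        then show "l \<in> ?C \<union> ?E" using l by auto
      qed
      then have "card {l. l < i \<and> A (Suc l) \<noteq> A l} \<le> card (?C \<union> ?E)" by (intro card_mono) auto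
      also have "\<dots> \<le> card ?C + card ?E" by (rule card_Un_le)
      also have "card ?C \<le> M" using M zS r by blast
      also have "card ?E \<le> 1"
      proof -
        have "l = m" if "l \<in> ?E" "m \<in> ?E" for l m
        proof (rule ccontr)
          assume "l \<noteq> m"
          then consider "Suc l \<le> m" | "Suc m \<le> l" by linarith
          then show False using sub that by cases blast+
        qed
        then have "\<forall>l\<in>?E. \<forall>m\<in>?E. l = m" by blast
        then show ?thesis using card_le_Suc0_iff_eq[of ?E] by simp
      qed
      finally show ?thesis by simp
    qed
    moreover have "a \<le> b + 4 * (M + 1)" if "a \<le> b + 4 * n" "n \<le> M + 1" for a b n :: nat
      using that by simp
    ultimately have "card (A i) \<le> card (V 0) + 4 * (M + 1)" by blast
    then show ?thesis unfolding A_def .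
  qed
  then show ?thesis by blast
qed

text \<open>If the mesh stayed above \<open>r\<close>, arbitrarily many centres would lie within a
  fixed multiple of \<open>r\<close> from the root, against \<open>count_centres\<close>.\<close>

lemma msh_small:
  assumes "0 < r"
  shows "\<exists>i. msh (V i) < r"
proof (rule ccontr)
  assume "\<not> ?thesis"
  then have r: "r \<le> msh (V l)" for l by (meson not_less)
  obtain \<Delta> where \<Delta>: "\<forall>x\<in>S. \<forall>y\<in>S. D x y \<le> \<Delta>" using bounded by blast
  obtain M where M: "\<forall>i z s. z \<in> S \<longrightarrow> 0 < s \<longrightarrow> (\<forall>l<i. s \<le> msh (V l)) \<longrightarrow>
      card {l. l < i \<and> D (c l) z \<le> (\<Delta> / r) * s} \<le> M"
    using count_centres[of "\<Delta> / r"] by (elim exE) (rule that)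
  have "D (c l) rt \<le> (\<Delta> / r) * r" for l using \<Delta> gseq_S[OF gseq_step(2)] rt_S assms by auto
  then have "{l. l < Suc M \<and> D (c l) rt \<le> (\<Delta> / r) * r} = {..<Suc M}" by auto
  then have "Suc M \<le> M" using M[rule_format, OF rt_S assms, of "Suc M"] r by (metis card_lessThan)
  then show False by simp
qed

end

text \<open>Up to the projection of \<open>x\<close> the arc stays in one edge, and from there on it
  is outside the subtree; each part is at most a gap, hence at most
  \<open>2 * msh V\<close>.\<close>

lemma ap_dist:
  assumes "tset V" "x \<in> S"
  shows "D (ap V x) x \<le> 4 * msh V"
proof -
  note A = ap_props[OF assms]
  obtain q where q: "proj V q x" using proj_ex assms by blast
  note Q = projD[OF q]
  have aq: "ap V x \<sqsubseteq> q" using Q(3) A down_sup tsetD(2)[OF assms(1)] by blast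
  have "D (ap V x) q \<le> 2 * msh V"
  proof (cases "q \<in> V")
    case True
    then have "ap V x = q" using A(3) Q(2) aq le_antisym by blast
    then show ?thesis using D_zero[of q q] le_S1[OF Q(2)] msh_bounds(2)[OF q] D_nonneg[of q x] by simp
  next
    case False
    then obtain u v where uv: "edge V u v" "u \<sqsubset> q" "q \<sqsubset> v" using down_cases[OF assms(1) Q(1)] by blast
    then have "u \<sqsubseteq> ap V x" using A(3) edgeD(1)[OF uv(1)] lt_le[OF uv(2)] Q(2) le_trans by blast
    then have "D (ap V x) q \<le> D u v" using mono aq lt_le[OF uv(3)] by blast
    then show ?thesis using msh_bounds(1)[OF uv(1)] by simp
  qed
  moreover have "D (ap V x) x \<le> D (ap V x) q + D q x" 
    by (rule D_tri[OF le_S1[OF aq] le_S1[OF Q(2)] assms(2)])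
  ultimately show ?thesis using msh_bounds(2)[OF q] by simp
qed

section \<open>Heights and densities\<close>

definition cnt where "cnt V y z = card {v\<in>V. y \<sqsubseteq> v \<and> v \<sqsubseteq> z}"

lemma cnt_edge:
  assumes "tset V" "edge V y x" "c \<sqsubseteq> y"
  shows "cnt V c y < cnt V c x"
  unfolding cnt_def
proof (rule psubset_card_mono)
  show "finite {v \<in> V. c \<sqsubseteq> v \<and> v \<sqsubseteq> x}" using tsetD(1)[OF assms(1)] by simp
  have "x \<sqsubseteq> x" "c \<sqsubseteq> x" using le_refl le_S2 edgeD(4)[OF assms(2)] le_trans[OF assms(3)] by auto
  then have "x \<in> {v \<in> V. c \<sqsubseteq> v \<and> v \<sqsubseteq> x}" using edgeD(2)[OF assms(2)] by simp
  moreover have "x \<notin> {v \<in> V. c \<sqsubseteq> v \<and> v \<sqsubseteq> y}" using not_le_lt[OF edgeD(3)[OF assms(2)]] by simp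
  moreover have "{v \<in> V. c \<sqsubseteq> v \<and> v \<sqsubseteq> y} \<subseteq> {v \<in> V. c \<sqsubseteq> v \<and> v \<sqsubseteq> x}"
    using le_trans[OF _ edgeD(4)[OF assms(2)]] by auto
  ultimately show "{v \<in> V. c \<sqsubseteq> v \<and> v \<sqsubseteq> y} \<subset> {v \<in> V. c \<sqsubseteq> v \<and> v \<sqsubseteq> x}" by auto
qed

lemma cnt_pos:
  assumes "tset V" "x \<in> V" "c \<sqsubseteq> x"
  shows "0 < cnt V c x"
proof -
  have "x \<in> {v\<in>V. c \<sqsubseteq> v \<and> v \<sqsubseteq> x}" using assms le_refl[OF le_S2[OF assms(3)]] by simp
  then show ?thesis unfolding cnt_def using tsetD(1)[OF assms(1)] card_gt_0_iff[of "{v\<in>V. c \<sqsubseteq> v \<and> v \<sqsubseteq> x}"] by fastforce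
qed

section \<open>Induction along chains of edges\<close>

lemma parent_ex:
  assumes "tset V" "w \<in> V" "v \<in> V" "w \<sqsubset> v"
  obtains u where "edge V u v" "w \<sqsubseteq> u"
proof -
  have "v \<noteq> rt" using not_le_lt[OF assms(4)] le_rt[OF le_S1[OF lt_le[OF assms(4)]]] by auto
  then obtain u where u: "edge V u v" using edge_ex[OF assms(1,3)] by auto
  then show ?thesis using that edgeD(5)[OF u assms(2,4)] by simp
qed

lemma chain_up [consumes 4, case_names base step]:
  assumes V: "tset V" "w \<in> V" "v \<in> V" "w \<sqsubseteq> v" and base: "P w"
    and step: "\<And>y x. edge V y x \<Longrightarrow> w \<sqsubseteq> y \<Longrightarrow> x \<sqsubseteq> v \<Longrightarrow> P y \<Longrightarrow> P x"
  shows "P v"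
proof -
  have "P x" if "x \<in> V" "w \<sqsubseteq> x" "x \<sqsubseteq> v" for x
    using that
  proof (induction "cnt V w x" arbitrary: x rule: less_induct)
    case less
    show ?case
    proof (cases "x = w")
      case False
      then have "w \<sqsubset> x" using less.prems(2) unfolding lt_def by auto
      then obtain y where y: "edge V y x" "w \<sqsubseteq> y" using parent_ex[OF V(1,2) less.prems(1)] by blast
      have yv: "y \<sqsubseteq> v" using le_trans[OF edgeD(4)[OF y(1)] less.prems(3)] .
      have "P y" using less.hyps[OF cnt_edge[OF V(1) y] edgeD(1)[OF y(1)] y(2) yv] .
      then show ?thesis using step[OF y less.prems(3)] by simp
    qed (use base in simp)
  qed
  then show ?thesis using V le_refl[OF le_S2[OF V(4)]] by simp
qed

lemma chain_down [consumes 4, case_names base step]: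
  assumes V: "tset V" "w \<in> V" "v \<in> V" "w \<sqsubseteq> v" and base: "P v"
    and step: "\<And>y x. edge V y x \<Longrightarrow> w \<sqsubseteq> y \<Longrightarrow> x \<sqsubseteq> v \<Longrightarrow> P x \<Longrightarrow> P y"
  shows "P w"
proof -
  have "P v \<longrightarrow> P w" using V
  proof (induction rule: chain_up)
    case base then show ?case by simp
  next
    case (step y x) then show ?case using assms(6) by blast
  qed
  then show ?thesis using base by simp
qed

text \<open>
  \<open>h\<close> is the height, \<open>k v\<close> the density of \<open>h\<close> with respect to \<open>D\<close> on the edge below \<open>v\<close>, and
  \<open>\<kappa> v\<close> the density assigned to the vertex \<open>v\<close>. Every vertex other than the root lies on a hair with base
  \<open>B v\<close> and tip \<open>tp v\<close>; hairs start with \<open>\<epsilon>\<close> times the density of their base, and the last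
  clause makes the heights of nested hairs decay geometrically. The values at \<open>rt\<close> of \<open>k\<close>, \<open>B\<close> and
  \<open>tp\<close> are junk.
\<close>

definition hinv where
  "hinv \<epsilon> r V h \<kappa> k B tp \<longleftrightarrow>
     (\<forall>u v. edge V u v \<longrightarrow> h v - h u = k v * D u v \<and> 0 < k v \<and> \<kappa> v \<le> 4 * k v \<and> k v \<le> 2 * \<kappa> v \<and> B v \<sqsubseteq> u \<and>
        (u \<noteq> B v \<longrightarrow> \<kappa> u \<le> 4 * k v \<and> k v \<le> 2 * \<kappa> u \<and> B u = B v \<and> tp u = tp v) \<and>
        (u = B v \<longrightarrow> k v = \<epsilon> * \<kappa> u)) \<and>
     (\<forall>v\<in>V. 0 < \<kappa> v) \<and>
     (\<forall>v\<in>V. v \<noteq> rt \<longrightarrow> v \<sqsubseteq> tp v \<and> tp v \<in> V \<and> B v \<in> V \<and> B v \<sqsubset> v \<and> B (tp v) = B v \<and> tp (tp v) = tp v \<and>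
        r \<le> D (B v) (tp v) \<and> h (tp v) - h (B v) = \<epsilon> * \<kappa> (B v) * D (B v) (tp v) \<and>
        (B v \<noteq> rt \<longrightarrow> 2 * (h (tp v) - h (B v)) \<le> h (tp (B v)) - h (B (B v))))"

lemma hinv_edge:
  assumes "hinv \<epsilon> r V h \<kappa> k B tp" "edge V u v"
  shows "h v - h u = k v * D u v" "0 < k v" "\<kappa> v \<le> 4 * k v" "k v \<le> 2 * \<kappa> v" "B v \<sqsubseteq> u"
    "u \<noteq> B v \<Longrightarrow> \<kappa> u \<le> 4 * k v" "u \<noteq> B v \<Longrightarrow> k v \<le> 2 * \<kappa> u" "u \<noteq> B v \<Longrightarrow> B u = B v"
    "u \<noteq> B v \<Longrightarrow> tp u = tp v" "u = B v \<Longrightarrow> k v = \<epsilon> * \<kappa> u"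
  using assms unfolding hinv_def by force+

lemma hinv_vertex:
  assumes "hinv \<epsilon> r V h \<kappa> k B tp" "v \<in> V"
  shows "0 < \<kappa> v" "v \<noteq> rt \<Longrightarrow> v \<sqsubseteq> tp v" "v \<noteq> rt \<Longrightarrow> tp v \<in> V" "v \<noteq> rt \<Longrightarrow> B v \<in> V"
    "v \<noteq> rt \<Longrightarrow> B v \<sqsubset> v" "v \<noteq> rt \<Longrightarrow> B (tp v) = B v" "v \<noteq> rt \<Longrightarrow> tp (tp v) = tp v"
    "v \<noteq> rt \<Longrightarrow> r \<le> D (B v) (tp v)"
    "v \<noteq> rt \<Longrightarrow> h (tp v) - h (B v) = \<epsilon> * \<kappa> (B v) * D (B v) (tp v)"
    "v \<noteq> rt \<Longrightarrow> B v \<noteq> rt \<Longrightarrow> 2 * (h (tp v) - h (B v)) \<le> h (tp (B v)) - h (B (B v))"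
  using assms unfolding hinv_def by blast+

lemma hinv_cong:
  assumes "hinv \<epsilon> r V h \<kappa> k B tp"
    "\<And>x. x \<in> V \<Longrightarrow> h' x = h x \<and> \<kappa>' x = \<kappa> x \<and> k' x = k x \<and> B' x = B x \<and> tp' x = tp x"
  shows "hinv \<epsilon> r V h' \<kappa>' k' B' tp'"
  using assms(1) assms(2) edgeD(1,2) unfolding hinv_def by (smt (verit, best))

lemma hinv_weaken: "hinv \<epsilon> r V h \<kappa> k B tp \<Longrightarrow> r' \<le> r \<Longrightarrow> hinv \<epsilon> r' V h \<kappa> k B tp"
  unfolding hinv_def by fastforce

lemma lt_rt: "w \<sqsubset> v \<Longrightarrow> v \<noteq> rt"
  using not_le_lt le_rt[OF le_S1[OF lt_le]] by blast

text \<open>On the way down, base and tip can change only across an edge that starts at its own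
  base, and no such edge is met strictly above \<open>B v\<close>.\<close>

lemma hair_const:
  assumes V: "tset V" and H: "hinv \<epsilon> r V h \<kappa> k B tp" and w: "w \<in> V" "v \<in> V" "B v \<sqsubset> w" "w \<sqsubseteq> v"
  shows "B w = B v \<and> tp w = tp v"
  using V w(1,2,4)
proof (induction rule: chain_down)
  case base
  then show ?case by simp
next
  case (step y x)
  have "y \<noteq> B x" using step(4) w(3) step(2) not_le_lt by auto
  then show ?case using hinv_edge(8,9)[OF H step(1)] step(4) by simp
qed

lemma h_mono:
  assumes V: "tset V" and H: "hinv \<epsilon> r V h \<kappa> k B tp" and w: "w \<in> V" "v \<in> V" "w \<sqsubseteq> v"
  shows "h w \<le> h v"
  using V w
proof (induction rule: chain_up)
  case (step y x)
  have "0 \<le> k x * D y x" using hinv_edge(2)[OF H step(1)] D_nonneg by simp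
  then show ?case using hinv_edge(1)[OF H step(1)] step(4) by linarith
qed simp

lemma h_strict:
  assumes V: "tset V" and H: "hinv \<epsilon> r V h \<kappa> k B tp" and w: "w \<in> V" "v \<in> V" "w \<sqsubset> v"
  shows "h w < h v"
proof -
  obtain u where u: "edge V u v" "w \<sqsubseteq> u" using parent_ex[OF V w] .
  have "h w \<le> h u" using h_mono[OF V H w(1) edgeD(1)[OF u(1)] u(2)] .
  moreover have "0 < k v * D u v" using hinv_edge(2)[OF H u(1)] lt_D_pos[OF edgeD(3)[OF u(1)]] by simp
  ultimately show ?thesis using hinv_edge(1)[OF H u(1)] by linarith
qed

text \<open>Going from a vertex to the next one through their common edge costs the factor
  \<open>L\<close> twice, whence the powers of \<open>L\<^sup>2\<close>. It is used with 4 above the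
  base within a hair, and with 4 / \<epsilon> across bases.\<close>

lemma chain_compare:
  fixes h \<kappa> k :: "'a \<Rightarrow> real"
  assumes V: "tset V" "c \<in> V" and L: "1 \<le> L"
    and E: "\<And>y z. edge V y z \<Longrightarrow> c \<sqsubseteq> y \<Longrightarrow> z \<sqsubseteq> tt \<Longrightarrow> h z - h y = k z * D y z \<and> \<kappa> y \<le> L * k z \<and>
       k z \<le> L * \<kappa> y \<and> \<kappa> z \<le> L * k z \<and> k z \<le> L * \<kappa> z \<and> 0 < \<kappa> z \<and> 0 < k z"
    and pos: "0 < \<kappa> c"
    and x: "x \<in> V" "c \<sqsubseteq> x" "x \<sqsubseteq> tt" "cnt V c x \<le> Suc n"
  shows "\<kappa> c \<le> (L\<^sup>2) ^ n * \<kappa> x \<and> \<kappa> x \<le> (L\<^sup>2) ^ n * \<kappa> c \<and> 0 < \<kappa> x \<and> h c \<le> h x \<and>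
    \<kappa> x * D c x \<le> (L\<^sup>2) ^ Suc n * (h x - h c) \<and> h x - h c \<le> n * (L\<^sup>2) ^ Suc n * (\<kappa> x * D c x)"
  using x
proof (induction n arbitrary: x)
  case 0
  have "x = c"
  proof (rule ccontr)
    assume "x \<noteq> c"
    then have "c \<sqsubset> x" using 0 unfolding lt_def by auto
    then obtain y where y: "edge V y x" "c \<sqsubseteq> y" using parent_ex[OF V 0(1)] by blast
    then show False using cnt_edge[OF V(1) y] cnt_pos[OF V(1) edgeD(1)[OF y(1)] y(2)] 0 by linarith
  qed
  moreover have "D c c = 0" using D_zero le_S1[OF 0(2)] by simp
  ultimately show ?case using pos by simp
next
  case (Suc n)
  define Q where "Q = L\<^sup>2"
  have Q1: "1 \<le> Q" "L \<le> Q" "0 < Q" unfolding Q_def using L by (auto simp: power2_eq_square mult_ge1_I)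
  have Qn: "1 \<le> Q ^ m" for m using Q1 by simp
  show ?case
  proof (cases "x = c")
    case True
    have D0: "D c c = 0" using D_zero le_S1[OF Suc.prems(2)] by simp
    have "1 * \<kappa> c \<le> Q ^ Suc n * \<kappa> c" using Qn[of "Suc n"] pos by (intro mult_right_mono) (simp_all del: power_Suc)
    then show ?thesis using True pos D0 unfolding Q_def by simp
  next
    case False
    then have "c \<sqsubset> x" using Suc.prems unfolding lt_def by auto
    then obtain y where y: "edge V y x" "c \<sqsubseteq> y" using parent_ex[OF V Suc.prems(1)] by blast
    have yt: "y \<sqsubseteq> tt" "y \<sqsubseteq> x" using le_trans[OF edgeD(4)[OF y(1)] Suc.prems(3)] edgeD(4)[OF y(1)] by auto
    have "cnt V c y \<le> Suc n" using cnt_edge[OF V(1) y] Suc.prems(4) by linarith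
    note IH = Suc.IH[OF edgeD(1)[OF y(1)] y(2) yt(1) this, folded Q_def]
    note e = E[OF y Suc.prems(3)]
    have Ds: "D c x \<le> D c y + D y x" "D c y \<le> D c x" "D y x \<le> D c x"
      using D_tri[OF le_S1[OF y(2)] le_S2[OF y(2)] le_S2[OF yt(2)]]
        mono[OF le_refl[OF le_S1[OF y(2)]] y(2) yt(2)]
        mono[OF y(2) yt(2) le_refl[OF le_S2[OF yt(2)]]] by auto
    have kyx: "\<kappa> y \<le> Q * \<kappa> x" "\<kappa> x \<le> Q * \<kappa> y"
    proof -
      have "\<kappa> y \<le> L * k x" "L * k x \<le> L * (L * \<kappa> x)" using e L by (auto intro: mult_left_mono)
      then show "\<kappa> y \<le> Q * \<kappa> x" unfolding Q_def power2_eq_square by (simp add: mult.assoc)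
      have "\<kappa> x \<le> L * k x" "L * k x \<le> L * (L * \<kappa> y)" using e L by (auto intro: mult_left_mono)
      then show "\<kappa> x \<le> Q * \<kappa> y" unfolding Q_def power2_eq_square by (simp add: mult.assoc)
    qed
    have 1: "\<kappa> c \<le> Q ^ Suc n * \<kappa> x"
    proof -
      have "\<kappa> c \<le> Q ^ n * \<kappa> y" using IH by blast
      also have "\<dots> \<le> Q ^ n * (Q * \<kappa> x)" using kyx Q1 by (intro mult_left_mono) auto
      finally show ?thesis by (simp add: algebra_simps)
    qed
    have 2: "\<kappa> x \<le> Q ^ Suc n * \<kappa> c"
    proof -
      have "\<kappa> x \<le> Q * \<kappa> y" using kyx by blast
      also have "\<dots> \<le> Q * (Q ^ n * \<kappa> c)" using IH Q1 by (intro mult_left_mono) auto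
      finally show ?thesis by (simp add: algebra_simps)
    qed
    have hxy: "h x - h y = k x * D y x" "0 \<le> h x - h y" using e D_nonneg[of y x] by auto
    have 3: "\<kappa> x * D c x \<le> Q ^ Suc (Suc n) * (h x - h c)"
    proof -
      have "\<kappa> x * D c x \<le> \<kappa> x * D c y + \<kappa> x * D y x"
        using Ds(1) e by (simp add: distrib_left[symmetric])
      also have "\<kappa> x * D c y \<le> (Q * \<kappa> y) * D c y" using kyx D_nonneg by (intro mult_right_mono) auto
      also have "\<dots> = Q * (\<kappa> y * D c y)" by simp
      also have "\<dots> \<le> Q * (Q ^ Suc n * (h y - h c))" using IH Q1 by (intro mult_left_mono) auto
      also have "\<kappa> x * D y x \<le> (L * k x) * D y x" using e D_nonneg by (intro mult_right_mono) auto
      also have "\<dots> = L * (h x - h y)" using hxy by simp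
      also have "\<dots> \<le> Q ^ Suc (Suc n) * (h x - h y)"
      proof (rule mult_right_mono)
        have "Q * 1 \<le> Q * Q ^ Suc n" using Qn[of "Suc n"] Q1 by (intro mult_left_mono) auto
        then have "Q \<le> Q ^ Suc (Suc n)" by (simp only: power_Suc[of Q "Suc n"] mult_1_right)
        then show "L \<le> Q ^ Suc (Suc n)" using Q1 by linarith
      qed (use hxy in simp)
      finally show ?thesis by (simp add: algebra_simps)
    qed
    have 4: "h x - h c \<le> Suc n * Q ^ Suc (Suc n) * (\<kappa> x * D c x)"
    proof -
      have kd: "0 \<le> \<kappa> x * D c x" using e D_nonneg[of c x] by simp
      have "h x - h y \<le> (L * \<kappa> x) * D c x" unfolding hxy using e Ds D_nonneg L
        by (intro mult_mono) auto
      also have "\<dots> = L * (\<kappa> x * D c x)" by simp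
      also have "\<dots> \<le> Q ^ Suc (Suc n) * (\<kappa> x * D c x)"
      proof (rule mult_right_mono)
        have "Q * 1 \<le> Q * Q ^ Suc n" using Qn[of "Suc n"] Q1 by (intro mult_left_mono) auto
        then have "Q \<le> Q ^ Suc (Suc n)" by (simp only: power_Suc[of Q "Suc n"] mult_1_right)
        then show "L \<le> Q ^ Suc (Suc n)" using Q1 by linarith
      qed (use kd in simp)
      finally have a: "h x - h y \<le> Q ^ Suc (Suc n) * (\<kappa> x * D c x)" .
      have "h y - h c \<le> n * Q ^ Suc n * (\<kappa> y * D c y)" using IH by blast
      also have "\<dots> \<le> n * Q ^ Suc n * ((Q * \<kappa> x) * D c x)"
        using kyx Ds D_nonneg Q1 IH e by (intro mult_left_mono mult_mono) auto
      also have "\<dots> = n * Q ^ Suc (Suc n) * (\<kappa> x * D c x)" by simp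
      finally show ?thesis using a by (simp add: algebra_simps)
    qed
    have "h c \<le> h x" using IH hxy by linarith
    then show ?thesis using 1 2 3 4 e unfolding Q_def by blast
  qed
qed

text \<open>The constant must not involve \<epsilon>, since \<epsilon> is chosen in terms of it.
  Therefore only edges starting above \<open>u\<close>, hence above the base, are compared with both
  of their ends; of an edge starting at \<open>u\<close>, which may be the base, only the density at
  its upper end is used. Half of the length \<open>r\<close> lies on one side of \<open>c\<close>,
  and the walk goes in that direction.\<close>

lemma hair_lower:
  assumes V: "tset V" and H: "hinv \<epsilon> r0 V h \<kappa> k B tp"
    and N: "\<And>y z. y \<sqsubseteq> z \<Longrightarrow> D y z \<le> r \<Longrightarrow> cnt V y z \<le> N"
    and r: "0 < r" "r \<le> D u v"
    and u: "u \<in> V" "v \<in> V" "B v \<sqsubseteq> u" and c: "c \<in> V" "u \<sqsubset> c" "c \<sqsubseteq> v"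
  shows "\<kappa> c * r \<le> 2 * 16 ^ (2 * N + 1) * (h v - h u)"
proof -
  have uc: "u \<sqsubseteq> c" "u \<sqsubseteq> v" using lt_le[OF c(2)] le_trans[OF _ c(3)] by auto
  have S: "u \<in> S" "v \<in> S" "c \<in> S" using uc le_S1 le_S2 by auto
  have kc: "0 < \<kappa> c" using hinv_vertex(1)[OF H c(1)] .
  have huc: "h u \<le> h c" "h c \<le> h v" using h_mono[OF V H] u c uc by auto
  have Bconst: "B z = B v" if z: "z \<in> V" "u \<sqsubset> z" "z \<sqsubseteq> v" for z
    using hair_const[OF V H z(1) u(2) le_lt_trans[OF u(3) z(2)] z(3)] by blast
  consider "r / 2 \<le> D u c" | "r / 2 \<le> D c v" using D_tri[OF S(1,3,2)] r by linarith
  then show ?thesis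
  proof cases
    case 1
    obtain z where z: "u \<sqsubseteq> z" "z \<sqsubseteq> c" "D z c = r / 2" using ivt_down[OF uc(1) _ 1] r by auto
    \<comment> \<open>Induction on the number of vertices between \<open>z\<close> and
      \<open>x\<close>. An edge reaching down to \<open>z\<close> or below is estimated as a whole.
      Otherwise the next vertex \<open>y\<close> is above \<open>z\<close>, hence above the base,
      and \<open>\<kappa> x \<le> 8 * \<kappa> y\<close>.\<close>
    have claim: "\<kappa> x * D z x \<le> 4 * 8 ^ n * (h x - h u)"
      if "x \<in> V" "u \<sqsubset> x" "z \<sqsubseteq> x" "x \<sqsubseteq> v" "cnt V z x \<le> Suc n" for x n
      using that
    proof (induction n arbitrary: x)
      case (0 x)
      obtain y where y: "edge V y x" "u \<sqsubseteq> y" using parent_ex[OF V u(1) 0(1,2)] .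
      have "\<not> z \<sqsubseteq> y"
        using cnt_edge[OF V y(1), of z] cnt_pos[OF V edgeD(1)[OF y(1)], of z] 0(5) by linarith
      then have "y \<sqsubseteq> z" using chain[OF edgeD(4)[OF y(1)] 0(3)] by blast
      then have "D z x \<le> D y x" using mono[OF _ 0(3) le_refl[OF le_S2[OF 0(3)]]] by blast
      then have "\<kappa> x * D z x \<le> (4 * k x) * D y x"
        using hinv_edge[OF H y(1)] D_nonneg by (intro mult_mono) auto
      also have "\<dots> = 4 * (h x - h y)" using hinv_edge(1)[OF H y(1)] by simp
      finally show ?case using h_mono[OF V H u(1) edgeD(1)[OF y(1)] y(2)] by simp
    next
      case (Suc n x)
      obtain y where y: "edge V y x" "u \<sqsubseteq> y" using parent_ex[OF V u(1) Suc.prems(1,2)] .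
      note e = hinv_edge[OF H y(1)]
      have huy: "h u \<le> h y" using h_mono[OF V H u(1) edgeD(1)[OF y(1)] y(2)] .
      have hyx: "h y \<le> h x" using h_mono[OF V H edgeD(1,2,4)[OF y(1)]] .
      consider "y \<sqsubseteq> z" | "z \<sqsubset> y"
        using chain_cases[OF edgeD(4)[OF y(1)] Suc.prems(3)] by blast
      then show ?case
      proof cases
        case 1
        then have "D z x \<le> D y x" using mono[OF _ Suc.prems(3) le_refl[OF le_S2[OF Suc.prems(3)]]] by blast
        then have "\<kappa> x * D z x \<le> (4 * k x) * D y x"
          using e D_nonneg by (intro mult_mono) auto
        also have "\<dots> = 4 * (h x - h y)" using e(1) by simp
        also have "\<dots> \<le> 4 * (h x - h u)" using huy by simp
        also have "\<dots> \<le> 4 * 8 ^ Suc n * (h x - h u)" using huy hyx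
          using one_le_power[of "8::real" "Suc n"] by (intro mult_right_mono) (simp_all del: power_Suc)
        finally show ?thesis .
      next
        case 2
        have uy: "u \<sqsubset> y" using le_lt_trans[OF z(1) 2] .
        have yv: "y \<sqsubseteq> v" using le_trans[OF edgeD(4)[OF y(1)] Suc.prems(4)] .
        have "B x = B v" using Bconst[OF Suc.prems(1,2,4)] .
        then have yB: "y \<noteq> B x" using not_le_lt[OF uy] u(3) by auto
        have cn: "cnt V z y \<le> Suc n" using cnt_edge[OF V y(1) lt_le[OF 2]] Suc.prems(5) by linarith
        have IH: "\<kappa> y * D z y \<le> 4 * 8 ^ n * (h y - h u)"
          using Suc.IH[OF edgeD(1)[OF y(1)] uy lt_le[OF 2] yv cn] .
        have xy: "\<kappa> x \<le> 8 * \<kappa> y" using e(3) e(7)[OF yB] by linarith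
        have "D z x \<le> D z y + D y x"
          using D_tri[OF le_S1[OF lt_le[OF 2]] le_S1[OF edgeD(4)[OF y(1)]] le_S2[OF edgeD(4)[OF y(1)]]] .
        then have "\<kappa> x * D z x \<le> \<kappa> x * (D z y + D y x)"
          using hinv_vertex(1)[OF H Suc.prems(1)] by (intro mult_left_mono) auto
        also have "\<dots> = \<kappa> x * D z y + \<kappa> x * D y x" by (simp add: distrib_left)
        also have "\<kappa> x * D z y \<le> (8 * \<kappa> y) * D z y" using xy D_nonneg by (intro mult_right_mono) auto
        also have "\<kappa> x * D y x \<le> (4 * k x) * D y x" using e(3) D_nonneg by (intro mult_right_mono) auto
        also have "\<dots> = 4 * (h x - h y)" using e(1) by simp
        also have "4 * (h x - h y) \<le> 4 * 8 ^ Suc n * (h x - h y)" using hyx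
          using one_le_power[of "8::real" "Suc n"] by (intro mult_right_mono) (simp_all del: power_Suc)
        finally show ?thesis using IH by (simp add: algebra_simps)
      qed
    qed
    have "cnt V z c \<le> Suc N" using N[OF z(2)] z(3) r by simp
    then have "\<kappa> c * D z c \<le> 4 * 8 ^ N * (h c - h u)" using claim[OF c(1,2) z(2) c(3)] by blast
    then have "\<kappa> c * r \<le> 8 * 8 ^ N * (h c - h u)" using z(3) by simp
    also have "\<dots> \<le> (2 * 16 ^ (2 * N + 1)) * (h v - h u)"
    proof (rule mult_mono)
      have "(8::real) ^ N \<le> 16 ^ N" by (rule power_mono) auto
      also have "\<dots> \<le> 16 ^ (2 * N)" by (rule power_increasing) auto
      finally show "8 * 8 ^ N \<le> 2 * (16::real) ^ (2 * N + 1)"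
        using zero_le_power[of "16::real" "2 * N"] unfolding power_add power_one_right by linarith
    qed (use huc in auto)
    finally show ?thesis .
  next
    case 2
    obtain z where z: "c \<sqsubseteq> z" "z \<sqsubseteq> v" "D c z = r / 2" using ivt_up[OF c(3) _ 2] r by auto
    \<comment> \<open>The first vertex \<open>x\<close> above \<open>z\<close> adds at most one
      vertex to those between \<open>c\<close> and \<open>z\<close>, so \<open>chain_compare\<close>
      applies with exponent \<open>N\<close>.\<close>
    have "z \<in> down V" using z u unfolding down_def by blast
    then obtain x where x: "x \<in> V" "z \<sqsubseteq> x" "\<forall>w\<in>V. z \<sqsubseteq> w \<longrightarrow> x \<sqsubseteq> w" using above_ex[OF V] by blast
    have xv: "x \<sqsubseteq> v" using x(3) u z by blast
    have cx: "c \<sqsubseteq> x" using le_trans[OF z(1) x(2)] .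
    have "{w\<in>V. c \<sqsubseteq> w \<and> w \<sqsubseteq> x} \<subseteq> insert x {w\<in>V. c \<sqsubseteq> w \<and> w \<sqsubseteq> z}"
    proof
      fix w assume w: "w \<in> {w\<in>V. c \<sqsubseteq> w \<and> w \<sqsubseteq> x}"
      then have "w \<sqsubseteq> z \<or> z \<sqsubseteq> w" using chain[of w x z] x(2) by auto
      then show "w \<in> insert x {w\<in>V. c \<sqsubseteq> w \<and> w \<sqsubseteq> z}" using w x(3) le_antisym by blast
    qed
    then have "card {w\<in>V. c \<sqsubseteq> w \<and> w \<sqsubseteq> x} \<le> card (insert x {w\<in>V. c \<sqsubseteq> w \<and> w \<sqsubseteq> z})"
      using tsetD(1)[OF V] by (intro card_mono) auto
    also have "\<dots> \<le> Suc (card {w\<in>V. c \<sqsubseteq> w \<and> w \<sqsubseteq> z})"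
      using tsetD(1)[OF V] by (simp add: card_insert_if)
    finally have "cnt V c x \<le> Suc (cnt V c z)" unfolding cnt_def .
    then have cn: "cnt V c x \<le> Suc N" using N[OF z(1)] z(3) r by simp
    have E: "h z - h y = k z * D y z \<and> \<kappa> y \<le> 4 * k z \<and>
       k z \<le> 4 * \<kappa> y \<and> \<kappa> z \<le> 4 * k z \<and> k z \<le> 4 * \<kappa> z \<and> 0 < \<kappa> z \<and> 0 < k z"
      if yz: "edge V y z" "c \<sqsubseteq> y" "z \<sqsubseteq> v" for y z
    proof -
      note e = hinv_edge[OF H yz(1)]
      have uz: "u \<sqsubset> z" using lt_le_trans[OF c(2) le_trans[OF yz(2) edgeD(4)[OF yz(1)]]] .
      have "B z = B v" using Bconst[OF edgeD(2)[OF yz(1)] uz yz(3)] .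
      then have "y \<noteq> B z" using lt_le_trans[OF c(2) yz(2)] not_le_lt u(3) by auto
      then show ?thesis using e(1-4) e(6,7) hinv_vertex(1)[OF H edgeD(2)[OF yz(1)]]
          hinv_vertex(1)[OF H edgeD(1)[OF yz(1)]] by simp
    qed
    have J: "\<kappa> c \<le> (4\<^sup>2) ^ N * \<kappa> x" "\<kappa> x * D c x \<le> (4\<^sup>2) ^ Suc N * (h x - h c)"
      using chain_compare[where tt = v and L = 4 and h = h and k = k and \<kappa> = \<kappa>, OF V c(1) _ E kc x(1) cx xv cn] by simp_all
    have Dcx: "D c z \<le> D c x" using mono[OF le_refl[OF S(3)] z(1) x(2)] .
    have "\<kappa> c * r = 2 * (\<kappa> c * D c z)" using z(3) by simp
    also have "\<dots> \<le> 2 * (((4\<^sup>2) ^ N * \<kappa> x) * D c x)"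
      using J(1) Dcx D_nonneg hinv_vertex(1)[OF H x(1)] by (intro mult_left_mono mult_mono) auto
    also have "\<dots> = 2 * (4\<^sup>2) ^ N * (\<kappa> x * D c x)" by simp
    also have "\<dots> \<le> 2 * (4\<^sup>2) ^ N * ((4\<^sup>2) ^ Suc N * (h x - h c))"
      using J(2) by (intro mult_left_mono) auto
    also have "\<dots> = 2 * ((4\<^sup>2) ^ N * (4\<^sup>2) ^ Suc N) * (h x - h c)" by (simp only: mult.assoc)
    also have "(4\<^sup>2) ^ N * (4\<^sup>2) ^ Suc N = (16::real) ^ (2 * N + 1)"
    proof -
      have "N + Suc N = 2 * N + 1" "(4::real)\<^sup>2 = 16" by simp_all
      then show ?thesis by (metis power_add)
    qed
    also have "2 * 16 ^ (2 * N + 1) * (h x - h c) \<le> 2 * 16 ^ (2 * N + 1) * (h v - h u)"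
      using h_mono[OF V H x(1) u(2) xv] huc by (intro mult_left_mono) auto
    finally show ?thesis .
  qed
qed

section \<open>Extending the height over cuts and hairs\<close>

lemma cut_density:
  assumes C: "cutpts V u a c b v" and K: "0 < K"
    and t: "t = (K * D u v - K * D u a - K * D b v) / (D a c + D c b)"
  shows "K / 4 \<le> t" "t \<le> 2 * K" "t * D a c + t * D c b = K * D u v - K * D u a - K * D b v"
proof -
  note CC = cutptsD[OF C]
  note CL = CC(2-5,8-12)[THEN lt_le]
  have S: "u \<in> S" "a \<in> S" "c \<in> S" "b \<in> S" "v \<in> S" using CL le_S1 le_S2 by auto
  have r: "x \<sqsubseteq> x" if "x \<in> S" for x using le_refl that .
  have ineq: "D u c \<le> D u v" "D c v \<le> D u v" "D u v \<le> D u c + D c v"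
     "D a c \<le> D u c" "D c b \<le> D c v" "D u c \<le> D u a + D a c" "D c v \<le> D c b + D b v"
    using mono[OF r[OF S(1)] CL(5,6)] mono[OF CL(5,6) r[OF S(5)]] D_tri[OF S(1,3,5)]
      mono[OF CL(1,2) r[OF S(3)]] mono[OF r[OF S(3)] CL(3,4)] D_tri[OF S(1,2,3)] D_tri[OF S(3,4,5)] by auto
  have uv: "0 < D u v" using lt_D_pos[OF edgeD(3)[OF CC(1)]] .
  \<comment> \<open>\<open>?w\<close> is the length that the two middle pieces have to account for,
    \<open>?s\<close> the sum of their actual lengths. The end pieces amount to at most half of
    \<open>D u v\<close>, so \<open>?w / ?s\<close> lies between (1/2) / 2 and 1 / (3/4).\<close>
  let ?s = "D a c + D c b" and ?w = "D u v - D u a - D b v"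
  have s: "3/4 * D u v \<le> ?s" "?s \<le> 2 * D u v" "0 < ?s" using ineq CC(6,7) uv by linarith+
  have w: "D u v / 2 \<le> ?w" "?w \<le> D u v" using ineq CC(6,7) D_nonneg[of u a] D_nonneg[of b v] by linarith+
  have t2: "t = K * (?w / ?s)" unfolding t by (simp add: algebra_simps)
  have "1/4 \<le> ?w / ?s" using s w by (simp add: field_simps)
  then have "K * (1/4) \<le> t" unfolding t2 using K by (intro mult_left_mono) auto
  then show "K / 4 \<le> t" by simp
  have "?w / ?s \<le> 2" using s w uv by (simp add: field_simps)
  then have "t \<le> K * 2" unfolding t2 using K by (intro mult_left_mono) auto
  then show "t \<le> 2 * K" by simp
  have "t * ?s = K * D u v - K * D u a - K * D b v" unfolding t using s by simp
  then show "t * D a c + t * D c b = K * D u v - K * D u a - K * D b v" by (simp add: algebra_simps)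
qed

text \<open>The end pieces keep the density \<open>K\<close> exactly, so the comparisons with
  \<open>u\<close> and \<open>v\<close> are inherited literally. The new vertices also receive
  \<open>K\<close>, and the middle density is between \<open>K / 4\<close> and \<open>2 * K\<close>;
  this is where the factors 4 and 2 of \<open>hinv\<close> come from, and they do not
  deteriorate.\<close>

lemma hinv_cut:
  assumes V: "tset V" and H: "hinv \<epsilon> r V h \<kappa> k B tp" and C: "cutpts V u a c b v"
  shows "\<exists>h' \<kappa>' k' B' tp'. hinv \<epsilon> r (V \<union> {a, c, b}) h' \<kappa>' k' B' tp' \<and>
    (\<forall>x\<in>V. h' x = h x \<and> \<kappa>' x = \<kappa> x \<and> k' x = k x \<and> B' x = B x \<and> tp' x = tp x) \<and>
    (\<forall>x\<in>{a, c, b}. tp' x = tp v)"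
proof -
  note CC = cutptsD[OF C]
  note F = cut_facts[OF V C]
  note e = hinv_edge[OF H CC(1)]
  have vV: "v \<in> V" "u \<in> V" using edgeD[OF CC(1)] by auto
  have vrt: "v \<noteq> rt" using lt_rt[OF edgeD(3)[OF CC(1)]] .
  note ve = hinv_vertex[OF H vV(1)]
  define K where "K = k v"
  define t where "t = (K * D u v - K * D u a - K * D b v) / (D a c + D c b)"
  have K: "0 < K" using e K_def by simp
  note T = cut_density[OF C K t_def]
  define N where "N = {a, c, b}"
  define h' where "h' = h(a := h u + K * D u a, c := h u + K * D u a + t * D a c, b := h v - K * D b v)"
  define \<kappa>' where "\<kappa>' = (\<lambda>x. if x \<in> N then K else \<kappa> x)"
  define k' where "k' = k(a := K, c := t, b := t)"
  define B' where "B' = (\<lambda>x. if x \<in> N then B v else B x)"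
  define tp' where "tp' = (\<lambda>x. if x \<in> N then tp v else tp x)"
  have old: "h' x = h x" "\<kappa>' x = \<kappa> x" "k' x = k x" "B' x = B x" "tp' x = tp x" if "x \<in> V" for x
    using that F(3-5) unfolding h'_def \<kappa>'_def k'_def B'_def tp'_def N_def by auto
  have inN: "a \<in> N" "c \<in> N" "b \<in> N" unfolding N_def by auto
  have new: "\<kappa>' x = K" "B' x = B v" "tp' x = tp v" if "x \<in> N" for x
    using that unfolding \<kappa>'_def B'_def tp'_def by auto
  have newh: "h' a = h u + K * D u a" "h' c = h u + K * D u a + t * D a c" "h' b = h v - K * D b v"
    "k' a = K" "k' c = t" "k' b = t"
    unfolding h'_def k'_def using F(6-8) by auto
  have Bu: "B v \<sqsubseteq> u" by (rule e(5))
  have Bl: "B v \<sqsubset> x" if "x \<in> N" for x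
    using that le_lt_trans[OF Bu CC(2)] le_lt_trans[OF Bu CC(8)] le_lt_trans[OF Bu CC(11)] unfolding N_def by auto
  have BvV: "B v \<in> V" "tp v \<in> V" using ve vrt by auto
  have xv: "x \<sqsubseteq> v" if "x \<in> N" for x using that CC(5,9,10)[THEN lt_le] unfolding N_def by auto
  have edges: "(edge V y z \<and> z \<noteq> v) \<or> (y = u \<and> z = a) \<or> (y = a \<and> z = c)
       \<or> (y = c \<and> z = b) \<or> (y = b \<and> z = v)" if "edge (V \<union> {a, c, b}) y z" for y z
    using that unfolding F(2) .
  have all: "h' z - h' y = k' z * D y z \<and> 0 < k' z \<and> \<kappa>' z \<le> 4 * k' z \<and> k' z \<le> 2 * \<kappa>' z \<and> B' z \<sqsubseteq> y \<and>
      (y \<noteq> B' z \<longrightarrow> \<kappa>' y \<le> 4 * k' z \<and> k' z \<le> 2 * \<kappa>' y \<and> B' y = B' z \<and> tp' y = tp' z) \<and>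
      (y = B' z \<longrightarrow> k' z = \<epsilon> * \<kappa>' y)" if yz: "edge (V \<union> {a, c, b}) y z" for y z
    using edges[OF yz]
  proof (elim disjE conjE)
    assume x: "edge V y z" "z \<noteq> v"
    note g = hinv_edge[OF H x(1)]
    have yz': "y \<in> V" "z \<in> V" using edgeD[OF x(1)] by auto
    show ?thesis unfolding old[OF yz'(1)] old[OF yz'(2)] using g by blast
  next
    assume x: "y = u" "z = a"
    have e': "u \<noteq> B v \<Longrightarrow> \<kappa> u \<le> 4 * K \<and> K \<le> 2 * \<kappa> u \<and> B u = B v \<and> tp u = tp v" "u = B v \<Longrightarrow> K = \<epsilon> * \<kappa> u"
      using e K_def by auto
    show ?thesis unfolding x newh new[OF inN(1)] old[OF vV(2)] using K Bu e' by auto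
  next
    assume x: "y = a" "z = c"
    have "a \<noteq> B v" using Bl[OF inN(1)] lt_irrefl by auto
    then show ?thesis unfolding x newh new[OF inN(1)] new[OF inN(2)]
      using K T lt_le[OF Bl[OF inN(1)]] by auto
  next
    assume x: "y = c" "z = b"
    have "c \<noteq> B v" using Bl[OF inN(2)] lt_irrefl by auto
    moreover have "h' b - h' c = t * D c b" using T(3) e(1) unfolding newh K_def by linarith
    ultimately show ?thesis unfolding x newh(4-6) new[OF inN(2)] new[OF inN(3)]
      using K T lt_le[OF Bl[OF inN(2)]] by auto
  next
    assume x: "y = b" "z = v"
    have "b \<noteq> B v" using Bl[OF inN(3)] lt_irrefl by auto
    then show ?thesis unfolding x newh old[OF vV(1)] new[OF inN(3)]
      using K e lt_le[OF Bl[OF inN(3)]] K_def by auto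
  qed
  have ver: "v' \<sqsubseteq> tp' v' \<and> tp' v' \<in> V \<union> {a, c, b} \<and> B' v' \<in> V \<union> {a, c, b} \<and> B' v' \<sqsubset> v' \<and> B' (tp' v') = B' v' \<and> tp' (tp' v') = tp' v' \<and>
      r \<le> D (B' v') (tp' v') \<and> h' (tp' v') - h' (B' v') = \<epsilon> * \<kappa>' (B' v') * D (B' v') (tp' v') \<and>
      (B' v' \<noteq> rt \<longrightarrow> 2 * (h' (tp' v') - h' (B' v')) \<le> h' (tp' (B' v')) - h' (B' (B' v')))"
    if v': "v' \<in> V \<union> {a, c, b}" "v' \<noteq> rt" for v'
  proof (cases "v' \<in> V")
    case True
    note g = hinv_vertex[OF H True]
    have m: "tp v' \<in> V" "B v' \<in> V" using g v' by auto
    have m2: "B (B v') \<in> V" "tp (B v') \<in> V" if "B v' \<noteq> rt" using hinv_vertex(3,4)[OF H m(2) that] by auto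
    show ?thesis using g v'(2) by (auto simp: old True m m2)
  next
    case False
    then have n: "v' \<in> N" using v' N_def by auto
    have m2: "B (B v) \<in> V" "tp (B v) \<in> V" if "B v \<noteq> rt" using hinv_vertex(3,4)[OF H BvV(1) that] by auto
    have J: "2 * (h' (tp v) - h' (B v)) \<le> h' (tp' (B v)) - h' (B' (B v))" if b: "B v \<noteq> rt"
      using ve(10)[OF vrt b]
      by (simp only: old(1)[OF m2(1)[OF b]] old(1)[OF m2(2)[OF b]] old(4,5)[OF BvV(1)] old(1)[OF BvV(1)] old(1)[OF BvV(2)])
    show ?thesis unfolding new[OF n]
    proof (intro conjI impI)
      show "v' \<sqsubseteq> tp v" using le_trans[OF xv[OF n] ve(2)[OF vrt]] .
      show "tp v \<in> V \<union> {a, c, b}" "B v \<in> V \<union> {a, c, b}" using BvV by auto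
      show "B v \<sqsubset> v'" by (rule Bl[OF n])
      show "B' (tp v) = B v" "tp' (tp v) = tp v" "r \<le> D (B v) (tp v)"
        "h' (tp v) - h' (B v) = \<epsilon> * \<kappa>' (B v) * D (B v) (tp v)"
        unfolding old[OF BvV(1)] old[OF BvV(2)] using ve vrt by simp_all
    qed (rule J)
  qed
  have "hinv \<epsilon> r (V \<union> {a, c, b}) h' \<kappa>' k' B' tp'"
    unfolding hinv_def
  proof (intro conjI)
    show "\<forall>x\<in>V \<union> {a, c, b}. 0 < \<kappa>' x" 
    proof
      fix x assume x: "x \<in> V \<union> {a, c, b}"
      show "0 < \<kappa>' x"
      proof (cases "x \<in> N")
        case True then show ?thesis using new(1) K by simp
      next
        case False
        then have "x \<in> V" using x unfolding N_def by blast
        then show ?thesis using old(2) hinv_vertex(1)[OF H] by simp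
      qed
    qed
  qed (intro allI ballI impI, rule all ver, assumption+)+
  moreover have "\<forall>x\<in>V. h' x = h x \<and> \<kappa>' x = \<kappa> x \<and> k' x = k x \<and> B' x = B x \<and> tp' x = tp x"
    using old by blast
  moreover have "\<forall>x\<in>{a, c, b}. tp' x = tp v" using new(3) N_def by blast
  ultimately show ?thesis by (intro exI conjI)
qed

text \<open>Only the decay clause needs an argument. The hair that carries \<open>c\<close> is at
  least as long as the mesh \<open>r\<close>, so by \<open>hair_lower\<close> its height is at least
  a fixed multiple of \<open>\<kappa> c * r\<close>. The new hair has height
  \<open>\<epsilon> * \<kappa> c * r\<close>, and the smallness of \<epsilon> makes this at most
  half.\<close>

lemma hinv_hair:
  assumes V: "tset V" and H: "hinv \<epsilon> r V h \<kappa> k B tp"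
    and p: "proj V c p" "c \<in> V" "p \<noteq> c" "D c p = r" and r: "0 < r"
    and N: "\<And>y z. y \<sqsubseteq> z \<Longrightarrow> D y z \<le> r \<Longrightarrow> cnt V y z \<le> N"
    and \<epsilon>: "0 < \<epsilon>" "\<epsilon> * (4 * 16 ^ (2 * N + 1)) \<le> 1"
  shows "\<exists>h' \<kappa>' k' B' tp'. hinv \<epsilon> r (insert p V) h' \<kappa>' k' B' tp' \<and>
    (\<forall>x\<in>V. h' x = h x \<and> \<kappa>' x = \<kappa> x \<and> k' x = k x \<and> B' x = B x \<and> tp' x = tp x) \<and> tp' p = p \<and> B' p = c"
proof -
  note F = hair_facts[OF V p(1,2,3)]
  define h' where "h' = h(p := h c + \<epsilon> * \<kappa> c * r)"
  define \<kappa>' where "\<kappa>' = \<kappa>(p := \<epsilon> * \<kappa> c)"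
  define k' where "k' = k(p := \<epsilon> * \<kappa> c)"
  define B' where "B' = B(p := c)"
  define tp' where "tp' = tp(p := p)"
  have old: "h' x = h x" "\<kappa>' x = \<kappa> x" "k' x = k x" "B' x = B x" "tp' x = tp x" if "x \<in> V" for x
    using that F(4) unfolding h'_def \<kappa>'_def k'_def B'_def tp'_def by auto
  have new: "h' p = h c + \<epsilon> * \<kappa> c * r" "\<kappa>' p = \<epsilon> * \<kappa> c" "k' p = \<epsilon> * \<kappa> c" "B' p = c" "tp' p = p"
    unfolding h'_def \<kappa>'_def k'_def B'_def tp'_def by auto
  have kc: "0 < \<kappa> c" using hinv_vertex(1)[OF H p(2)] .
  then have kk: "0 < \<epsilon> * \<kappa> c" using \<epsilon> by simp
  have cp: "c \<sqsubset> p" "c \<sqsubseteq> c" "p \<sqsubseteq> p"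
    using projD(2)[OF p(1)] p(3) le_refl le_S1 le_S2 unfolding lt_def by auto
  have all: "h' z - h' y = k' z * D y z \<and> 0 < k' z \<and> \<kappa>' z \<le> 4 * k' z \<and> k' z \<le> 2 * \<kappa>' z \<and> B' z \<sqsubseteq> y \<and>
      (y \<noteq> B' z \<longrightarrow> \<kappa>' y \<le> 4 * k' z \<and> k' z \<le> 2 * \<kappa>' y \<and> B' y = B' z \<and> tp' y = tp' z) \<and>
      (y = B' z \<longrightarrow> k' z = \<epsilon> * \<kappa>' y)" if yz: "edge (insert p V) y z" for y z
    using yz[unfolded F(2)]
  proof (elim disjE conjE)
    assume x: "edge V y z"
    note g = hinv_edge[OF H x(1)]
    have yz': "y \<in> V" "z \<in> V" using edgeD[OF x(1)] by auto
    show ?thesis unfolding old[OF yz'(1)] old[OF yz'(2)] using g by blast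
  next
    assume x: "y = c" "z = p"
    show ?thesis unfolding x new old[OF p(2)] p(4) using cp kk by simp
  qed
  have base: "2 * (\<epsilon> * \<kappa> c * r) \<le> h (tp c) - h (B c)" if c: "c \<noteq> rt"
  proof -
    note g = hinv_vertex[OF H p(2)]
    have "\<kappa> c * r \<le> 2 * 16 ^ (2 * N + 1) * (h (tp c) - h (B c))"
      by (rule hair_lower[OF V H N r g(8)[OF c] g(4)[OF c] g(3)[OF c] _ p(2) g(5)[OF c] g(2)[OF c]])
        (use g(6)[OF c] le_refl[OF le_S1[OF lt_le[OF g(5)[OF c]]]] in auto)
    then have "2 * \<epsilon> * (\<kappa> c * r) \<le> 2 * \<epsilon> * (2 * 16 ^ (2 * N + 1) * (h (tp c) - h (B c)))"
      using \<epsilon> by (intro mult_left_mono) auto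
    also have "\<dots> = \<epsilon> * (4 * 16 ^ (2 * N + 1)) * (h (tp c) - h (B c))" by simp
    also have "\<dots> \<le> 1 * (h (tp c) - h (B c))"
    proof (rule mult_right_mono[OF \<epsilon>(2)])
      have "B c \<sqsubseteq> tp c" using le_trans[OF lt_le[OF g(5)[OF c]] g(2)[OF c]] .
      then show "0 \<le> h (tp c) - h (B c)" using h_mono[OF V H g(4)[OF c] g(3)[OF c]] by simp
    qed
    finally show ?thesis by simp
  qed
  have ver: "v' \<sqsubseteq> tp' v' \<and> tp' v' \<in> insert p V \<and> B' v' \<in> insert p V \<and> B' v' \<sqsubset> v' \<and> B' (tp' v') = B' v' \<and> tp' (tp' v') = tp' v' \<and>
      r \<le> D (B' v') (tp' v') \<and> h' (tp' v') - h' (B' v') = \<epsilon> * \<kappa>' (B' v') * D (B' v') (tp' v') \<and>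
      (B' v' \<noteq> rt \<longrightarrow> 2 * (h' (tp' v') - h' (B' v')) \<le> h' (tp' (B' v')) - h' (B' (B' v')))"
    if v': "v' \<in> insert p V" "v' \<noteq> rt" for v'
  proof (cases "v' \<in> V")
    case True
    note g = hinv_vertex[OF H True]
    have m: "tp v' \<in> V" "B v' \<in> V" using g v' by auto
    have m2: "B (B v') \<in> V" "tp (B v') \<in> V" if "B v' \<noteq> rt" using hinv_vertex(3,4)[OF H m(2) that] by auto
    show ?thesis using g v'(2) by (auto simp: old True m m2)
  next
    case False
    then have n: "v' = p" using v' by auto
    have m2: "B c \<in> V" "tp c \<in> V" if "c \<noteq> rt" using hinv_vertex(3,4)[OF H p(2) that] by auto
    show ?thesis unfolding n using cp p base by (auto simp: new old m2)
  qed
  have "hinv \<epsilon> r (insert p V) h' \<kappa>' k' B' tp'"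
    unfolding hinv_def
  proof (intro conjI)
    show "\<forall>x\<in>insert p V. 0 < \<kappa>' x" using kk hinv_vertex(1)[OF H] unfolding \<kappa>'_def by auto
  qed (intro allI ballI impI, rule all ver, assumption+)+
  then show ?thesis using old new by blast
qed

text \<open>The last clause dates the hairs: a hair whose tip is not old has the length of the mesh
  at this step. \<open>upper\<close> needs this to relate late hairs to the scale at which they were
  attached.\<close>

lemma hinv_gstep:
  assumes V: "tset V" "v0 \<in> V" "v0 \<noteq> rt" and g: "gstep V c V'" and H: "hinv \<epsilon> (msh V) V h \<kappa> k B tp"
    and N: "\<And>y z. y \<sqsubseteq> z \<Longrightarrow> D y z \<le> msh V \<Longrightarrow> cnt V' y z \<le> N"
    and \<epsilon>: "0 < \<epsilon>" "\<epsilon> * (4 * 16 ^ (2 * N + 1)) \<le> 1"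
  shows "\<exists>h' \<kappa>' k' B' tp'. hinv \<epsilon> (msh V') V' h' \<kappa>' k' B' tp' \<and>
    (\<forall>x\<in>V. h' x = h x \<and> \<kappa>' x = \<kappa> x \<and> k' x = k x \<and> B' x = B x \<and> tp' x = tp x) \<and>
    (\<forall>x\<in>V'. x \<noteq> rt \<longrightarrow> tp' x \<in> V \<or> D (B' x) (tp' x) = msh V \<and> B' x \<in> V')"
proof -
  have fin: "finite V'" using gstep_facts(1)[OF V g] tsetD(1) by blast
  have mle: "msh V' \<le> msh V" using gstep_facts(4)[OF V g] .
  obtain V1 where V1: "V1 = V \<and> c \<in> V \<or> (\<exists>u a b v. cutpts V u a c b v \<and> V1 = V \<union> {a, c, b})"
    and V2: "V' = V1 \<and> (\<exists>u v. edge V u v \<and> u \<sqsubset> c \<and> c \<sqsubset> v \<and> msh V / 2 \<le> D u c \<and> msh V / 2 \<le> D c v) \<or>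
      (\<exists>p. proj V c p \<and> p \<noteq> c \<and> D c p = msh V \<and> V' = insert p V1)"
    using g unfolding gstep_def by (elim exE conjE) (rule that)
  have "\<exists>h' \<kappa>' k' B' tp'. hinv \<epsilon> (msh V) V1 h' \<kappa>' k' B' tp' \<and>
    (\<forall>x\<in>V. h' x = h x \<and> \<kappa>' x = \<kappa> x \<and> k' x = k x \<and> B' x = B x \<and> tp' x = tp x) \<and>
    (\<forall>x\<in>V1. x \<noteq> rt \<longrightarrow> tp' x \<in> V) \<and> tset V1 \<and> c \<in> V1 \<and> V \<subseteq> V1 \<and> down V1 = down V"
    using V1
  proof (elim disjE exE conjE)
    assume "V1 = V" "c \<in> V"
    then show ?thesis using H V(1) hinv_vertex(3)[OF H]
      by (intro exI[of _ h] exI[of _ \<kappa>] exI[of _ k] exI[of _ B] exI[of _ tp]) auto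
  next
    fix u a b v assume C: "cutpts V u a c b v" and eq: "V1 = V \<union> {a, c, b}"
    note F = cut_facts[OF V(1) C]
    have v: "v \<in> V" "v \<noteq> rt" using edgeD(2)[OF cutptsD(1)[OF C]] lt_rt[OF edgeD(3)[OF cutptsD(1)[OF C]]] by auto
    obtain h' \<kappa>' k' B' tp' where X: "hinv \<epsilon> (msh V) V1 h' \<kappa>' k' B' tp'"
      "\<forall>x\<in>V. h' x = h x \<and> \<kappa>' x = \<kappa> x \<and> k' x = k x \<and> B' x = B x \<and> tp' x = tp x"
      "\<forall>x\<in>{a, c, b}. tp' x = tp v"
      using hinv_cut[OF V(1) H C] unfolding eq by blast
    have "\<forall>x\<in>V1. x \<noteq> rt \<longrightarrow> tp' x \<in> V" using X(2,3) hinv_vertex(3)[OF H] v unfolding eq by auto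
    then show ?thesis using X(1,2) F(1,9) eq by blast
  qed
  then obtain h1 \<kappa>1 k1 B1 tp1 where X: "hinv \<epsilon> (msh V) V1 h1 \<kappa>1 k1 B1 tp1"
    "\<forall>x\<in>V. h1 x = h x \<and> \<kappa>1 x = \<kappa> x \<and> k1 x = k x \<and> B1 x = B x \<and> tp1 x = tp x"
    "\<forall>x\<in>V1. x \<noteq> rt \<longrightarrow> tp1 x \<in> V" "tset V1" "c \<in> V1" "V \<subseteq> V1" "down V1 = down V" by blast
  show ?thesis using V2
  proof (elim disjE exE conjE)
    assume "V' = V1"
    moreover from this have "hinv \<epsilon> (msh V') V' h1 \<kappa>1 k1 B1 tp1" using hinv_weaken[OF X(1) mle] by simp
    moreover have "\<forall>x\<in>V'. x \<noteq> rt \<longrightarrow> tp1 x \<in> V \<or> D (B1 x) (tp1 x) = msh V \<and> B1 x \<in> V'"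
      using X(3) calculation(1) by blast
    ultimately show ?thesis using X(2) by (intro exI conjI)
  next
    fix p assume p: "proj V c p" "p \<noteq> c" "D c p = msh V" "V' = insert p V1"
    have pp: "proj V1 c p" using p X(7) unfolding proj_def by simp
    have N1: "cnt V1 y z \<le> N" if "y \<sqsubseteq> z" "D y z \<le> msh V" for y z
    proof -
      have "cnt V1 y z \<le> cnt V' y z" unfolding cnt_def using fin p(4) by (intro card_mono) auto
      then show ?thesis using N[OF that] by simp
    qed
    note HF = hair_facts[OF X(4) pp X(5) p(2)]
    obtain h' \<kappa>' k' B' tp' where Y: "hinv \<epsilon> (msh V) (insert p V1) h' \<kappa>' k' B' tp'"
      "\<forall>x\<in>V1. h' x = h1 x \<and> \<kappa>' x = \<kappa>1 x \<and> k' x = k1 x \<and> B' x = B1 x \<and> tp' x = tp1 x" "tp' p = p" "B' p = c"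
      using hinv_hair[OF X(4,1) pp X(5) p(2,3) msh_pos[OF V] N1 \<epsilon>] by blast
    have "\<forall>x\<in>V'. x \<noteq> rt \<longrightarrow> tp' x \<in> V \<or> D (B' x) (tp' x) = msh V \<and> B' x \<in> V'"
      using X(3,5) Y p by auto
    moreover have "\<forall>x\<in>V. h' x = h x \<and> \<kappa>' x = \<kappa> x \<and> k' x = k x \<and> B' x = B x \<and> tp' x = tp x"
      using X(2,6) Y(2) by auto
    moreover have "hinv \<epsilon> (msh V') V' h' \<kappa>' k' B' tp'" using hinv_weaken[OF Y(1) mle] p(4) by simp
    ultimately show ?thesis by (intro exI conjI)
  qed
qed

section \<open>A height function on all vertices\<close>

lemma far_point: "\<exists>x0\<in>S. x0 \<noteq> rt \<and> (\<forall>x\<in>S. D rt x \<le> 2 * D rt x0)"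
proof -
  obtain x1 where x1: "x1 \<in> S" "x1 \<noteq> rt" using nontriv by blast
  obtain \<Delta> where \<Delta>: "\<forall>x\<in>S. \<forall>y\<in>S. D x y \<le> \<Delta>" using bounded by blast
  let ?A = "D rt ` S"
  have bdd: "bdd_above ?A" using \<Delta> rt_S by (auto intro!: bdd_aboveI[of _ \<Delta>])
  have p: "0 < Sup ?A" using cSup_upper[OF _ bdd, of "D rt x1"] D_pos[OF rt_S x1(1)] x1 by force
  then have "Sup ?A / 2 < Sup ?A" by simp
  moreover have "?A \<noteq> {}" using rt_S by auto
  ultimately have "\<exists>y\<in>?A. Sup ?A / 2 < y" using less_cSup_iff[OF _ bdd] by blast
  then obtain x0 where x0: "x0 \<in> S" "Sup ?A / 2 < D rt x0" by blast
  have "x0 \<noteq> rt" using x0 p D_zero[OF rt_S rt_S] by auto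
  moreover have "D rt x \<le> 2 * D rt x0" if "x \<in> S" for x using cSup_upper[OF _ bdd, of "D rt x"] that x0 by simp
  ultimately show ?thesis using x0 by blast
qed

lemma hinv_initial:
  assumes x0: "x0 \<in> S" "x0 \<noteq> rt" "\<forall>x\<in>S. D rt x \<le> 2 * D rt x0" and \<epsilon>: "0 < \<epsilon>"
  shows "\<exists>h \<kappa> k B tp. hinv \<epsilon> (msh {rt, x0}) {rt, x0} h \<kappa> k B tp"
proof -
  have V: "tset {rt, x0}" using initial_tset[OF x0(1)] .
  have lt: "rt \<sqsubset> x0" using le_rt x0 unfolding lt_def by auto
  have e: "u = rt \<and> v = x0" if "edge {rt, x0} u v" for u v
    using edgeD(1,2,3)[OF that] lt_rt[of u v] lt_irrefl by auto
  have D00: "D rt rt = 0" using D_zero rt_S by auto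
  \<comment> \<open>The first hair must be at least as long as the mesh, which is half the largest
    gap. Hence \<open>x0\<close> is chosen as far from the root as possible, up to the factor
    2.\<close>
  have "2 * msh {rt, x0} \<le> 2 * D rt x0"
  proof (rule msh_least[OF V])
    show "x0 \<in> {rt, x0}" "x0 \<noteq> rt" using x0 by auto
    show "D u v \<le> 2 * D rt x0" if "edge {rt, x0} u v" for u v using e[OF that] D_nonneg[of rt x0] by simp
    show "D q x \<le> 2 * D rt x0" if "proj {rt, x0} q x" for q x
    proof -
      note Q = projD(2)[OF that]
      have "D q x \<le> D rt x" using mono[OF le_rt[OF le_S1[OF Q]] Q le_refl[OF le_S2[OF Q]]] .
      then show ?thesis using x0(3) le_S2[OF Q] by force
    qed
  qed
  then have m: "msh {rt, x0} \<le> D rt x0" by simp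
  \<comment> \<open>The density 1 / \<epsilon> at the root gives the first hair, whose base is the
    root, density 1.\<close>
  have "hinv \<epsilon> (msh {rt, x0}) {rt, x0} (D rt) (\<lambda>x. if x = rt then 1 / \<epsilon> else 1) (\<lambda>x. 1) (\<lambda>x. rt) (\<lambda>x. x0)"
    unfolding hinv_def
  proof (intro conjI allI impI)
    fix u v assume "edge {rt, x0} u v"
    then have uv: "u = rt" "v = x0" using e by auto
    show "D rt v - D rt u = 1 * D u v" "rt \<sqsubseteq> u" "(1::real) = \<epsilon> * (if u = rt then 1 / \<epsilon> else 1)"
      unfolding uv using D00 le_refl rt_S \<epsilon> by auto
    show "(if v = rt then 1 / \<epsilon> else 1) \<le> 4 * 1" "1 \<le> 2 * (if v = rt then 1 / \<epsilon> else 1)"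
      unfolding uv using x0 by auto
    assume "u \<noteq> rt"
    then show "(if u = rt then 1 / \<epsilon> else 1) \<le> 4 * 1" "1 \<le> 2 * (if u = rt then 1 / \<epsilon> else 1)"
      using uv by auto
  next
    show "\<forall>v\<in>{rt, x0}. 0 < (if v = rt then 1 / \<epsilon> else 1)" using \<epsilon> by simp
  qed (use x0 D00 \<epsilon> m lt le_refl in auto)
  then show ?thesis by blast
qed

text \<open>\<open>N\<close> depends only on the vertex sets, and \<epsilon> only on
  \<open>N\<close>; heights are constructed after both are fixed. Since a step never changes the
  data at old vertices, the stages glue together.\<close>

theorem heights_ex:
  "\<exists>V c h \<kappa> k B tp \<epsilon>. gseq V c \<and> 0 < \<epsilon> \<and> \<epsilon> \<le> 1 \<and> (\<forall>n. hinv \<epsilon> (msh (V n)) (V n) h \<kappa> k B tp) \<and>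
    (\<forall>n. \<forall>x\<in>V (Suc n). x \<noteq> rt \<longrightarrow> tp x \<in> V n \<or> D (B x) (tp x) = msh (V n) \<and> B x \<in> V (Suc n))"
proof -
  obtain x0 where x0: "x0 \<in> S" "x0 \<noteq> rt" "\<forall>x\<in>S. D rt x \<le> 2 * D rt x0" using far_point by blast
  obtain V c where G: "gseq V c" "V 0 = {rt, x0}" using gseq_ex[OF x0(1,2)] by blast
  obtain N where N: "\<forall>i y z r. y \<sqsubseteq> z \<longrightarrow> 0 < r \<longrightarrow> (\<forall>l<i. r \<le> msh (V l)) \<longrightarrow> D y z \<le> 1 * r \<longrightarrow>
     card {v\<in>V i. y \<sqsubseteq> v \<and> v \<sqsubseteq> z} \<le> N" using count_vertices[OF G(1), of 1] by (elim exE) (rule that)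
  have N': "cnt (V (Suc n)) y z \<le> N" if "y \<sqsubseteq> z" "D y z \<le> msh (V n)" for y z n
  proof -
    have "\<forall>l<Suc n. msh (V n) \<le> msh (V l)" using msh_mono[OF G(1)] by simp
    then show ?thesis unfolding cnt_def using N[rule_format, OF that(1) gseq_step(5)[OF G(1), of n], of "Suc n"] that(2) by simp
  qed
  define \<epsilon> :: real where "\<epsilon> = 1 / (4 * 16 ^ (2 * N + 1))"
  have \<epsilon>: "0 < \<epsilon>" "\<epsilon> * (4 * 16 ^ (2 * N + 1)) \<le> 1" "\<epsilon> \<le> 1"
  proof -
    show "0 < \<epsilon>" "\<epsilon> * (4 * 16 ^ (2 * N + 1)) \<le> 1" unfolding \<epsilon>_def by auto
    have "(1::real) \<le> 16 ^ (2 * N + 1)" by (rule one_le_power) simp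
    then have "(1::real) \<le> 4 * 16 ^ (2 * N + 1)" by linarith
    then show "\<epsilon> \<le> 1" unfolding \<epsilon>_def by (simp only: le_divide_eq_1 divide_le_eq_1) auto
  qed
  let ?P = "\<lambda>(n::nat) (s :: ('a \<Rightarrow> real) \<times> ('a \<Rightarrow> real) \<times> ('a \<Rightarrow> real) \<times> ('a \<Rightarrow> 'a) \<times> ('a \<Rightarrow> 'a)).
     case s of (h, \<kappa>, k, B, tp) \<Rightarrow> hinv \<epsilon> (msh (V n)) (V n) h \<kappa> k B tp"
  let ?Q = "\<lambda>(n::nat) (s :: ('a \<Rightarrow> real) \<times> ('a \<Rightarrow> real) \<times> ('a \<Rightarrow> real) \<times> ('a \<Rightarrow> 'a) \<times> ('a \<Rightarrow> 'a))
     (s' :: ('a \<Rightarrow> real) \<times> ('a \<Rightarrow> real) \<times> ('a \<Rightarrow> real) \<times> ('a \<Rightarrow> 'a) \<times> ('a \<Rightarrow> 'a)).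
     case s of (h, \<kappa>, k, B, tp) \<Rightarrow> case s' of (h', \<kappa>', k', B', tp') \<Rightarrow>
     (\<forall>x\<in>V n. h' x = h x \<and> \<kappa>' x = \<kappa> x \<and> k' x = k x \<and> B' x = B x \<and> tp' x = tp x) \<and>
     (\<forall>x\<in>V (Suc n). x \<noteq> rt \<longrightarrow> tp' x \<in> V n \<or> D (B' x) (tp' x) = msh (V n) \<and> B' x \<in> V (Suc n))"
  have "\<exists>f. \<forall>n. ?P n (f n) \<and> ?Q n (f n) (f (Suc n))"
  proof (rule dependent_nat_choice)
    show "\<exists>s. ?P 0 s" using hinv_initial[OF x0 \<epsilon>(1)] unfolding G(2) by auto
    fix s n assume s: "?P n s"
    obtain h \<kappa> k B tp where s_eq: "s = (h, \<kappa>, k, B, tp)" by (metis prod.exhaust)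
    obtain v where v: "v \<in> V n" "v \<noteq> rt" using gseq_inv[OF G(1)] by blast
    have g: "gstep (V n) (c n) (V (Suc n))" using G(1) unfolding gseq_def by blast
    have H: "hinv \<epsilon> (msh (V n)) (V n) h \<kappa> k B tp" using s unfolding s_eq by simp
    obtain h' \<kappa>' k' B' tp' where X: "hinv \<epsilon> (msh (V (Suc n))) (V (Suc n)) h' \<kappa>' k' B' tp'"
      "\<forall>x\<in>V n. h' x = h x \<and> \<kappa>' x = \<kappa> x \<and> k' x = k x \<and> B' x = B x \<and> tp' x = tp x"
      "\<forall>x\<in>V (Suc n). x \<noteq> rt \<longrightarrow> tp' x \<in> V n \<or> D (B' x) (tp' x) = msh (V n) \<and> B' x \<in> V (Suc n)"
      using hinv_gstep[OF gseq_tset[OF G(1)] v g H N' \<epsilon>(1,2)] by blast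
    then show "\<exists>s'. ?P (Suc n) s' \<and> ?Q n s s'" unfolding s_eq
      by (intro exI[of _ "(h', \<kappa>', k', B', tp')"]) simp
  qed
  then obtain f where f0: "\<forall>n. ?P n (f n) \<and> ?Q n (f n) (f (Suc n))" by (rule exE)
  note f = conjunct1[OF spec[OF f0]] conjunct2[OF spec[OF f0]]
  define ag where "ag x s s' \<longleftrightarrow> fst s x = fst s' x \<and> fst (snd s) x = fst (snd s') x \<and> fst (snd (snd s)) x = fst (snd (snd s')) x
    \<and> fst (snd (snd (snd s))) x = fst (snd (snd (snd s'))) x \<and> snd (snd (snd (snd s))) x = snd (snd (snd (snd s'))) x"
    for x :: 'a and s s' :: "('a \<Rightarrow> real) \<times> ('a \<Rightarrow> real) \<times> ('a \<Rightarrow> real) \<times> ('a \<Rightarrow> 'a) \<times> ('a \<Rightarrow> 'a)"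
  have ag1: "ag x (f m) (f n)" if "m \<le> n" "x \<in> V m" for x m n
    using that(1)
  proof (induction rule: dec_induct)
    case base show ?case by (simp add: ag_def)
  next
    case (step n)
    have "x \<in> V n" using gseq_mono[OF G(1) step(1)] that by blast
    then show ?case using step f(2)[of n] unfolding ag_def by (auto split: prod.splits)
  qed
  \<comment> \<open>The data of a vertex are frozen from the first stage that contains it.\<close>
  define i where "i x = (LEAST n. x \<in> V n)" for x
  have i: "x \<in> V (i x)" "i x \<le> n" if "x \<in> V n" for x n
    using that unfolding i_def by (auto intro: LeastI Least_le)
  define g where "g x = f (i x)" for x
  have gx: "ag x (g x) (f n)" if "x \<in> V n" for x n unfolding g_def using ag1[OF i(2,1)[OF that]] .
  define h where "h x = fst (g x) x" for x
  define \<kappa> where "\<kappa> x = fst (snd (g x)) x" for x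
  define k where "k x = fst (snd (snd (g x))) x" for x
  define B where "B x = fst (snd (snd (snd (g x)))) x" for x
  define tp where "tp x = snd (snd (snd (snd (g x)))) x" for x
  have H: "hinv \<epsilon> (msh (V n)) (V n) h \<kappa> k B tp" for n
  proof -
    obtain h1 \<kappa>1 k1 B1 tp1 where s_eq: "f n = (h1, \<kappa>1, k1, B1, tp1)" by (metis prod.exhaust)
    have "hinv \<epsilon> (msh (V n)) (V n) h1 \<kappa>1 k1 B1 tp1" using f(1)[of n] unfolding s_eq by simp
    then show ?thesis
      by (rule hinv_cong) (use gx[of _ n] in \<open>simp add: ag_def s_eq h_def \<kappa>_def k_def B_def tp_def\<close>)
  qed
  have "\<forall>x\<in>V (Suc n). x \<noteq> rt \<longrightarrow> tp x \<in> V n \<or> D (B x) (tp x) = msh (V n) \<and> B x \<in> V (Suc n)" for n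
  proof (intro ballI impI)
    fix x assume x: "x \<in> V (Suc n)" "x \<noteq> rt"
    obtain h1 \<kappa>1 k1 B1 tp1 where s_eq: "f n = (h1, \<kappa>1, k1, B1, tp1)" by (metis prod.exhaust)
    obtain h2 \<kappa>2 k2 B2 tp2 where s_eq2: "f (Suc n) = (h2, \<kappa>2, k2, B2, tp2)" by (metis prod.exhaust)
    have "tp x = tp2 x" "B x = B2 x" using gx[OF x(1)] unfolding ag_def s_eq2 tp_def B_def by auto
    then show "tp x \<in> V n \<or> D (B x) (tp x) = msh (V n) \<and> B x \<in> V (Suc n)"
      using f(2)[of n] x unfolding s_eq s_eq2 by simp
  qed
  then show ?thesis using G(1) \<epsilon>(1,3) H by blast
qed

lemma cnt_lt:
  assumes "tset V" "y \<sqsubset> x" "x \<in> V" "c \<sqsubseteq> y"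
  shows "cnt V c y < cnt V c x"
  unfolding cnt_def
proof (rule psubset_card_mono)
  show "finite {v \<in> V. c \<sqsubseteq> v \<and> v \<sqsubseteq> x}" using tsetD(1)[OF assms(1)] by simp
  note yx = lt_le[OF assms(2)]
  have "x \<sqsubseteq> x" "c \<sqsubseteq> x" using le_refl[OF le_S2[OF yx]] le_trans[OF assms(4) yx] by auto
  then have "x \<in> {v \<in> V. c \<sqsubseteq> v \<and> v \<sqsubseteq> x}" using assms(3) by simp
  moreover have "x \<notin> {v \<in> V. c \<sqsubseteq> v \<and> v \<sqsubseteq> y}" using not_le_lt[OF assms(2)] by simp
  moreover have "{v \<in> V. c \<sqsubseteq> v \<and> v \<sqsubseteq> y} \<subseteq> {v \<in> V. c \<sqsubseteq> v \<and> v \<sqsubseteq> x}"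
    using le_trans[OF _ yx] by auto
  ultimately show "{v \<in> V. c \<sqsubseteq> v \<and> v \<sqsubseteq> y} \<subset> {v \<in> V. c \<sqsubseteq> v \<and> v \<sqsubseteq> x}" by auto
qed

lemma hair_edges:
  assumes V: "tset V" and H: "hinv \<epsilon> r V h \<kappa> k B tp" and u: "v \<in> V" "B v \<sqsubseteq> u"
    and yz: "edge V y z" "u \<sqsubset> y" "z \<sqsubseteq> v"
  shows "h z - h y = k z * D y z \<and> \<kappa> y \<le> 4 * k z \<and>
       k z \<le> 4 * \<kappa> y \<and> \<kappa> z \<le> 4 * k z \<and> k z \<le> 4 * \<kappa> z \<and> 0 < \<kappa> z \<and> 0 < k z"
proof -
  note e = hinv_edge[OF H yz(1)]
  have By: "B v \<sqsubset> y" using le_lt_trans[OF u(2) yz(2)] .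
  have "B z = B v"
    using hair_const[OF V H edgeD(2)[OF yz(1)] u(1) lt_le_trans[OF By edgeD(4)[OF yz(1)]] yz(3)] by simp
  then have "y \<noteq> B z" using By lt_irrefl by auto
  then show ?thesis using e(1-4) e(6,7) hinv_vertex(1)[OF H edgeD(2)[OF yz(1)]]
          hinv_vertex(1)[OF H edgeD(1)[OF yz(1)]] by simp
qed

lemma ap_in: "tset V \<Longrightarrow> x \<in> V \<Longrightarrow> ap V x = x"
  using ap_props(2,3)[of V x] le_antisym le_refl tsetD(2) by (metis subsetD)

lemma ap_edge:
  assumes "tset V" "edge V u v" "u \<sqsubset> x" "x \<sqsubset> v"
  shows "ap V x = u"
proof -
  have S: "x \<in> S" using le_S1[OF lt_le[OF assms(4)]] .
  note A = ap_props[OF assms(1) S]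
  have "ap V x \<sqsubset> v" using le_lt_trans[OF A(2) assms(4)] .
  then have "ap V x \<sqsubseteq> u" using edgeD(5)[OF assms(2) A(1)] by simp
  then show ?thesis using A(3)[OF edgeD(1)[OF assms(2)] lt_le[OF assms(3)]] le_antisym by simp
qed

section \<open>Weak quasisymmetry of the height metric\<close>

definition hdist :: "('a \<Rightarrow> real) \<Rightarrow> 'a \<Rightarrow> 'a \<Rightarrow> real" where
  "hdist h x y = h x + h y - 2 * h (mt x y)"

lemma hdist_sym: "x \<in> S \<Longrightarrow> y \<in> S \<Longrightarrow> hdist h x y = hdist h y x"
  unfolding hdist_def using mt_commute[of x y] by simp

context
  fixes V :: "nat \<Rightarrow> 'a set" and c :: "nat \<Rightarrow> 'a" and h \<kappa> k :: "'a \<Rightarrow> real" and B tp :: "'a \<Rightarrow> 'a" and \<epsilon> :: real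
  assumes G: "gseq V c" and \<epsilon>: "0 < \<epsilon>" "\<epsilon> \<le> 1"
    and H: "\<And>n. hinv \<epsilon> (msh (V n)) (V n) h \<kappa> k B tp"
    and A: "\<And>n x. x \<in> V (Suc n) \<Longrightarrow> x \<noteq> rt \<Longrightarrow> tp x \<in> V n \<or> D (B x) (tp x) = msh (V n) \<and> B x \<in> V (Suc n)"
begin

text \<open>Cutting a hair changes neither its base nor its tip, so one can go back to the step at
  which the tip appeared; the length of the hair is the mesh of that step.\<close>

lemma hair_birth:
  assumes "x \<in> V n" "x \<noteq> rt"
  shows "tp x \<in> V i \<or> (\<exists>l\<ge>i. D (B x) (tp x) = msh (V l) \<and> B x \<in> V (Suc l))"
  using assms
proof (induction n arbitrary: x)
  case 0
  then show ?case using hinv_vertex(3)[OF H 0(1)] gseq_mono[OF G, of 0 i] by blast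
next
  case (Suc n)
  note hv = hinv_vertex[OF H Suc.prems(1)]
  show ?case
  proof (cases "Suc n \<le> i")
    case True
    then show ?thesis using hv(3)[OF Suc.prems(2)] gseq_mono[OF G True] by blast
  next
    case False
    then have i: "i \<le> n" by simp
    show ?thesis
    proof (cases "tp x \<in> V n")
      case True
      have "tp x \<noteq> rt" using lt_rt[OF lt_le_trans[OF hv(5) hv(2)]] Suc.prems by blast
      then show ?thesis using Suc.IH[OF True] hv(6,7) Suc.prems(2) by simp
    next
      case False
      then show ?thesis using A[OF Suc.prems] i by blast
    qed
  qed
qed

text \<open>Between the stages \<open>i\<close> and \<open>l\<close> the density at \<open>b\<close>
  may have drifted far from that of the edge. If the edge is at least as long as the mesh at stage
  \<open>l\<close>, the height of the edge pays for the drift through \<open>hair_lower\<close>. If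
  it is shorter, boundedly many vertices separate \<open>b\<close> from \<open>v\<close>, and
  \<open>chain_compare\<close> applies.\<close>

lemma attach_density:
  "\<exists>C::real. 0 \<le> C \<and> (\<forall>i l u v b. i \<le> l \<longrightarrow> edge (V i) u v \<longrightarrow> b \<in> V (Suc l) \<longrightarrow> u \<sqsubset> b \<longrightarrow> b \<sqsubset> v \<longrightarrow>
     \<kappa> b * msh (V l) \<le> C * (k v * msh (V i)))"
proof -
  obtain N where N: "\<forall>i y z r. y \<sqsubseteq> z \<longrightarrow> 0 < r \<longrightarrow> (\<forall>l<i. r \<le> msh (V l)) \<longrightarrow> D y z \<le> 1 * r \<longrightarrow>
     card {v\<in>V i. y \<sqsubseteq> v \<and> v \<sqsubseteq> z} \<le> N" using count_vertices[OF G, of 1] by (elim exE) (rule that)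
  have N': "cnt (V (Suc n)) y z \<le> N" if "y \<sqsubseteq> z" "D y z \<le> msh (V n)" for y z n
  proof -
    have "\<forall>l<Suc n. msh (V n) \<le> msh (V l)" using msh_mono[OF G] by simp
    then show ?thesis unfolding cnt_def using N[rule_format, OF that(1) gseq_step(5)[OF G, of n], of "Suc n"] that(2) by simp
  qed
  define C :: real where "C = 4 * 16 ^ (2 * N + 1)"
  have "\<kappa> b * msh (V l) \<le> C * (k v * msh (V i))"
    if il: "i \<le> l" and uv: "edge (V i) u v" and b: "b \<in> V (Suc l)" "u \<sqsubset> b" "b \<sqsubset> v" for i l u v b
  proof -
    have sub: "V i \<subseteq> V (Suc l)" using gseq_mono[OF G] il by simp
    have uvV: "u \<in> V (Suc l)" "v \<in> V (Suc l)" using sub edgeD[OF uv] by auto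
    note e = hinv_edge[OF H uv]
    note T = gseq_tset[OF G, of "Suc l"]
    have m: "0 < msh (V l)" "msh (V l) \<le> msh (V i)" using gseq_step(5)[OF G] msh_mono[OF G il] by auto
    have km: "0 \<le> k v * msh (V i)" using e(2) m by simp
    show ?thesis
    proof (cases "msh (V l) \<le> D u v")
      case True
      have "\<kappa> b * msh (V l) \<le> 2 * 16 ^ (2 * N + 1) * (h v - h u)"
        by (rule hair_lower[OF T H N' m(1) True uvV e(5) b(1,2) lt_le[OF b(3)]])
      also have "\<dots> = 2 * 16 ^ (2 * N + 1) * (k v * D u v)" using e(1) by simp
      also have "\<dots> \<le> 2 * 16 ^ (2 * N + 1) * (k v * (2 * msh (V i)))"
        using msh_bounds(1)[OF uv] e(2) by (intro mult_left_mono) auto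
      also have "\<dots> = C * (k v * msh (V i))" unfolding C_def by simp
      finally show ?thesis .
    next
      case False
      have "D b v \<le> D u v" using mono[OF lt_le[OF b(2)] lt_le[OF b(3)] le_refl[OF le_S2[OF lt_le[OF b(3)]]]] .
      then have cn: "cnt (V (Suc l)) b v \<le> Suc N" using N'[OF lt_le[OF b(3)], of l] False by simp
      have E: "h z - h y = k z * D y z \<and> \<kappa> y \<le> 4 * k z \<and>
       k z \<le> 4 * \<kappa> y \<and> \<kappa> z \<le> 4 * k z \<and> k z \<le> 4 * \<kappa> z \<and> 0 < \<kappa> z \<and> 0 < k z"
        if "edge (V (Suc l)) y z" "b \<sqsubseteq> y" "z \<sqsubseteq> v" for y z
        using hair_edges[OF T H uvV(2) e(5) that(1) lt_le_trans[OF b(2) that(2)] that(3)] .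
      have "\<kappa> b \<le> (4\<^sup>2) ^ N * \<kappa> v"
        using chain_compare[where tt = v and L = 4 and h = h and k = k and \<kappa> = \<kappa>, OF T b(1) _ E
            hinv_vertex(1)[OF H b(1)] uvV(2) lt_le[OF b(3)] le_refl[OF le_S2[OF lt_le[OF b(3)]]] cn] by simp
      also have "\<dots> \<le> (4\<^sup>2) ^ N * (4 * k v)" using e(3) by (intro mult_left_mono) auto
      finally have "\<kappa> b \<le> 4 * 16 ^ N * k v" by simp
      then have "\<kappa> b * msh (V l) \<le> (4 * 16 ^ N * k v) * msh (V i)"
        using m e(2) by (intro mult_mono) auto
      also have "\<dots> = (4 * 16 ^ N) * (k v * msh (V i))" by simp
      also have "\<dots> \<le> C * (k v * msh (V i))"
      proof (rule mult_right_mono[OF _ km])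
        have "(16::real) ^ N \<le> 16 ^ (2 * N + 1)" by (rule power_increasing) auto
        then show "4 * 16 ^ N \<le> C" unfolding C_def by simp
      qed
      finally show ?thesis .
    qed
  qed
  moreover have "0 \<le> C" unfolding C_def by simp
  ultimately show ?thesis by blast
qed

text \<open>A geometric series over the hairs met on the way down. The subtracted height of the hair
  through \<open>x\<close> makes the induction close: twice this height is at most the height of the
  hair carrying its base.\<close>

lemma hair_descent:
  assumes "x \<in> V n" "x \<notin> down (V i)"
  shows "\<exists>y\<in>V n. y \<sqsubseteq> x \<and> y \<notin> down (V i) \<and> B y \<in> down (V i) \<and>
     h x - h (B y) \<le> 2 * (h (tp y) - h (B y)) - (h (tp x) - h (B x))"
  using assms
proof (induction "cnt (V n) rt x" arbitrary: x rule: less_induct)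
  case less
  note T = gseq_tset[OF G]
  have rtd: "rt \<in> down (V i)" using down_sup[OF tsetD(2)[OF T]] tsetD(3)[OF T] by blast
  then have xr: "x \<noteq> rt" using less.prems by blast
  note hv = hinv_vertex[OF H less.prems(1)]
  have xx: "x \<sqsubseteq> x" using le_refl[OF le_S2[OF lt_le[OF hv(5)[OF xr]]]] .
  have 1: "h x \<le> h (tp x)" using h_mono[OF T H less.prems(1) hv(3)[OF xr] hv(2)[OF xr]] .
  show ?case
  proof (cases "B x \<in> down (V i)")
    case True
    have "h x - h (B x) \<le> 2 * (h (tp x) - h (B x)) - (h (tp x) - h (B x))" using 1 by simp
    then show ?thesis using less.prems xx True by blast
  next
    case False
    then have br: "B x \<noteq> rt" using rtd by auto
    have lt: "cnt (V n) rt (B x) < cnt (V n) rt x"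
      using cnt_lt[OF T hv(5)[OF xr] less.prems(1) le_rt[OF le_S1[OF lt_le[OF hv(5)[OF xr]]]]] .
    obtain y where y: "y \<in> V n" "y \<sqsubseteq> B x" "y \<notin> down (V i)" "B y \<in> down (V i)"
      "h (B x) - h (B y) \<le> 2 * (h (tp y) - h (B y)) - (h (tp (B x)) - h (B (B x)))"
      using less.hyps[OF lt hv(4)[OF xr] False] by blast
    have "h x - h (B y) \<le> 2 * (h (tp y) - h (B y)) - (h (tp x) - h (B x))"
      using y(5) hv(10)[OF xr br] 1 by argo
    then show ?thesis using y le_trans[OF y(2) lt_le[OF hv(5)[OF xr]]] by blast
  qed
qed

lemma edge_low: "edge (V i) u v \<Longrightarrow> k v \<le> 2 * \<kappa> u"
proof -
  assume e: "edge (V i) u v"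
  have "\<epsilon> * \<kappa> u \<le> 1 * \<kappa> u" using \<epsilon> hinv_vertex(1)[OF H edgeD(1)[OF e]] by (intro mult_right_mono) auto
  then show ?thesis using hinv_edge(7,10)[OF H e] hinv_vertex(1)[OF H edgeD(1)[OF e]] by (cases "u = B v") auto
qed

text \<open>A point of the subtree lies in a single edge. From any other point one descends to a
  hair attached after stage \<open>i\<close> whose base is in the subtree; it and all hairs nested
  above add up to at most twice its height, and \<open>attach_density\<close> bounds that height
  when the base is interior to an edge.\<close>

lemma upper:
  "\<exists>C::real. 0 \<le> C \<and> (\<forall>n i x. i \<le> n \<longrightarrow> x \<in> V n \<longrightarrow>
     h (ap (V i) x) \<le> h x \<and> h x - h (ap (V i) x) \<le> C * (\<kappa> (ap (V i) x) * msh (V i)))"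
proof -
  obtain C :: real where C: "0 \<le> C" "\<And>i l u v b. i \<le> l \<Longrightarrow> edge (V i) u v \<Longrightarrow> b \<in> V (Suc l) \<Longrightarrow> u \<sqsubset> b \<Longrightarrow> b \<sqsubset> v \<Longrightarrow>
     \<kappa> b * msh (V l) \<le> C * (k v * msh (V i))" using attach_density by blast
  have "h (ap (V i) x) \<le> h x \<and> h x - h (ap (V i) x) \<le> (4 * C + 4) * (\<kappa> (ap (V i) x) * msh (V i))"
    if i: "i \<le> n" and x: "x \<in> V n" for n i x
  proof -
    note T = gseq_tset[OF G]
    note P = ap_props[OF gseq_tset[OF G, of i] gseq_S[OF G x]]
    let ?x = "ap (V i) x"
    have sub: "V i \<subseteq> V n" using gseq_mono[OF G i] .
    have xn: "?x \<in> V n" using P(1) sub by blast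
    have kp: "0 < \<kappa> ?x" using hinv_vertex(1)[OF H xn] .
    have mp: "0 < msh (V i)" using gseq_step(5)[OF G] .
    have km: "0 \<le> \<kappa> ?x * msh (V i)" using kp mp by simp
    have uvb: "h v - h u \<le> 4 * (\<kappa> u * msh (V i))" if uv: "edge (V i) u v" for u v
    proof -
      have "h v - h u = k v * D u v" using hinv_edge(1)[OF H uv] .
      also have "\<dots> \<le> (2 * \<kappa> u) * (2 * msh (V i))"
        using edge_low[OF uv] msh_bounds(1)[OF uv] D_nonneg hinv_edge(2)[OF H uv] hinv_vertex(1)[OF H edgeD(1)[OF uv]]
        by (intro mult_mono) auto
      finally show ?thesis by simp
    qed
    have "h x - h ?x \<le> (4 * C + 4) * (\<kappa> ?x * msh (V i))"
    proof (cases "x \<in> down (V i)")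
      case True
      show ?thesis
      proof (cases "x \<in> V i")
        case xV: True
        show ?thesis using ap_in[OF T xV] km C(1) by simp
      next
        case False
        obtain u v where uv: "edge (V i) u v" "u \<sqsubset> x" "x \<sqsubset> v" using down_cases[OF T True False] .
        have au: "?x = u" using ap_edge[OF T uv] .
        have "v \<in> V n" using edgeD(2)[OF uv(1)] sub by blast
        then have "h x \<le> h v" using h_mono[OF T H x _ lt_le[OF uv(3)]] by blast
        then have "h x - h ?x \<le> 4 * (\<kappa> ?x * msh (V i))" using uvb[OF uv(1)] unfolding au by linarith
        also have "\<dots> \<le> (4 * C + 4) * (\<kappa> ?x * msh (V i))" using km C(1) by (intro mult_right_mono) auto
        finally show ?thesis .
      qed
    next
      case False
      obtain y where y: "y \<in> V n" "y \<sqsubseteq> x" "y \<notin> down (V i)" "B y \<in> down (V i)"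
        "h x - h (B y) \<le> 2 * (h (tp y) - h (B y)) - (h (tp x) - h (B x))"
        using hair_descent[OF x False] by blast
      have rtd: "rt \<in> down (V i)" using down_sup[OF tsetD(2)[OF T]] tsetD(3)[OF T] by blast
      have yr: "y \<noteq> rt" "x \<noteq> rt" using y(3) False rtd by auto
      note hx = hinv_vertex[OF H x]
      note hy = hinv_vertex[OF H y(1)]
      have "h (B x) \<le> h (tp x)"
        using h_mono[OF T H hx(4) hx(3) le_trans[OF lt_le[OF hx(5)] hx(2)]] yr by blast
      then have hxB: "h x - h (B y) \<le> 2 * (h (tp y) - h (B y))" using y(5) by linarith
      have tpy: "tp y \<notin> V i" using y(3) hy(2)[OF yr(1)] unfolding down_def by blast
      then obtain l where l: "i \<le> l" "D (B y) (tp y) = msh (V l)" "B y \<in> V (Suc l)"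
        using hair_birth[OF y(1) yr(1), of i] by blast
      have kB: "0 < \<kappa> (B y)" using hinv_vertex(1)[OF H hy(4)[OF yr(1)]] .
      have ml: "0 < msh (V l)" "msh (V l) \<le> msh (V i)" using gseq_step(5)[OF G] msh_mono[OF G l(1)] by auto
      have Sy: "h (tp y) - h (B y) \<le> \<kappa> (B y) * msh (V l)"
      proof -
        have "h (tp y) - h (B y) = \<epsilon> * (\<kappa> (B y) * msh (V l))" using hy(9)[OF yr(1)] l(2) by simp
        also have "\<dots> \<le> 1 * (\<kappa> (B y) * msh (V l))" using \<epsilon> kB ml by (intro mult_right_mono) auto
        finally show ?thesis by simp
      qed
      have Bx: "B y \<sqsubseteq> x" using le_trans[OF lt_le[OF hy(5)[OF yr(1)]] y(2)] .
      \<comment> \<open>Otherwise \<open>?x\<close> would lie on the hair through \<open>y\<close>,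
        and the tip of that hair would belong to \<open>V i\<close>, although the hair is
        younger.\<close>
      have nb: "\<not> B y \<sqsubset> ?x"
      proof
        assume b: "B y \<sqsubset> ?x"
        have "\<not> y \<sqsubseteq> ?x" using y(3) P(1) unfolding down_def by blast
        then have xy: "?x \<sqsubseteq> y" using chain[OF y(2) P(2)] by blast
        have "tp ?x = tp y" using hair_const[OF T H xn y(1) b xy] by blast
        then show False using hinv_vertex(3)[OF H P(1) lt_rt[OF b]] tpy by simp
      qed
      show ?thesis
      proof (cases "B y \<in> V i")
        case True
        have "?x = B y" using P(3)[OF True Bx] nb unfolding lt_def by metis
        then have "h x - h ?x \<le> 2 * (\<kappa> ?x * msh (V l))" using hxB Sy by simp
        also have "\<dots> \<le> 2 * (\<kappa> ?x * msh (V i))" using ml kp by simp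
        also have "\<dots> \<le> (4 * C + 4) * (\<kappa> ?x * msh (V i))" using km C(1) by (intro mult_right_mono) auto
        finally show ?thesis .
      next
        case nB: False
        obtain u v where uv: "edge (V i) u v" "u \<sqsubset> B y" "B y \<sqsubset> v" using down_cases[OF T y(4) nB] .
        have "?x \<sqsubset> B y" using chain[OF Bx P(2)] nb nB P(1) unfolding lt_def by metis
        then have "?x \<sqsubset> v" using le_lt_trans[OF lt_le uv(3)] by blast
        then have "?x \<sqsubseteq> u" using edgeD(5)[OF uv(1) P(1)] by blast
        moreover have "u \<sqsubseteq> ?x" using P(3)[OF edgeD(1)[OF uv(1)] le_trans[OF lt_le[OF uv(2)] Bx]] .
        ultimately have au: "?x = u" using le_antisym by blast
        have "v \<in> V n" using edgeD(2)[OF uv(1)] sub by blast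
        then have "h (B y) \<le> h v" using h_mono[OF T H hy(4)[OF yr(1)] _ lt_le[OF uv(3)]] by blast
        then have 1: "h (B y) - h ?x \<le> 4 * (\<kappa> ?x * msh (V i))" using uvb[OF uv(1)] unfolding au by linarith
        have "\<kappa> (B y) * msh (V l) \<le> C * (k v * msh (V i))" using C(2)[OF l(1) uv(1) l(3) uv(2,3)] .
        also have "\<dots> \<le> C * ((2 * \<kappa> u) * msh (V i))"
          using edge_low[OF uv(1)] C(1) mp by (intro mult_left_mono mult_right_mono) auto
        finally have "\<kappa> (B y) * msh (V l) \<le> 2 * C * (\<kappa> ?x * msh (V i))" unfolding au by simp
        then show ?thesis using 1 hxB Sy by (simp add: algebra_simps)
      qed
    qed
    then show ?thesis using h_mono[OF T H xn x P(2)] by blast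
  qed
  then show ?thesis using C(1) by (intro exI[of _ "4 * C + 4"]) auto
qed

text \<open>Unlike in \<open>hair_lower\<close>, the segment may now pass bases of hairs. As
  \<epsilon> is fixed, the constant may depend on it, and 4 / \<epsilon> dominates the ratio at
  every kind of edge.\<close>

lemma chain_bounds:
  "\<exists>C::real. 1 \<le> C \<and> (\<forall>i u v r. 0 < r \<longrightarrow> (\<forall>l<i. r \<le> msh (V l)) \<longrightarrow> u \<in> V i \<longrightarrow> v \<in> V i \<longrightarrow> u \<sqsubseteq> v \<longrightarrow>
     D u v \<le> L * r \<longrightarrow> \<kappa> u \<le> C * \<kappa> v \<and> \<kappa> v \<le> C * \<kappa> u \<and> \<kappa> v * D u v \<le> C * (h v - h u) \<and>
       h v - h u \<le> C * (\<kappa> v * D u v))"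
proof -
  obtain N where N: "\<forall>i y z r. y \<sqsubseteq> z \<longrightarrow> 0 < r \<longrightarrow> (\<forall>l<i. r \<le> msh (V l)) \<longrightarrow> D y z \<le> L * r \<longrightarrow>
     card {v\<in>V i. y \<sqsubseteq> v \<and> v \<sqsubseteq> z} \<le> N" using count_vertices[OF G, of L] by (elim exE) (rule that)
  define K where "K = 4 / \<epsilon>"
  have K: "1 \<le> K" "4 \<le> K" using \<epsilon> unfolding K_def by (auto simp: field_simps)
  define Q where "Q = K\<^sup>2"
  have Q: "1 \<le> Q" using K unfolding Q_def by simp
  define C where "C = real (Suc N) * Q ^ Suc N"
  have Qp: "1 \<le> Q ^ n" for n using Q by simp
  have QC: "Q ^ N \<le> C" "Q ^ Suc N \<le> C" "N * Q ^ Suc N \<le> C" "1 \<le> C"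
  proof -
    have a: "Q ^ N \<le> Q ^ Suc N" using Q by (intro power_increasing) auto
    have b: "1 * Q ^ Suc N \<le> C" unfolding C_def using Qp[of "Suc N"] by (intro mult_right_mono) (auto simp del: power_Suc)
    show "Q ^ N \<le> C" "Q ^ Suc N \<le> C" "1 \<le> C" using a b Qp[of "Suc N"] by linarith+
    show "N * Q ^ Suc N \<le> C" unfolding C_def using Qp[of "Suc N"] by (intro mult_right_mono) (auto simp del: power_Suc)
  qed
  have "\<kappa> u \<le> C * \<kappa> v \<and> \<kappa> v \<le> C * \<kappa> u \<and> \<kappa> v * D u v \<le> C * (h v - h u) \<and>
       h v - h u \<le> C * (\<kappa> v * D u v)"
    if r: "0 < r" "\<forall>l<i. r \<le> msh (V l)" and u: "u \<in> V i" "v \<in> V i" "u \<sqsubseteq> v" "D u v \<le> L * r" for i u v r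
  proof -
    note T = gseq_tset[OF G, of i]
    have cn: "cnt (V i) u v \<le> Suc N" using N[rule_format, OF u(3) r(1), of i] r(2) u(4) unfolding cnt_def by force
    have E: "h z - h y = k z * D y z \<and> \<kappa> y \<le> K * k z \<and>
       k z \<le> K * \<kappa> y \<and> \<kappa> z \<le> K * k z \<and> k z \<le> K * \<kappa> z \<and> 0 < \<kappa> z \<and> 0 < k z"
      if "edge (V i) y z" "u \<sqsubseteq> y" "z \<sqsubseteq> v" for y z
    proof -
      note e = hinv_edge[OF H that(1)]
      have p: "0 < \<kappa> z" "0 < \<kappa> y" using hinv_vertex(1)[OF H] edgeD[OF that(1)] by auto
      have m: "4 * t \<le> K * t" "2 * t \<le> K * t" if "0 \<le> t" for t
        using K that by (auto intro!: mult_right_mono)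
      have "\<kappa> y \<le> K * k z"
      proof (cases "y = B z")
        case True
        then have "k z = \<epsilon> * \<kappa> y" using e(10) by blast
        then have "4 * \<kappa> y = K * k z" unfolding K_def using \<epsilon> by simp
        then show ?thesis using p by linarith
      next
        case False
        then have "\<kappa> y \<le> 4 * k z" using e(6) by simp
        then show ?thesis using m(1)[of "k z"] e(2) by linarith
      qed
      moreover have "k z \<le> K * \<kappa> y" using edge_low[OF that(1)] m(2)[of "\<kappa> y"] p by linarith
      moreover have "\<kappa> z \<le> K * k z" "k z \<le> K * \<kappa> z"
        using e(2,3,4) m(1)[of "k z"] m(2)[of "\<kappa> z"] p by linarith+
      ultimately show ?thesis using e(1,2) p by blast
    qed
    have J: "\<kappa> u \<le> Q ^ N * \<kappa> v \<and> \<kappa> v \<le> Q ^ N * \<kappa> u \<and> 0 < \<kappa> v \<and> h u \<le> h v \<and>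
      \<kappa> v * D u v \<le> Q ^ Suc N * (h v - h u) \<and> h v - h u \<le> N * Q ^ Suc N * (\<kappa> v * D u v)"
      using chain_compare[where tt = v and L = K and h = h and k = k and \<kappa> = \<kappa>, OF T u(1) K(1) E
            hinv_vertex(1)[OF H u(1)] u(2,3) le_refl[OF le_S2[OF u(3)]] cn, folded Q_def] .
    have ku: "0 < \<kappa> u" using hinv_vertex(1)[OF H u(1)] .
    have "Q ^ N * \<kappa> v \<le> C * \<kappa> v" "Q ^ N * \<kappa> u \<le> C * \<kappa> u" using J ku QC by (auto intro!: mult_right_mono)
    moreover have "Q ^ Suc N * (h v - h u) \<le> C * (h v - h u)" using J QC by (intro mult_right_mono) auto
    moreover have "N * Q ^ Suc N * (\<kappa> v * D u v) \<le> C * (\<kappa> v * D u v)"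
      using J QC D_nonneg by (intro mult_right_mono) auto
    ultimately show ?thesis using J by linarith
  qed
  then show ?thesis using QC(4) by (intro exI[of _ C]) auto
qed

text \<open>Here \<open>mt x z\<close> lies between the two last vertices, within
  \<open>4 * r\<close> of \<open>ap (V i) x\<close>, and a vertex \<open>u\<close> follows within
  \<open>2 * r\<close>. What remains up to \<open>ap (V i) z\<close> is a long chain of
  \<open>V i\<close>, and the arc from \<open>x\<close> to \<open>z\<close> climbs at least its
  height.\<close>

lemma lower_aux:
  assumes i: "i \<le> n" and xz: "x \<in> V n" "z \<in> V n" and r: "msh (V i) \<le> r" "0 < r"
    and far: "32 * r \<le> D (ap (V i) x) (ap (V i) z)" "D (ap (V i) x) (ap (V i) z) \<le> 128 * r"
    and le: "ap (V i) x \<sqsubseteq> z"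
  shows "\<exists>u\<in>V i. u \<sqsubseteq> ap (V i) z \<and> 8 * r \<le> D u (ap (V i) z) \<and> D u (ap (V i) z) \<le> 128 * r \<and>
     h (ap (V i) z) - h u \<le> hdist h x z"
proof -
  note T = gseq_tset[OF G]
  have S: "x \<in> S" "z \<in> S" using xz gseq_S[OF G] by auto
  note X = ap_props[OF gseq_tset[OF G, of i] S(1)] and Z = ap_props[OF gseq_tset[OF G, of i] S(2)]
  let ?x = "ap (V i) x" and ?z = "ap (V i) z"
  have sub: "V i \<subseteq> V n" using gseq_mono[OF G i] .
  define m where "m = mt x z"
  have m: "m \<in> V n" "m \<sqsubseteq> x" "m \<sqsubseteq> z" "?x \<sqsubseteq> m"
    unfolding m_def using tsetD(4)[OF T xz] mt1[OF S] mt2[OF S] mt_greatest[OF X(2) le] by auto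
  have xz': "?x \<noteq> ?z" using far r D_zero[of ?x ?x] le_S1[OF X(2)] by auto
  have "\<not> ?z \<sqsubseteq> m"
  proof
    assume "?z \<sqsubseteq> m"
    then have "?z \<sqsubseteq> ?x" using X(3)[OF Z(1) le_trans[OF _ m(2)]] by blast
    moreover have "?x \<sqsubseteq> ?z" using Z(3)[OF X(1) le] .
    ultimately show False using xz' le_antisym by blast
  qed
  then have mz: "m \<sqsubseteq> ?z" using chain[OF m(3) Z(2)] by blast
  have mS: "m \<in> S" "?x \<in> S" "?z \<in> S" using le_S1[OF m(2)] le_S1[OF X(2)] le_S1[OF Z(2)] by auto
  have "\<exists>u\<in>V i. m \<sqsubseteq> u \<and> u \<sqsubseteq> ?z \<and> D m u \<le> 2 * msh (V i)"
  proof (cases "m \<in> V i")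
    case True
    then show ?thesis using le_refl[OF mS(1)] mz D_zero[of m m] mS gseq_step(5)[OF G, of i] by force
  next
    case False
    have "m \<in> down (V i)" using mz Z(1) unfolding down_def by blast
    then obtain p q where pq: "edge (V i) p q" "p \<sqsubset> m" "m \<sqsubset> q" using down_cases[OF T _ False] by blast
    have "q \<sqsubseteq> ?z" using edge_above[OF T pq(1,2) lt_le[OF pq(3)] mz Z(1)] .
    moreover have "D m q \<le> D p q" using mono[OF lt_le[OF pq(2)] lt_le[OF pq(3)] le_refl[OF le_S2[OF lt_le[OF pq(3)]]]] .
    ultimately show ?thesis using msh_bounds(1)[OF pq(1)] edgeD(2)[OF pq(1)] lt_le[OF pq(3)] by force
  qed
  then obtain u where u: "u \<in> V i" "m \<sqsubseteq> u" "u \<sqsubseteq> ?z" "D m u \<le> 2 * msh (V i)" by blast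
  have uS: "u \<in> S" using le_S1[OF u(3)] .
  have "D ?x m \<le> D ?x x" using mono[OF le_refl[OF mS(2)] m(4) m(2)] .
  then have "D ?x m \<le> 4 * r" using ap_dist[OF T S(1), of i] r by linarith
  moreover have "D ?x ?z \<le> D ?x m + D m ?z" "D m ?z \<le> D m u + D u ?z"
    using D_tri mS uS by auto
  ultimately have 1: "8 * r \<le> D u ?z" using far u(4) r by linarith
  have "D u ?z \<le> D ?x ?z" using mono[OF le_trans[OF m(4) u(2)] u(3) le_refl[OF mS(3)]] .
  then have 2: "D u ?z \<le> 128 * r" using far by linarith
  have hh: "h m \<le> h u" "h m \<le> h x" "h ?z \<le> h z" using h_mono[OF T H] m xz u(1,2) Z(1,2) sub by auto
  have "h ?z - h u \<le> hdist h x z" unfolding hdist_def m_def[symmetric] using hh by linarith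
  then show ?thesis using 1 2 u by blast
qed

text \<open>All three points are replaced by their last vertices at the first stage whose mesh is at
  most a fixed fraction of \<open>D x z\<close>. At this scale the densities there are comparable,
  and both sides are compared with \<open>\<kappa> (ap (V i) x) * r\<close>. The factor 3 in place
  of 2 leaves room for the passage to the limit.\<close>

lemma weak_quasisymmetry:
  "\<exists>\<Theta>::real. \<forall>n. \<forall>x\<in>V n. \<forall>y\<in>V n. \<forall>z\<in>V n. x \<noteq> z \<longrightarrow> D x y \<le> 3 * D x z \<longrightarrow> hdist h x y \<le> \<Theta> * hdist h x z"
proof -
  obtain C4 :: real where C4: "0 \<le> C4" "\<And>n i x. i \<le> n \<Longrightarrow> x \<in> V n \<Longrightarrow>
     h (ap (V i) x) \<le> h x \<and> h x - h (ap (V i) x) \<le> C4 * (\<kappa> (ap (V i) x) * msh (V i))" using upper by blast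
  obtain C :: real where C: "1 \<le> C" "\<And>i u v r. 0 < r \<Longrightarrow> (\<forall>l<i. r \<le> msh (V l)) \<Longrightarrow> u \<in> V i \<Longrightarrow> v \<in> V i \<Longrightarrow> u \<sqsubseteq> v \<Longrightarrow>
     D u v \<le> 128 * r \<Longrightarrow> \<kappa> u \<le> C * \<kappa> v \<and> \<kappa> v \<le> C * \<kappa> u \<and> \<kappa> v * D u v \<le> C * (h v - h u) \<and>
       h v - h u \<le> C * (\<kappa> v * D u v)"
    using chain_bounds[of 128] by blast
  define C6 where "C6 = C4 + C4 * C\<^sup>2 + 128 * C + 128 * C ^ 3"
  have C6: "0 \<le> C6" unfolding C6_def using C(1) C4(1) by simp
  have "hdist h x y \<le> (C6 * C ^ 3) * hdist h x z"
    if n: "x \<in> V n0" "y \<in> V n0" "z \<in> V n0" and xz: "x \<noteq> z" "D x y \<le> 3 * D x z" for n0 x y z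
  proof -
    note T = gseq_tset[OF G]
    have S: "x \<in> S" "y \<in> S" "z \<in> S" using n gseq_S[OF G] by auto
    \<comment> \<open>Each point moves by at most \<open>4 * r\<close>, so distances change by at
      most \<open>8 * r\<close>: 40 becomes at least 32, and 120 at most 128.\<close>
    define r where "r = D x z / 40"
    have r: "0 < r" unfolding r_def using D_pos[OF S(1,3) xz(1)] by simp
    define i where "i = (LEAST i. msh (V i) \<le> r)"
    obtain i0 where "msh (V i0) < r" using msh_small[OF G r] by blast
    then have ex: "msh (V i0) \<le> r" by simp
    have i: "msh (V i) \<le> r" unfolding i_def by (rule LeastI[of _ i0]) (rule ex)
    have il: "\<forall>l<i. r \<le> msh (V l)" unfolding i_def using not_less_Least by fastforce
    define n where "n = max n0 i"
    have nn: "i \<le> n" "V n0 \<subseteq> V n" unfolding n_def using gseq_mono[OF G] by auto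
    have xV: "x \<in> V n" "y \<in> V n" "z \<in> V n" using n nn by auto
    let ?x = "ap (V i) x" and ?y = "ap (V i) y" and ?z = "ap (V i) z"
    note X = ap_props[OF gseq_tset[OF G, of i] S(1)] and Y = ap_props[OF gseq_tset[OF G, of i] S(2)] and Z = ap_props[OF gseq_tset[OF G, of i] S(3)]
    have S': "?x \<in> S" "?y \<in> S" "?z \<in> S" using le_S1[OF X(2)] le_S1[OF Y(2)] le_S1[OF Z(2)] by auto
    have d: "D ?x x \<le> 4 * r" "D ?y y \<le> 4 * r" "D ?z z \<le> 4 * r"
      using ap_dist[OF T S(1), of i] ap_dist[OF T S(2), of i] ap_dist[OF T S(3), of i] i by linarith+
    have dxz: "D x z = 40 * r" "D x y \<le> 120 * r" using r_def xz by auto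
    have xy': "D ?x ?y \<le> 128 * r"
      using D_tri[OF S'(1) S(1) S'(2)] D_tri[OF S(1,2) S'(2)] d dxz D_sym[of ?y y] by linarith
    have xz': "32 * r \<le> D ?x ?z" "D ?x ?z \<le> 128 * r"
      using D_tri[OF S(1) S'(1) S(3)] D_tri[OF S'(1,3) S(3)] D_tri[OF S'(1) S(1) S'(3)] D_tri[OF S(1,3) S'(3)]
        d dxz D_sym[of ?x x] D_sym[of ?z z] r by linarith+
    have kpos: "0 < \<kappa> ?x" "0 < \<kappa> ?y" "0 < \<kappa> ?z" using hinv_vertex(1)[OF H] X(1) Y(1) Z(1) by auto
    have cmp: "\<kappa> a \<le> C\<^sup>2 * \<kappa> b" if ab: "a \<in> V i" "b \<in> V i" "D a b \<le> 128 * r" for a b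
    proof -
      have aS: "a \<in> S" "b \<in> S" using ab gseq_S[OF G] by auto
      have mV: "mt a b \<in> V i" using tsetD(4)[OF T ab(1,2)] .
      have "D (mt a b) a \<le> 128 * r" "D (mt a b) b \<le> 128 * r"
        using D_mt[OF aS] D_mt[OF aS(2,1)] mt_commute[OF aS] D_sym[of a b] ab(3) by auto
      then have "\<kappa> a \<le> C * \<kappa> (mt a b)" "\<kappa> (mt a b) \<le> C * \<kappa> b"
        using C(2)[OF r il mV ab(1) mt1[OF aS]] C(2)[OF r il mV ab(2) mt2[OF aS]] by auto
      then have "\<kappa> a \<le> C * (C * \<kappa> b)" using C(1)
        by (meson mult_left_mono order_trans zero_le_one)
      then show ?thesis by (simp add: power2_eq_square mult.assoc)
    qed
    have up: "h w - h (ap (V i) w) \<le> C4 * (\<kappa> (ap (V i) w) * r)" if "w \<in> V n" for w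
    proof -
      have "0 < \<kappa> (ap (V i) w)" using hinv_vertex(1)[OF H ap_props(1)[OF T gseq_S[OF G that]]] .
      then have "C4 * (\<kappa> (ap (V i) w) * msh (V i)) \<le> C4 * (\<kappa> (ap (V i) w) * r)"
        using i C4(1) by (intro mult_left_mono) auto
      then show ?thesis using C4(2)[OF nn(1) that] by linarith
    qed
    have kyr: "\<kappa> ?y * r \<le> C\<^sup>2 * (\<kappa> ?x * r)"
    proof -
      have "\<kappa> ?y \<le> C\<^sup>2 * \<kappa> ?x" using cmp[OF Y(1) X(1)] xy' D_sym[of ?x ?y] by simp
      then have "\<kappa> ?y * r \<le> (C\<^sup>2 * \<kappa> ?x) * r" using r by (intro mult_right_mono) auto
      then show ?thesis by (simp add: mult.assoc)
    qed
    have upper_bd: "hdist h x y \<le> C6 * (\<kappa> ?x * r)"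
    proof -
      let ?m = "mt ?x ?y"
      have mV: "?m \<in> V i" using tsetD(4)[OF T X(1) Y(1)] .
      have "?m \<sqsubseteq> mt x y"
        using mt_greatest[OF le_trans[OF mt1[OF S'(1,2)] X(2)] le_trans[OF mt2[OF S'(1,2)] Y(2)]] .
      moreover have "mt x y \<in> V n" using tsetD(4)[OF T xV(1,2)] .
      moreover have "?m \<in> V n" using mV gseq_mono[OF G nn(1)] by blast
      ultimately have "h ?m \<le> h (mt x y)" using h_mono[OF T H] by blast
      then have 1: "hdist h x y \<le> (h x - h ?x) + (h y - h ?y) + (h ?x - h ?m) + (h ?y - h ?m)"
        unfolding hdist_def by linarith
      have Dm: "D ?m ?x \<le> 128 * r" "D ?m ?y \<le> 128 * r"
        using D_mt[OF S'(1,2)] D_mt[OF S'(2,1)] mt_commute[OF S'(1,2)] D_sym[of ?x ?y] xy' by auto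
      have "h ?x - h ?m \<le> C * (\<kappa> ?x * D ?m ?x)" "h ?y - h ?m \<le> C * (\<kappa> ?y * D ?m ?y)"
        using C(2)[OF r il mV X(1) mt1[OF S'(1,2)] Dm(1)] C(2)[OF r il mV Y(1) mt2[OF S'(1,2)] Dm(2)] by auto
      moreover have "C * (\<kappa> ?x * D ?m ?x) \<le> C * (\<kappa> ?x * (128 * r))" "C * (\<kappa> ?y * D ?m ?y) \<le> C * (\<kappa> ?y * (128 * r))"
        using Dm kpos C(1) by (auto intro!: mult_left_mono)
      ultimately have 2: "h ?x - h ?m \<le> 128 * C * (\<kappa> ?x * r)" "h ?y - h ?m \<le> 128 * C * (\<kappa> ?y * r)"
        by (simp_all add: algebra_simps)
      have "128 * C * (\<kappa> ?y * r) \<le> 128 * C * (C\<^sup>2 * (\<kappa> ?x * r))" "C4 * (\<kappa> ?y * r) \<le> C4 * (C\<^sup>2 * (\<kappa> ?x * r))"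
        using kyr C(1) C4(1) by (auto intro!: mult_left_mono)
      then have "hdist h x y \<le> C4 * (\<kappa> ?x * r) + C4 * (C\<^sup>2 * (\<kappa> ?x * r)) + 128 * C * (\<kappa> ?x * r) + 128 * C * (C\<^sup>2 * (\<kappa> ?x * r))"
        using 1 2 up[OF xV(1)] up[OF xV(2)] by linarith
      also have "\<dots> = C6 * (\<kappa> ?x * r)" unfolding C6_def by (simp add: algebra_simps power3_eq_cube power2_eq_square)
      finally show ?thesis .
    qed
    have "\<exists>u w. u \<in> V i \<and> w \<in> V i \<and> u \<sqsubseteq> w \<and> 8 * r \<le> D u w \<and> D u w \<le> 128 * r \<and> h w - h u \<le> hdist h x z \<and>
        \<kappa> ?x \<le> C\<^sup>2 * \<kappa> w"
    proof -
      have kw: "\<kappa> ?x \<le> C\<^sup>2 * \<kappa> ?z" using cmp[OF X(1) Z(1) xz'(2)] .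
      have kx: "\<kappa> ?x \<le> C\<^sup>2 * \<kappa> ?x" using cmp[OF X(1) X(1)] r D_zero[OF S'(1,1)] by simp
      consider "?x \<sqsubseteq> z" | "?z \<sqsubseteq> x" | "\<not> ?x \<sqsubseteq> z" "\<not> ?z \<sqsubseteq> x" by blast
      then show ?thesis
      proof cases
        case 1
        then show ?thesis using lower_aux[OF nn(1) xV(1,3) i r xz' 1] Z(1) kw by blast
      next
        case 2
        have "\<exists>u\<in>V i. u \<sqsubseteq> ?x \<and> 8 * r \<le> D u ?x \<and> D u ?x \<le> 128 * r \<and> h ?x - h u \<le> hdist h z x"
          using lower_aux[OF nn(1) xV(3,1) i r _ _ 2] xz' D_sym[of ?x ?z] by simp
        then show ?thesis using X(1) kx hdist_sym[OF S(1,3)] by auto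
      next
        case 3
        \<comment> \<open>Both last vertices lie above the branch point \<open>m\<close>, which is
          therefore their meet and itself a vertex of \<open>V i\<close>; one of the two branches is
          long.\<close>
        define m where "m = mt x z"
        have m: "m \<sqsubseteq> x" "m \<sqsubseteq> z" "m \<in> V n" unfolding m_def using mt1[OF S(1,3)] mt2[OF S(1,3)] tsetD(4)[OF T xV(1,3)] by auto
        have "\<not> ?x \<sqsubseteq> m" "\<not> ?z \<sqsubseteq> m" using 3 le_trans m by blast+
        then have mx: "m \<sqsubseteq> ?x" "m \<sqsubseteq> ?z" using chain[OF m(1) X(2)] chain[OF m(2) Z(2)] by auto
        have "mt ?x ?z \<sqsubseteq> m" unfolding m_def
          using mt_greatest[OF le_trans[OF mt1[OF S'(1,3)] X(2)] le_trans[OF mt2[OF S'(1,3)] Z(2)]] .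
        then have meq: "m = mt ?x ?z" using mt_greatest[OF mx] le_antisym by blast
        then have mV: "m \<in> V i" using tsetD(4)[OF T X(1) Z(1)] by simp
        have mS: "m \<in> S" using le_S1[OF m(1)] .
        have hm: "h m \<le> h x" "h m \<le> h z" "h ?x \<le> h x" "h ?z \<le> h z"
          using h_mono[OF T H m(3)] xV m(1,2) C4(2)[OF nn(1)] by auto
        have bd: "D m ?x \<le> 128 * r" "D m ?z \<le> 128 * r"
          using D_mt[OF S'(1,3)] D_mt[OF S'(3,1)] mt_commute[OF S'(1,3)] D_sym[of ?x ?z] xz' meq by auto
        consider "8 * r \<le> D m ?x" | "8 * r \<le> D m ?z"
          using D_tri[OF S'(1) mS S'(3)] D_sym[of ?x m] xz' r by linarith
        then show ?thesis
        proof cases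
          case 1
          moreover have "h ?x - h m \<le> hdist h x z" unfolding hdist_def m_def[symmetric] using hm by linarith
          ultimately show ?thesis using mV X(1) mx kx bd by blast
        next
          case 2
          moreover have "h ?z - h m \<le> hdist h x z" unfolding hdist_def m_def[symmetric] using hm by linarith
          ultimately show ?thesis using mV Z(1) mx kw bd by blast
        qed
      qed
    qed
    then obtain u w where uw: "u \<in> V i" "w \<in> V i" "u \<sqsubseteq> w" "8 * r \<le> D u w" "D u w \<le> 128 * r"
      "h w - h u \<le> hdist h x z" "\<kappa> ?x \<le> C\<^sup>2 * \<kappa> w" by blast
    have kw: "0 < \<kappa> w" using hinv_vertex(1)[OF H uw(2)] .
    have "\<kappa> ?x * r \<le> (C\<^sup>2 * \<kappa> w) * D u w" using uw(4,7) kw r C(1) by (intro mult_mono) auto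
    also have "\<dots> = C\<^sup>2 * (\<kappa> w * D u w)" by simp
    also have "\<dots> \<le> C\<^sup>2 * (C * (h w - h u))" using C(2)[OF r il uw(1-3,5)] by (intro mult_left_mono) auto
    also have "\<dots> = C ^ 3 * (h w - h u)" by (simp add: power3_eq_cube power2_eq_square)
    also have "\<dots> \<le> C ^ 3 * hdist h x z" using uw(6) C(1) by (intro mult_left_mono) auto
    finally have "C6 * (\<kappa> ?x * r) \<le> C6 * (C ^ 3 * hdist h x z)" using C6 by (intro mult_left_mono) auto
    then show ?thesis using upper_bd by simp
  qed
  then show ?thesis by blast
qed

end

section \<open>Passage to the limit of the heights\<close>

theorem geodesic_metric_ex:
  "\<exists>\<rho> \<Theta>::real. (\<forall>x\<in>S. \<forall>y\<in>S. 0 \<le> \<rho> x y \<and> (\<rho> x y = 0 \<longleftrightarrow> x = y) \<and> \<rho> x y = \<rho> y x) \<and>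
    (\<forall>x\<in>S. \<forall>y\<in>S. \<forall>z\<in>S. \<rho> x z \<le> \<rho> x y + \<rho> y z) \<and>
    (\<forall>x\<in>S. \<forall>y\<in>S. \<forall>z. mt x y \<sqsubseteq> z \<longrightarrow> z \<sqsubseteq> x \<or> z \<sqsubseteq> y \<longrightarrow> \<rho> x y = \<rho> x z + \<rho> z y) \<and>
    (\<forall>x\<in>S. \<forall>y\<in>S. \<forall>z\<in>S. x \<noteq> z \<longrightarrow> D x y \<le> 2 * D x z \<longrightarrow> \<rho> x y \<le> \<Theta> * \<rho> x z)"
proof -
  obtain V c h \<kappa> k B tp \<epsilon> where G: "gseq V c" and \<epsilon>: "0 < \<epsilon>" "\<epsilon> \<le> 1"
    and H: "\<And>n. hinv \<epsilon> (msh (V n)) (V n) h \<kappa> k B tp"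
    and A: "\<And>n x. x \<in> V (Suc n) \<Longrightarrow> x \<noteq> rt \<Longrightarrow> tp x \<in> V n \<or> D (B x) (tp x) = msh (V n) \<and> B x \<in> V (Suc n)"
    using heights_ex by blast
  note T = gseq_tset[OF G]
  obtain \<Theta> where \<Theta>: "\<And>n x y z. x \<in> V n \<Longrightarrow> y \<in> V n \<Longrightarrow> z \<in> V n \<Longrightarrow> x \<noteq> z \<Longrightarrow> D x y \<le> 3 * D x z \<Longrightarrow>
      hdist h x y \<le> \<Theta> * hdist h x z"
    using weak_quasisymmetry[OF G \<epsilon> H A] by blast
  obtain C :: real where C: "\<And>n i x. i \<le> n \<Longrightarrow> x \<in> V n \<Longrightarrow>
     h (ap (V i) x) \<le> h x \<and> h x - h (ap (V i) x) \<le> C * (\<kappa> (ap (V i) x) * msh (V i))"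
    using upper[OF G \<epsilon> H A] by blast
  define a where "a n x = ap (V n) x" for n x
  have a: "a n x \<in> V n" "a n x \<sqsubseteq> x" "\<And>w. w \<in> V n \<Longrightarrow> w \<sqsubseteq> x \<Longrightarrow> w \<sqsubseteq> a n x" "D (a n x) x \<le> 4 * msh (V n)"
    if "x \<in> S" for n x
    unfolding a_def using ap_props[OF T that] ap_dist[OF T that] by blast+
  have amono: "a m x \<sqsubseteq> a n x" if "m \<le> n" "x \<in> S" for m n x
    using a(3)[OF that(2)] a(1,2)[OF that(2), of m] gseq_mono[OF G that(1)] by blast
  \<comment> \<open>An upper bound for all heights, from \<open>upper\<close> at stage 0 and the
    finiteness of \<open>V 0\<close>; it makes the increasing sequences below converge.\<close>
  define M where "M = Max ((\<lambda>v. h v + C * (\<kappa> v * msh (V 0))) ` V 0)"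
  have hM: "h w \<le> M" if "w \<in> V n" for w n
  proof -
    let ?v = "ap (V 0) w"
    have "?v \<in> V 0" using ap_props(1)[OF T gseq_S[OF G that]] .
    then have "h ?v + C * (\<kappa> ?v * msh (V 0)) \<le> M" unfolding M_def
      by (intro Max_ge) (auto simp: tsetD(1)[OF T])
    then show ?thesis using C[of 0 n w] that by auto
  qed
  have "\<exists>L. (\<lambda>n. h (a n x)) \<longlonglongrightarrow> L \<and> (\<forall>n. h (a n x) \<le> L)" if "x \<in> S" for x
  proof -
    have "incseq (\<lambda>n. h (a n x))"
    proof (rule incseq_SucI)
      fix n
      have "a n x \<in> V (Suc n)" using a(1)[OF that, of n] gseq_step(1)[OF G] by blast
      then show "h (a n x) \<le> h (a (Suc n) x)"
        using h_mono[OF T H _ a(1)[OF that] amono[OF _ that]] by simp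
    qed
    then show ?thesis using hM[OF a(1)[OF that]] by (elim incseq_convergent) auto
  qed
  then obtain g where g: "\<And>x. x \<in> S \<Longrightarrow> (\<lambda>n. h (a n x)) \<longlonglongrightarrow> g x" "\<And>x n. x \<in> S \<Longrightarrow> h (a n x) \<le> g x"
    by metis
  have gle: "g x \<le> h w" if "w \<in> V n" "x \<sqsubseteq> w" for x w n
  proof (rule LIMSEQ_le_const2[OF g(1)[OF le_S1[OF that(2)]]])
    have "h (a m x) \<le> h w" for m
    proof -
      have "a m x \<in> V (max m n)" "w \<in> V (max m n)"
        using a(1)[OF le_S1[OF that(2)], of m] that(1) gseq_mono[OF G, of m "max m n"] gseq_mono[OF G, of n "max m n"]
        by auto
      then show ?thesis using h_mono[OF T H] le_trans[OF a(2)[OF le_S1[OF that(2)]] that(2)] by blast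
    qed
    then show "\<exists>N. \<forall>n\<ge>N. h (a n x) \<le> h w" by blast
  qed
  have F3: "\<exists>n. x \<sqsubset> a n y" if lt: "x \<sqsubset> y" for x y
  proof -
    note xy = lt_le[OF lt]
    obtain n where n: "msh (V n) < D x y / 4" using msh_small[OF G, of "D x y / 4"] lt_D_pos[OF lt] by auto
    have "\<not> a n y \<sqsubseteq> x"
    proof
      assume "a n y \<sqsubseteq> x"
      then have "D x y \<le> D (a n y) y" using mono[OF _ xy le_refl[OF le_S2[OF xy]]] by blast
      then show False using a(4)[OF le_S2[OF xy], of n] n by linarith
    qed
    then have "x \<sqsubset> a n y" using chain_cases[OF a(2)[OF le_S2[OF xy]] xy] by blast
    then show ?thesis by blast
  qed
  \<comment> \<open>Strict inequalities need not survive a limit, so two vertices are squeezed in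
    between: \<open>g x \<le> h (a n z) < h (a m y) \<le> g y\<close>.\<close>
  have g_strict: "g x < g y" if "x \<sqsubset> y" for x y
  proof -
    note xy = lt_le[OF that]
    have p: "0 < D x y" using lt_D_pos[OF that] .
    obtain z where z: "x \<sqsubseteq> z" "z \<sqsubseteq> y" "D x z = D x y / 2" using ivt_up[OF xy, of "D x y / 2"] p by auto
    have "x \<noteq> z" "z \<noteq> y" using z(3) p D_zero[of x x] le_S1[OF xy] by auto
    then have lt: "x \<sqsubset> z" "z \<sqsubset> y" using z unfolding lt_def by auto
    obtain n m where nm: "x \<sqsubset> a n z" "z \<sqsubset> a m y" using F3[OF lt(1)] F3[OF lt(2)] by blast
    have S: "z \<in> S" "y \<in> S" using le_S1 le_S2 z by auto
    have i: "a n z \<in> V (max n m)" "a m y \<in> V (max n m)"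
      using a(1)[OF S(1), of n] a(1)[OF S(2), of m] gseq_mono[OF G, of m "max n m"] gseq_mono[OF G, of n "max n m"] by auto
    have "h (a n z) < h (a m y)" using h_strict[OF T H i le_lt_trans[OF a(2)[OF S(1)] nm(2)]] .
    moreover have "g x \<le> h (a n z)" using gle[OF i(1) lt_le[OF nm(1)]] .
    moreover have "h (a m y) \<le> g y" using g(2)[OF S(2)] .
    ultimately show ?thesis by linarith
  qed
  have g_mono: "g x \<le> g y" if "x \<sqsubseteq> y" for x y
    using g_strict[of x y] that unfolding lt_def by fastforce
  define \<rho> where "\<rho> x y = g x + g y - 2 * g (mt x y)" for x y
  have sym: "\<rho> x y = \<rho> y x" if "x \<in> S" "y \<in> S" for x y unfolding \<rho>_def using mt_commute[OF that] by simp
  have nonneg: "0 \<le> \<rho> x y" if "x \<in> S" "y \<in> S" for x y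
    unfolding \<rho>_def using g_mono[OF mt1[OF that]] g_mono[OF mt2[OF that]] by linarith
  have zero: "\<rho> x y = 0 \<longleftrightarrow> x = y" if "x \<in> S" "y \<in> S" for x y
  proof
    assume "\<rho> x y = 0"
    then have "g (mt x y) = g x" "g (mt x y) = g y"
      unfolding \<rho>_def using g_mono[OF mt1[OF that]] g_mono[OF mt2[OF that]] by linarith+
    then have "mt x y = x" "mt x y = y"
      using g_strict[of "mt x y" x] g_strict[of "mt x y" y] mt1[OF that] mt2[OF that] unfolding lt_def by fastforce+
    then show "x = y" by simp
  next
    assume "x = y"
    then show "\<rho> x y = 0" unfolding \<rho>_def using mt_eq_le[OF le_refl[OF that(1)]] by simp
  qed
  have tri: "\<rho> x z \<le> \<rho> x y + \<rho> y z" if S: "x \<in> S" "y \<in> S" "z \<in> S" for x y z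
  proof -
    \<comment> \<open>Both meets lie below \<open>y\<close> and are therefore comparable; the lower
      one is also below \<open>mt x z\<close>.\<close>
    have 1: "g (mt x y) + g (mt y z) \<le> g y + g (mt x z)"
    proof (cases "mt x y \<sqsubseteq> mt y z")
      case True
      then have "mt x y \<sqsubseteq> mt x z" using mt_greatest[OF mt1[OF S(1,2)] le_trans[OF True mt2[OF S(2,3)]]] by blast
      then show ?thesis using g_mono[of "mt x y" "mt x z"] g_mono[OF mt1[OF S(2,3)]] by linarith
    next
      case False
      then have "mt y z \<sqsubseteq> mt x y" using chain[OF mt2[OF S(1,2)] mt1[OF S(2,3)]] by blast
      then have "mt y z \<sqsubseteq> mt x z" using mt_greatest[OF le_trans[OF _ mt1[OF S(1,2)]] mt2[OF S(2,3)]] by blast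
      then show ?thesis using g_mono[of "mt y z" "mt x z"] g_mono[OF mt2[OF S(1,2)]] by linarith
    qed
    then show ?thesis unfolding \<rho>_def by simp
  qed
  have add1: "\<rho> x y = \<rho> x z + \<rho> z y" if S: "x \<in> S" "y \<in> S" and z: "mt x y \<sqsubseteq> z" "z \<sqsubseteq> x" for x y z
  proof -
    have zS: "z \<in> S" using le_S2[OF z(1)] .
    have "mt x z = z" using mt_eq_le[OF z(2)] mt_commute[OF S(1) zS] by simp
    moreover have "mt z y = mt x y"
      using le_antisym[OF mt_greatest[OF le_trans[OF mt1[OF zS S(2)] z(2)] mt2[OF zS S(2)]] mt_greatest[OF z(1) mt2[OF S]]] .
    ultimately show ?thesis unfolding \<rho>_def by simp
  qed
  have add: "\<rho> x y = \<rho> x z + \<rho> z y" if S: "x \<in> S" "y \<in> S" and z: "mt x y \<sqsubseteq> z" "z \<sqsubseteq> x \<or> z \<sqsubseteq> y" for x y z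
  proof (cases "z \<sqsubseteq> x")
    case True
    then show ?thesis using add1 S z by blast
  next
    case False
    then have zy: "z \<sqsubseteq> y" using z by blast
    have zS: "z \<in> S" using le_S2[OF z(1)] .
    have "\<rho> y x = \<rho> y z + \<rho> z x" using add1[OF S(2,1) _ zy] z(1) mt_commute[OF S] by simp
    then show ?thesis using sym S zS by simp
  qed
  have m0: "(\<lambda>n. msh (V n)) \<longlonglongrightarrow> 0"
  proof (rule LIMSEQ_I)
    fix r :: real assume "0 < r"
    then obtain i where i: "msh (V i) < r" using msh_small[OF G] by blast
    have "norm (msh (V n) - 0) < r" if "i \<le> n" for n
      using msh_mono[OF G that] gseq_step(5)[OF G, of n] i by simp
    then show "\<exists>no. \<forall>n\<ge>no. norm (msh (V n) - 0) < r" by blast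
  qed
  have amt: "mt (a n x) (a n y) = a n (mt x y)" if S: "x \<in> S" "y \<in> S" for n x y
  proof (rule le_antisym)
    have aS: "a n x \<in> S" "a n y \<in> S" using le_S1 a(2) S by auto
    have "mt (a n x) (a n y) \<sqsubseteq> mt x y"
      using mt_greatest[OF le_trans[OF mt1[OF aS] a(2)[OF S(1)]] le_trans[OF mt2[OF aS] a(2)[OF S(2)]]] .
    moreover have "mt (a n x) (a n y) \<in> V n" using tsetD(4)[OF T a(1)[OF S(1)] a(1)[OF S(2)]] .
    ultimately show "mt (a n x) (a n y) \<sqsubseteq> a n (mt x y)" using a(3)[OF mt_S[OF S]] by blast
    show "a n (mt x y) \<sqsubseteq> mt (a n x) (a n y)"
      using mt_greatest[OF a(3)[OF S(1) a(1)[OF mt_S[OF S]] le_trans[OF a(2)[OF mt_S[OF S]] mt1[OF S]]]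
          a(3)[OF S(2) a(1)[OF mt_S[OF S]] le_trans[OF a(2)[OF mt_S[OF S]] mt2[OF S]]]] .
  qed
  have lim: "(\<lambda>n. hdist h (a n x) (a n y)) \<longlonglongrightarrow> \<rho> x y" if S: "x \<in> S" "y \<in> S" for x y
    unfolding hdist_def \<rho>_def amt[OF S]
    by (intro tendsto_diff tendsto_add tendsto_mult tendsto_const g(1) S mt_S[OF S])
  have Dlim: "\<bar>D (a n x) (a n y) - D x y\<bar> \<le> 8 * msh (V n)" if S: "x \<in> S" "y \<in> S" for x y n
  proof -
    have aS: "a n x \<in> S" "a n y \<in> S" using le_S1 a(2) S by auto
    show ?thesis
      using D_tri[OF aS(1) S(1) aS(2)] D_tri[OF S(1,2) aS(2)] D_tri[OF S(1) aS(1) S(2)] D_tri[OF aS S(2)]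
        a(4)[OF S(1), of n] a(4)[OF S(2), of n] D_sym[of "a n x" x] D_sym[of "a n y" y] by linarith
  qed
  have wq: "\<rho> x y \<le> \<Theta> * \<rho> x z" if S: "x \<in> S" "y \<in> S" "z \<in> S" and xz: "x \<noteq> z" "D x y \<le> 2 * D x z" for x y z
  proof (rule tendsto_le[OF sequentially_bot])
    show "(\<lambda>n. \<Theta> * hdist h (a n x) (a n z)) \<longlonglongrightarrow> \<Theta> * \<rho> x z"
      by (intro tendsto_mult tendsto_const lim S)
    show "(\<lambda>n. hdist h (a n x) (a n y)) \<longlonglongrightarrow> \<rho> x y" by (intro lim S)
    \<comment> \<open>Then both distances are off by less than \<open>D x z / 4\<close>, and 2 + 1/4
      = 3 * (1 - 1/4) turns the factor 2 into 3.\<close>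
    have p: "0 < D x z / 32" using D_pos[OF S(1,3) xz(1)] by simp
    have "eventually (\<lambda>n. msh (V n) < D x z / 32) sequentially"
      using order_tendstoD(2)[OF m0 p] .
    then show "eventually (\<lambda>n. hdist h (a n x) (a n y) \<le> \<Theta> * hdist h (a n x) (a n z)) sequentially"
    proof (rule eventually_mono)
      fix n assume n: "msh (V n) < D x z / 32"
      have aS: "a n x \<in> S" "a n z \<in> S" using le_S1 a(2) S by auto
      have "D (a n x) (a n y) \<le> 3 * D (a n x) (a n z)" "0 < D (a n x) (a n z)"
        using Dlim[OF S(1,2), of n] Dlim[OF S(1,3), of n] n xz(2) p by linarith+
      moreover have "a n x \<noteq> a n z" using calculation(2) D_zero[OF aS(1,1)] by auto
      ultimately show "hdist h (a n x) (a n y) \<le> \<Theta> * hdist h (a n x) (a n z)"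
        using \<Theta>[OF a(1)[OF S(1)] a(1)[OF S(2)] a(1)[OF S(3)]] by blast
    qed
  qed
  show ?thesis
    by (intro exI[of _ \<rho>] exI[of _ \<Theta>] conjI ballI allI impI; rule nonneg zero sym tri add wq; assumption)
qed

end

section \<open>Chains and paths\<close>

text \<open>Links consecutive refinements: the cell of \<open>t\<close> at level
  \<open>Suc k\<close> is contained in the cell with index divided by \<open>N\<close> at level
  \<open>k\<close>.\<close>

lemma nat_floor_div:
  assumes "0 < N" "0 \<le> t"
  shows "nat \<lfloor>t * real N ^ Suc k\<rfloor> div N = nat \<lfloor>t * real N ^ k\<rfloor>"
proof -
  have "t * real N ^ k = t * real N ^ Suc k / real_of_int (int N)" using assms by simp
  then have "\<lfloor>t * real N ^ k\<rfloor> = \<lfloor>t * real N ^ Suc k\<rfloor> div int N"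
    using floor_divide_real_eq_div[of "int N" "t * real N ^ Suc k"] by simp
  moreover have "0 \<le> \<lfloor>t * real N ^ Suc k\<rfloor>" using assms by simp
  ultimately show ?thesis by (simp add: nat_div_distrib)
qed

text \<open>
  The path is the limit of iterated chain refinements, the \<open>k\<close>-th one being indexed by \<open>N ^ k\<close> equidistant
  parameters.
\<close>

lemma path_from_chains:
  fixes Y :: "'b::complete_space set"
  assumes Y: "closed Y" and N: "0 < N" and K: "0 \<le> K"
    and ch: "\<And>a b. a \<in> Y \<Longrightarrow> b \<in> Y \<Longrightarrow> \<exists>c. c 0 = a \<and> c N = b \<and> (\<forall>j. c j \<in> Y) \<and>
       (\<forall>j<N. dist (c j) (c (Suc j)) \<le> dist a b / 2) \<and> (\<forall>j\<le>N. dist a (c j) \<le> K * dist a b)"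
    and xy: "x \<in> Y" "y \<in> Y"
  shows "\<exists>p. path p \<and> path_image p \<subseteq> Y \<and> pathstart p = x \<and> pathfinish p = y \<and>
    path_image p \<subseteq> cball x ((2 * K + 1) * dist x y)"
proof -
  obtain cc where cc: "\<And>a b. a \<in> Y \<Longrightarrow> b \<in> Y \<Longrightarrow> cc a b 0 = a \<and> cc a b N = b \<and> (\<forall>j. cc a b j \<in> Y) \<and>
       (\<forall>j<N. dist (cc a b j) (cc a b (Suc j)) \<le> dist a b / 2) \<and> (\<forall>j\<le>N. dist a (cc a b j) \<le> K * dist a b)"
    using ch by metis
  define d where "d = dist x y"
  \<comment> \<open>\<open>P k n\<close> is the \<open>n\<close>-th point of the \<open>k\<close>-th
    chain; from index \<open>N ^ k\<close> on it stays at \<open>y\<close>, so the recursion makes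
    sense for all indices.\<close>
  define P where "P = rec_nat (\<lambda>n::nat. if n = 0 then x else y)
     (\<lambda>k Q n. cc (Q (n div N)) (Q (Suc (n div N))) (n mod N))"
  have P0: "P 0 n = (if n = 0 then x else y)" for n by (simp add: P_def)
  have PS: "P (Suc k) n = cc (P k (n div N)) (P k (Suc (n div N))) (n mod N)" for k n by (simp add: P_def)
  have PY: "P k n \<in> Y" for k n
    by (induction k arbitrary: n) (use xy cc in \<open>auto simp: P0 PS\<close>)
  have step: "dist (P k n) (P k (Suc n)) \<le> d / 2 ^ k" for k n
  proof (induction k arbitrary: n)
    case 0
    then show ?case by (simp add: P0 d_def)
  next
    case (Suc k)
    let ?q = "n div N"
    have IH: "dist (P k ?q) (P k (Suc ?q)) / 2 \<le> d / 2 ^ Suc k" using Suc[of ?q] by simp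
    have lt: "n mod N < N" using N by simp
    have "P (Suc k) (Suc n) = cc (P k ?q) (P k (Suc ?q)) (Suc (n mod N))"
    proof (cases "Suc (n mod N) = N")
      case True
      then have "Suc n div N = Suc ?q" "Suc n mod N = 0" by (auto simp: div_Suc mod_Suc)
      then show ?thesis using True cc[OF PY PY] by (simp add: PS)
    next
      case False
      then have "Suc n div N = ?q" "Suc n mod N = Suc (n mod N)" by (auto simp: div_Suc mod_Suc)
      then show ?thesis by (simp add: PS)
    qed
    then show ?case using cc[OF PY PY, of k ?q k "Suc ?q"] lt IH by (force simp: PS)
  qed
  have near: "dist (P k (n div N)) (P (Suc k) n) \<le> K * (d / 2 ^ k)" for k n
  proof -
    have "dist (P k (n div N)) (P (Suc k) n) \<le> K * dist (P k (n div N)) (P k (Suc (n div N)))"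
      unfolding PS using cc[OF PY PY] N by (meson less_imp_le mod_less_divisor)
    also have "\<dots> \<le> K * (d / 2 ^ k)" using step K by (intro mult_left_mono)
    finally show ?thesis .
  qed
  have Pl: "P k 0 = x" for k by (induction k) (use cc[OF PY PY] in \<open>auto simp: P0 PS\<close>)
  have Pr: "P k (N ^ k) = y" for k
  proof (induction k)
    case (Suc k)
    have "N ^ Suc k div N = N ^ k" "N ^ Suc k mod N = 0" using N by auto
    then have "P (Suc k) (N ^ Suc k) = cc y (P k (Suc (N ^ k))) 0" unfolding PS using Suc by simp
    then show ?case using cc[OF xy(2) PY] by metis
  qed (simp add: P0)
  define f where "f k t = P k (nat \<lfloor>t * real N ^ k\<rfloor>)" for k and t :: real
  have fs: "dist (f k t) (f (Suc k) t) \<le> K * (d / 2 ^ k)" if "0 \<le> t" for k t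
    using near[of k "nat \<lfloor>t * real N ^ Suc k\<rfloor>"] nat_floor_div[OF N that, of k] unfolding f_def by simp
  have fm: "dist (f k t) (f (k + m) t) \<le> 2 * K * d / 2 ^ k - 2 * K * d / 2 ^ (k + m)" if "0 \<le> t" for k m t
  proof (induction m)
    case (Suc m)
    have "dist (f k t) (f (k + Suc m) t) \<le> dist (f k t) (f (k + m) t) + dist (f (k + m) t) (f (Suc (k + m)) t)"
      using dist_triangle by simp
    also have "\<dots> \<le> 2 * K * d / 2 ^ k - 2 * K * d / 2 ^ (k + m) + K * (d / 2 ^ (k + m))"
      using Suc fs[OF that, of "k + m"] by linarith
    also have "\<dots> = 2 * K * d / 2 ^ k - 2 * K * d / 2 ^ (k + Suc m)" by simp
    finally show ?case .
  qed simp
  have Kd: "0 \<le> K * d" using K unfolding d_def by simp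
  have fm': "dist (f k t) (f n t) \<le> 2 * K * d / 2 ^ k" if t: "0 \<le> t" and kn: "k \<le> n" for k n t
  proof -
    obtain m where nm: "n = k + m" using kn le_Suc_ex by blast
    have "0 \<le> 2 * K * d / 2 ^ (k + m)" using Kd by simp
    then show ?thesis unfolding nm using fm[OF t, of k m] by linarith
  qed
  have small: "\<exists>k. A / 2 ^ k < e" if "0 < e" for A e :: real
  proof -
    have "(\<lambda>k. A * (1/2) ^ k) \<longlonglongrightarrow> A * 0" by (intro tendsto_mult tendsto_const LIMSEQ_power_zero) auto
    then have "(\<lambda>k. A / 2 ^ k) \<longlonglongrightarrow> 0" by (simp add: power_divide)
    then have "eventually (\<lambda>k. A / 2 ^ k < e) sequentially" using order_tendstoD(2) that by blast
    then show ?thesis using eventually_happens'[OF sequentially_bot] by blast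
  qed
  have "\<exists>l. (\<lambda>k. f k t) \<longlonglongrightarrow> l" if t: "0 \<le> t" for t
  proof -
    have "Cauchy (\<lambda>k. f k t)"
    proof (rule metric_CauchyI)
      fix e :: real assume "0 < e"
      then obtain k where k: "(4 * K * d) / 2 ^ k < e" using small by blast
      have "dist (f m t) (f n t) < e" if "k \<le> m" "k \<le> n" for m n
      proof -
        have "dist (f m t) (f n t) \<le> dist (f k t) (f m t) + dist (f k t) (f n t)"
          using dist_triangle3 by blast
        also have "\<dots> \<le> 2 * K * d / 2 ^ k + 2 * K * d / 2 ^ k" using fm'[OF t] that by (intro add_mono) auto
        also have "\<dots> = (4 * K * d) / 2 ^ k" by simp
        finally show ?thesis using k by linarith
      qed
      then show "\<exists>M. \<forall>m\<ge>M. \<forall>n\<ge>M. dist (f m t) (f n t) < e" by blast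
    qed
    then show ?thesis using Cauchy_convergent convergent_def by blast
  qed
  then obtain F where F: "\<And>t. 0 \<le> t \<Longrightarrow> (\<lambda>k. f k t) \<longlonglongrightarrow> F t" by metis
  have fF: "dist (f k t) (F t) \<le> 2 * K * d / 2 ^ k" if "0 \<le> t" for k t
  proof (rule LIMSEQ_le_const2)
    show "(\<lambda>n. dist (f k t) (f n t)) \<longlonglongrightarrow> dist (f k t) (F t)" by (intro tendsto_dist tendsto_const F that)
    show "\<exists>M. \<forall>n\<ge>M. dist (f k t) (f n t) \<le> 2 * K * d / 2 ^ k" using fm'[OF that] by blast
  qed
  have FY: "F t \<in> Y" if "0 \<le> t" for t
    using closed_sequentially[OF Y _ F[OF that]] PY unfolding f_def by blast
  have fclose: "dist (f k s) (f k t) \<le> d / 2 ^ k" if st: "0 \<le> s" "s \<le> t" "t - s < 1 / real N ^ k" for s t k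
  proof -
    let ?a = "s * real N ^ k" and ?b = "t * real N ^ k"
    have p: "0 < real N ^ k" using N by simp
    have "?a \<le> ?b" using st p by simp
    have "(t - s) * real N ^ k < 1" using st(3) p by (simp add: field_simps)
    then have "?b < ?a + 1" by (simp add: algebra_simps)
    then have "\<lfloor>?b\<rfloor> \<le> \<lfloor>?a\<rfloor> + 1" "\<lfloor>?a\<rfloor> \<le> \<lfloor>?b\<rfloor>" using \<open>?a \<le> ?b\<close> by linarith+
    moreover have "0 \<le> \<lfloor>?a\<rfloor>" using st p by simp
    ultimately have "nat \<lfloor>?b\<rfloor> = nat \<lfloor>?a\<rfloor> \<or> nat \<lfloor>?b\<rfloor> = Suc (nat \<lfloor>?a\<rfloor>)" by linarith
    then show ?thesis unfolding f_def using step[of k "nat \<lfloor>?a\<rfloor>"] by (auto simp: d_def)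
  qed
  have Fclose: "dist (F s) (F t) \<le> (4 * K * d + d) / 2 ^ k" if st: "0 \<le> s" "s \<le> t" "t - s < 1 / real N ^ k" for s t k
  proof -
    have "dist (F s) (F t) \<le> dist (f k s) (F s) + dist (f k s) (f k t) + dist (f k t) (F t)"
      using dist_triangle[of "F s" "F t" "f k s"] dist_triangle[of "f k s" "F t" "f k t"]
        dist_commute[of "F s" "f k s"] by linarith
    also have "\<dots> \<le> 2 * K * d / 2 ^ k + d / 2 ^ k + 2 * K * d / 2 ^ k"
      using fF[of s k] fF[of t k] fclose[OF st] st by (intro add_mono) auto
    also have "\<dots> = (4 * K * d + d) / 2 ^ k" by (simp add: add_divide_distrib)
    finally show ?thesis .
  qed
  have cont: "continuous_on {0..1} F"
  proof (rule continuous_on_iff[THEN iffD2], intro ballI allI impI)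
    fix s e :: real assume s: "s \<in> {0..1}" and e: "0 < e"
    obtain k where k: "(4 * K * d + d) / 2 ^ k < e" using small[OF e] by blast
    have "dist (F t) (F s) < e" if t: "t \<in> {0..1}" "dist t s < 1 / real N ^ k" for t
    proof (cases "s \<le> t")
      case True
      then show ?thesis using Fclose[of s t k] s t k by (auto simp: dist_real_def dist_commute)
    next
      case False
      then show ?thesis using Fclose[of t s k] s t k by (auto simp: dist_real_def)
    qed
    then show "\<exists>\<delta>>0. \<forall>t\<in>{0..1}. dist t s < \<delta> \<longrightarrow> dist (F t) (F s) < e"
      using N by (intro exI[of _ "1 / real N ^ k"]) auto
  qed
  have F0: "F 0 = x" using LIMSEQ_unique[OF F[of 0], of x] Pl unfolding f_def by simp
  have "f k 1 = y" for k
  proof -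
    have "nat \<lfloor>real (N ^ k)\<rfloor> = N ^ k" by (simp only: floor_of_nat nat_int)
    then show ?thesis unfolding f_def using Pr[of k] by simp
  qed
  then have F1: "F 1 = y" using LIMSEQ_unique[OF F[of 1], of y] by simp
  have "dist x (F t) \<le> (2 * K + 1) * d" if t: "t \<in> {0..1}" for t
  proof -
    have "f 0 t = x \<or> f 0 t = y" unfolding f_def P0 by simp
    then have "dist x (f 0 t) \<le> d" unfolding d_def by auto
    moreover have "dist (f 0 t) (F t) \<le> 2 * K * d" using fF[of t 0] t by simp
    ultimately show ?thesis using dist_triangle[of x "F t" "f 0 t"] by (simp add: algebra_simps)
  qed
  then have "path_image F \<subseteq> cball x ((2 * K + 1) * dist x y)"
    unfolding path_image_def d_def by (intro image_subsetI) (simp only: mem_cball)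
  moreover have "path_image F \<subseteq> Y" unfolding path_image_def using FY by auto
  moreover have "path F" using cont unfolding path_def .
  moreover have "pathstart F = x" "pathfinish F = y" using F0 F1 unfolding pathstart_def pathfinish_def by auto
  ultimately show ?thesis by blast
qed

section \<open>Chains of small steps in connected sets\<close>

lemma connected_chain:
  fixes E :: "'b::metric_space set"
  assumes "connected E" "x \<in> E" "y \<in> E" "0 < e"
  shows "(x, y) \<in> {(a, b). a \<in> E \<and> b \<in> E \<and> dist a b \<le> e}\<^sup>*"
proof -
  let ?R = "{(a, b). a \<in> E \<and> b \<in> E \<and> dist a b \<le> e}"
  have s: "sym (?R\<^sup>*)" by (intro sym_rtrancl symI) (auto simp: dist_commute)
  have "(\<lambda>a b. (a, b) \<in> ?R\<^sup>*) x y"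
  proof (rule connected_equivalence_relation[OF assms(1-3)])
    show "\<And>a b. (a, b) \<in> ?R\<^sup>* \<Longrightarrow> (b, a) \<in> ?R\<^sup>*" by (rule symD[OF s])
    show "\<And>a b c. (a, b) \<in> ?R\<^sup>* \<Longrightarrow> (b, c) \<in> ?R\<^sup>* \<Longrightarrow> (a, c) \<in> ?R\<^sup>*" by (rule rtrancl_trans)
    fix a assume a: "a \<in> E"
    have "openin (top_of_set E) (E \<inter> ball a e)" by (simp add: openin_open_Int)
    moreover have "(a, b) \<in> ?R\<^sup>*" if "b \<in> E \<inter> ball a e" for b using that a by auto
    ultimately show "\<exists>T. openin (top_of_set E) T \<and> a \<in> T \<and> (\<forall>b\<in>T. (a, b) \<in> ?R\<^sup>*)"
      using a assms(4) by (intro exI[of _ "E \<inter> ball a e"]) auto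
  qed
  then show ?thesis .
qed

text \<open>In a shortest chain, points whose indices differ by at least 2 are more than
  \<open>e\<close> apart, so the points of even index are separated and at most \<open>M\<close> in
  number. The chain is padded to length \<open>2 * M\<close> by repeating its last point.\<close>

lemma bounded_chain:
  fixes E :: "'b::metric_space set"
  assumes E: "connected E" "x \<in> E" "y \<in> E" and e: "0 < e"
    and M: "\<And>F. finite F \<Longrightarrow> F \<subseteq> E \<Longrightarrow> (\<And>f g. f \<in> F \<Longrightarrow> g \<in> F \<Longrightarrow> f \<noteq> g \<Longrightarrow> e \<le> dist f g) \<Longrightarrow> card F \<le> M"
  shows "\<exists>c. c 0 = x \<and> c (2 * M) = y \<and> (\<forall>j. c j \<in> E) \<and> (\<forall>j. dist (c j) (c (Suc j)) \<le> e)"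
proof -
  let ?R = "{(a, b). a \<in> E \<and> b \<in> E \<and> dist a b \<le> e}"
  have "\<exists>n. (x, y) \<in> ?R ^^ n" using connected_chain[OF E e] rtrancl_imp_relpow by blast
  define n where "n = (LEAST n. (x, y) \<in> ?R ^^ n)"
  have n: "(x, y) \<in> ?R ^^ n" unfolding n_def using \<open>\<exists>n. (x, y) \<in> ?R ^^ n\<close> by (rule LeastI_ex)
  have least: "n \<le> m" if "(x, y) \<in> ?R ^^ m" for m unfolding n_def using that by (rule Least_le)
  obtain f where f: "f 0 = x" "f n = y" "\<forall>i<n. (f i, f (Suc i)) \<in> ?R" using n relpow_fun_conv[of x y n ?R] by blast
  have fE: "f i \<in> E" if "i \<le> n" for i using f that E by (cases i) auto
  have far: "e < dist (f i) (f j)" if ij: "Suc (Suc i) \<le> j" "j \<le> n" for i j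
  proof (rule ccontr)
    assume "\<not> ?thesis"
    then have R: "(f i, f j) \<in> ?R" using fE ij by auto
    have "(f 0, f i) \<in> ?R ^^ i" using f ij by (subst relpow_fun_conv) (intro exI[of _ f], auto)
    moreover have "(f j, f n) \<in> ?R ^^ (n - j)" using f ij
      by (subst relpow_fun_conv) (intro exI[of _ "\<lambda>k. f (j + k)"], auto)
    then have "(f i, f n) \<in> ?R ^^ Suc (n - j)" using relpow_Suc_I2[OF R] by blast
    ultimately have "(x, y) \<in> ?R ^^ (i + Suc (n - j))" unfolding relpow_add using f(1,2) by blast
    then show False using least ij by fastforce
  qed
  have "n \<le> 2 * M"
  proof -
    let ?I = "{i. 2 * i \<le> n}"
    have fin: "finite ?I" by (rule finite_subset[of _ "{..n}"]) auto
    have sep: "e < dist (f (2 * i)) (f (2 * j))" if "i \<in> ?I" "j \<in> ?I" "i \<noteq> j" for i j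
      using far[of "2 * i" "2 * j"] far[of "2 * j" "2 * i"] that dist_commute[of "f (2 * i)"]
      by (cases "i < j") auto
    have inj: "inj_on (\<lambda>i. f (2 * i)) ?I"
    proof (rule inj_onI, rule ccontr)
      fix i j assume "i \<in> ?I" "j \<in> ?I" "f (2 * i) = f (2 * j)" "i \<noteq> j"
      then show False using sep[of i j] e by simp
    qed
    have "card ((\<lambda>i. f (2 * i)) ` ?I) \<le> M"
    proof (rule M)
      show "finite ((\<lambda>i. f (2 * i)) ` ?I)" using fin by simp
      show "(\<lambda>i. f (2 * i)) ` ?I \<subseteq> E" using fE by auto
      show "e \<le> dist a b" if ab: "a \<in> (\<lambda>i. f (2 * i)) ` ?I" "b \<in> (\<lambda>i. f (2 * i)) ` ?I" "a \<noteq> b" for a b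
      proof -
        obtain i j where "i \<in> ?I" "j \<in> ?I" "a = f (2 * i)" "b = f (2 * j)" using ab by blast
        then show ?thesis using sep[of i j] ab(3) by (cases "i = j") auto
      qed
    qed
    then have "card ?I \<le> M" using card_image[OF inj] by simp
    moreover have "?I = {..n div 2}" by auto
    ultimately show ?thesis by simp
  qed
  then show ?thesis using f fE e
    by (intro exI[of _ "\<lambda>j. f (min j n)"]) (auto simp: min_def not_le Suc_le_eq less_Suc_eq_le)
qed

section \<open>From weak to power quasisymmetry\<close>

text \<open>Both powers are increasing bijections of the half-line, so the inverse of their maximum
  is the minimum of their inverses. Two exponents are needed for ratios above and below 1.\<close>

lemma homeomorphic_max_powr:
  fixes A K \<alpha> \<beta> :: real
  assumes "0 < A" "0 < K" "0 < \<alpha>" "0 < \<beta>"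
  shows "homeomorphic_map (top_of_set {0..}) (top_of_set {0..})
    (\<lambda>t. A * max ((K * t) powr \<alpha>) ((K * t) powr \<beta>))"
proof -
  let ?f = "\<lambda>t::real. A * max ((K * t) powr \<alpha>) ((K * t) powr \<beta>)"
  let ?g = "\<lambda>s::real. min ((s / A) powr (1 / \<alpha>)) ((s / A) powr (1 / \<beta>)) / K"
  have inv1: "(u powr \<gamma>) powr (1 / \<gamma>) = u" "(u powr (1 / \<gamma>)) powr \<gamma> = u" if "0 \<le> u" "0 < \<gamma>" for u \<gamma> :: real
    using that by (auto simp: powr_powr)
  have mono: "u powr \<gamma> \<le> v powr \<gamma>" if "0 \<le> u" "u \<le> v" "0 < \<gamma>" for u v \<gamma> :: real
    using that by (intro powr_mono2) auto
  have gf: "?g (?f t) = t" if t: "0 \<le> t" for t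
  proof -
    let ?u = "K * t"
    have u: "0 \<le> ?u" using t assms by simp
    let ?m = "max (?u powr \<alpha>) (?u powr \<beta>)"
    have "?u \<le> ?m powr (1 / \<alpha>)" "?u \<le> ?m powr (1 / \<beta>)"
      using mono[of "?u powr \<alpha>" ?m "1 / \<alpha>"] mono[of "?u powr \<beta>" ?m "1 / \<beta>"] inv1[OF u] assms by auto
    moreover have "?m powr (1 / \<alpha>) = ?u \<or> ?m powr (1 / \<beta>) = ?u"
      using inv1[OF u] assms by (auto simp: max_def)
    ultimately have "min (?m powr (1 / \<alpha>)) (?m powr (1 / \<beta>)) = ?u" by (auto simp: min_def)
    then show ?thesis using assms by simp
  qed
  have fg: "?f (?g s) = s" if s: "0 \<le> s" for s
  proof -
    let ?u = "s / A"
    have u: "0 \<le> ?u" using s assms by simp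
    let ?m = "min (?u powr (1 / \<alpha>)) (?u powr (1 / \<beta>))"
    have m: "0 \<le> ?m" by simp
    have "?m powr \<alpha> \<le> ?u" "?m powr \<beta> \<le> ?u"
      using mono[OF m, of "?u powr (1 / \<alpha>)" \<alpha>] mono[OF m, of "?u powr (1 / \<beta>)" \<beta>] inv1[OF u] assms by auto
    moreover have "?m powr \<alpha> = ?u \<or> ?m powr \<beta> = ?u"
      using inv1[OF u] assms by (auto simp: min_def)
    ultimately have "max (?m powr \<alpha>) (?m powr \<beta>) = ?u" by (auto simp: max_def)
    then show ?thesis using assms by simp
  qed
  have nonneg: "0 \<le> ?f t" "0 \<le> t \<Longrightarrow> 0 \<le> ?g t" for t
    using assms by (auto simp: le_max_iff_disj)
  have "homeomorphic_maps (top_of_set {0..}) (top_of_set {0..}) ?f ?g"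
    unfolding homeomorphic_maps_def
  proof (intro conjI)
    show "continuous_map (top_of_set {0..}) (top_of_set {0..}) ?f"
      using assms nonneg by (auto intro!: continuous_intros continuous_on_powr')
    show "continuous_map (top_of_set {0..}) (top_of_set {0..}) ?g"
      using assms nonneg by (auto intro!: continuous_intros continuous_on_powr')
  qed (use gf fg in auto)
  then show ?thesis using homeomorphic_maps_map by blast
qed

text \<open>Each halving of \<open>D x y\<close> costs a factor \<open>T\<close>, which gives one
  exponent. Decay needs a gain: if \<open>z'\<close> is half way from \<open>x\<close> to
  \<open>z\<close>, the weak inequality at \<open>z'\<close> yields
  \<open>\<rho> z' x \<le> T * \<rho> z' z\<close>, and additivity turns this into
  \<open>\<rho> x z' \<le> q * \<rho> x z\<close> with \<open>q < 1\<close>.\<close>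

lemma weak_imp_power_quasisymmetry:
  fixes D \<rho> :: "'a \<Rightarrow> 'a \<Rightarrow> real" and \<Theta> :: real
  assumes D: "\<And>x y. x \<in> S \<Longrightarrow> y \<in> S \<Longrightarrow> 0 \<le> D x y \<and> (D x y = 0 \<longleftrightarrow> x = y) \<and> D x y = D y x"
      "\<And>x y z. x \<in> S \<Longrightarrow> y \<in> S \<Longrightarrow> z \<in> S \<Longrightarrow> D x z \<le> D x y + D y z"
    and \<rho>: "\<And>x y. x \<in> S \<Longrightarrow> y \<in> S \<Longrightarrow> 0 \<le> \<rho> x y \<and> \<rho> x y = \<rho> y x"
    and ivt: "\<And>x y s. x \<in> S \<Longrightarrow> y \<in> S \<Longrightarrow> 0 \<le> s \<Longrightarrow> s \<le> D x y \<Longrightarrow>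
       \<exists>z\<in>S. D x z = s \<and> \<rho> x y = \<rho> x z + \<rho> z y"
    and wq: "\<And>x y z. x \<in> S \<Longrightarrow> y \<in> S \<Longrightarrow> z \<in> S \<Longrightarrow> x \<noteq> z \<Longrightarrow> D x y \<le> 2 * D x z \<Longrightarrow> \<rho> x y \<le> \<Theta> * \<rho> x z"
  shows "\<exists>A \<alpha> \<beta>. 0 < A \<and> 0 < \<alpha> \<and> 0 < \<beta> \<and> (\<forall>x\<in>S. \<forall>y\<in>S. \<forall>z\<in>S. x \<noteq> z \<longrightarrow>
      \<rho> x y \<le> A * max ((D x y / D x z) powr \<alpha>) ((D x y / D x z) powr \<beta>) * \<rho> x z)"
proof -
  define T where "T = max 2 \<Theta>"
  have T: "2 \<le> T" unfolding T_def by simp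
  have wT: "\<rho> x y \<le> T * \<rho> x z" if S: "x \<in> S" "y \<in> S" "z \<in> S" "x \<noteq> z" "D x y \<le> 2 * D x z" for x y z
  proof -
    have "\<Theta> * \<rho> x z \<le> T * \<rho> x z" unfolding T_def using \<rho>[OF S(1,3)] by (intro mult_right_mono) auto
    then show ?thesis using wq[OF S] by linarith
  qed
  define q where "q = T / (1 + T)"
  have q: "0 < q" "q < 1" unfolding q_def using T by auto
  have up: "\<rho> x y \<le> T ^ Suc k * \<rho> x z"
    if "x \<in> S" "y \<in> S" "z \<in> S" "x \<noteq> z" "D x y \<le> 2 ^ k * D x z" for x y z k
    using that
  proof (induction k arbitrary: y)
    case 0
    then have "D x y \<le> 2 * D x z" using D(1)[of x z] by simp
    then show ?case using wT 0 by simp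
  next
    case (Suc k)
    obtain y' where y': "y' \<in> S" "D x y' = D x y / 2" using ivt[of x y "D x y / 2"] D(1)[of x y] Suc.prems by auto
    have 1: "\<rho> x y' \<le> T ^ Suc k * \<rho> x z" using Suc.IH[OF Suc.prems(1) y'(1) Suc.prems(3,4)] y' Suc.prems by simp
    show ?case
    proof (cases "x = y'")
      case True
      then have "D x y = 0" using y' D(1)[of x x] Suc.prems by simp
      then have "D x y \<le> 2 * D x z" using D(1)[of x z] Suc.prems by simp
      then have "\<rho> x y \<le> T * \<rho> x z" using wT Suc.prems by simp
      also have "T * \<rho> x z \<le> T ^ Suc (Suc k) * \<rho> x z"
        using T \<rho>[of x z] Suc.prems one_le_power[of T "Suc k"] by (intro mult_right_mono) auto
      finally show ?thesis .
    next
      case False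
      have "\<rho> x y \<le> T * \<rho> x y'" using wT[OF Suc.prems(1,2) y'(1) False] y' by simp
      also have "\<dots> \<le> T * (T ^ Suc k * \<rho> x z)" using 1 T by (intro mult_left_mono) auto
      finally show ?thesis by simp
    qed
  qed
  have down: "\<rho> x y \<le> T * q ^ k * \<rho> x z"
    if "x \<in> S" "y \<in> S" "z \<in> S" "x \<noteq> z" "2 ^ k * D x y \<le> D x z" for x y z k
    using that
  proof (induction k arbitrary: z)
    case 0
    then have "D x y \<le> 2 * D x z" using D(1)[of x z] by simp
    then show ?case using wT 0 by simp
  next
    case (Suc k)
    have xz: "0 < D x z" using D(1)[of x z] Suc.prems by auto
    obtain z' where z': "z' \<in> S" "D x z' = D x z / 2" "\<rho> x z = \<rho> x z' + \<rho> z' z"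
      using ivt[of x z "D x z / 2"] D(1)[of x z] Suc.prems by auto
    have xz': "x \<noteq> z'" using z' xz D(1)[of x x] Suc.prems by auto
    have 1: "\<rho> x y \<le> T * q ^ k * \<rho> x z'" using Suc.IH[OF Suc.prems(1,2) z'(1) xz'] z' Suc.prems by simp
    have "D x z \<le> D x z' + D z' z" using D(2) Suc.prems z' by blast
    then have d: "D x z' \<le> D z' z" "0 < D z' z" using z' xz by linarith+
    then have "z' \<noteq> z" using D(1)[of z z] Suc.prems by auto
    then have "\<rho> z' x \<le> T * \<rho> z' z" using wT[OF z'(1) Suc.prems(1,3)] d D(1)[of x z'] z'(1) Suc.prems by simp
    then have "(1 + T) * \<rho> x z' \<le> T * \<rho> x z" using z' \<rho>[of x z'] Suc.prems by (simp add: algebra_simps)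
    then have "\<rho> x z' \<le> q * \<rho> x z" unfolding q_def using T by (simp add: field_simps)
    then have "T * q ^ k * \<rho> x z' \<le> T * q ^ k * (q * \<rho> x z)" using T q by (intro mult_left_mono) auto
    also have "\<dots> = T * q ^ Suc k * \<rho> x z" by simp
    finally show ?case using 1 by linarith
  qed
  define \<alpha> where "\<alpha> = log 2 T"
  define \<beta> where "\<beta> = log 2 (1 / q)"
  \<comment> \<open>\<open>T\<^sup>2\<close> absorbs the rounding of \<open>log 2 t\<close> and the
    initial factor for large ratios, \<open>T / q\<close> does the same for small ones;
    \<open>A\<close> dominates both.\<close>
  define A where "A = T\<^sup>2 / q"
  have pos: "0 < \<alpha>" "0 < \<beta>" "0 < A" unfolding \<alpha>_def \<beta>_def A_def using T q by auto
  have "T\<^sup>2 * 1 \<le> T\<^sup>2 * (1 / q)" using q by (intro mult_left_mono) auto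
  moreover have "T * 1 \<le> T * T" using T by (intro mult_left_mono) auto
  moreover have "T * (1 / q) \<le> T\<^sup>2 * (1 / q)" using q T by (intro mult_right_mono) (auto simp: power2_eq_square)
  ultimately have A: "T\<^sup>2 \<le> A" "T / q \<le> A" unfolding A_def by auto
  have "\<rho> x y \<le> A * max ((D x y / D x z) powr \<alpha>) ((D x y / D x z) powr \<beta>) * \<rho> x z"
    if S: "x \<in> S" "y \<in> S" "z \<in> S" "x \<noteq> z" for x y z
  proof (cases "x = y")
    case True
    \<comment> \<open>As \<open>D x y = 0\<close>, the estimate \<open>down\<close> holds for every
      \<open>k\<close>, which forces \<open>\<rho> x y \<le> 0\<close>.\<close>
    have "\<rho> x y \<le> T * q ^ k * \<rho> x z" for k using down[OF S, of k] True D(1)[OF S(1,1)] D(1)[OF S(1,3)] by simp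
    moreover have "(\<lambda>k. T * q ^ k * \<rho> x z) \<longlonglongrightarrow> T * 0 * \<rho> x z"
      using q by (intro tendsto_mult tendsto_const LIMSEQ_power_zero) auto
    ultimately have "\<rho> x y \<le> 0" using LIMSEQ_le_const[of "\<lambda>k. T * q ^ k * \<rho> x z" 0 "\<rho> x y"] by simp
    then show ?thesis using pos \<rho>[OF S(1,3)] by (intro order_trans[OF _ mult_nonneg_nonneg]) (auto simp: le_max_iff_disj)
  next
    case False
    define t where "t = D x y / D x z"
    have d: "0 < D x y" "0 < D x z" using D(1)[OF S(1,2)] D(1)[OF S(1,3)] False S(4) by auto
    then have t: "0 < t" "D x y = t * D x z" unfolding t_def by auto
    let ?m = "max (t powr \<alpha>) (t powr \<beta>)"
    have r: "0 \<le> \<rho> x z" using \<rho>[OF S(1,3)] by simp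
    show ?thesis
    proof (cases "1 \<le> t")
      case True
      define k where "k = nat \<lceil>log 2 t\<rceil>"
      have l: "0 \<le> log 2 t" using True by simp
      have k: "log 2 t \<le> real k" "real k \<le> log 2 t + 1" unfolding k_def using l by linarith+
      have "t \<le> 2 powr real k" using k(1) t by (simp add: log_le_iff)
      then have "D x y \<le> 2 ^ k * D x z" unfolding t(2) using d by (intro mult_right_mono) (auto simp: powr_realpow)
      then have "\<rho> x y \<le> T ^ Suc k * \<rho> x z" using up[OF S] by blast
      also have "T ^ Suc k \<le> T\<^sup>2 * (t powr \<alpha>)"
      proof -
        have "T ^ Suc k = T powr (real k + 1)" using T by (simp add: powr_realpow powr_add)
        also have "\<dots> \<le> T powr (log 2 t + 2)" using T k by (intro powr_mono) auto
        also have "\<dots> = T\<^sup>2 * T powr (log 2 t)" using T by (simp add: powr_add)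
        also have "T powr (log 2 t) = t powr \<alpha>" unfolding \<alpha>_def using T t
          by (simp add: powr_def log_def)
        finally show ?thesis .
      qed
      also have "T\<^sup>2 * (t powr \<alpha>) \<le> A * ?m" using A pos by (intro mult_mono) auto
      finally show ?thesis unfolding t_def[symmetric] using r by (auto intro: mult_right_mono)
    next
      case False
      define k where "k = nat \<lfloor>log 2 (1 / t)\<rfloor>"
      have l: "0 \<le> log 2 (1 / t)" using False t by simp
      have k: "real k \<le> log 2 (1 / t)" "log 2 (1 / t) - 1 \<le> real k" unfolding k_def using l by linarith+
      have "2 powr real k \<le> 1 / t" using k(1) t by (simp add: le_log_iff)
      then have "2 ^ k * t \<le> 1" using t by (simp add: powr_realpow field_simps)
      then have "2 ^ k * D x y \<le> D x z" unfolding t(2) using d mult_right_mono[of "2 ^ k * t" 1 "D x z"] by simp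
      then have "\<rho> x y \<le> T * q ^ k * \<rho> x z" using down[OF S] by blast
      also have "T * q ^ k \<le> (T / q) * (t powr \<beta>)"
      proof -
        have "q ^ k = q powr real k" using q by (simp add: powr_realpow)
        also have "\<dots> \<le> q powr (log 2 (1 / t) - 1)" using q k by (intro powr_mono') auto
        also have "\<dots> = q powr (log 2 (1 / t)) / q" using q by (simp add: powr_diff)
        also have "q powr (log 2 (1 / t)) = t powr \<beta>" unfolding \<beta>_def using q t
          by (simp add: powr_def log_def ln_div)
        finally have "T * q ^ k \<le> T * (t powr \<beta> / q)" using T by (intro mult_left_mono) auto
        then show ?thesis by simp
      qed
      also have "(T / q) * (t powr \<beta>) \<le> A * ?m" using A pos T q by (intro mult_mono) auto
      finally show ?thesis unfolding t_def[symmetric] using r by (auto intro: mult_right_mono)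
    qed
  qed
  then show ?thesis using pos by blast
qed

section \<open>Uniquely arcwise connected compacta\<close>

definition arc_in :: "'b::topological_space set \<Rightarrow> 'b \<Rightarrow> 'b \<Rightarrow> (real \<Rightarrow> 'b) \<Rightarrow> bool" where
  "arc_in Y x y g \<longleftrightarrow> arc g \<and> path_image g \<subseteq> Y \<and> pathstart g = x \<and> pathfinish g = y"

text \<open>The tree is placed in a complete normed space, where paths, arcs and diameters are the
  type-based notions. Bounded turning and doubling appear in the form in which they are used: a
  connected set inside a ball, and a bound on separated sets.\<close>

locale unique_arcs =
  fixes Y :: "'b::{complete_space,real_normed_vector} set" and K :: real
  assumes compact: "compact Y"
    and arc_ex: "x \<in> Y \<Longrightarrow> y \<in> Y \<Longrightarrow> x \<noteq> y \<Longrightarrow> \<exists>g. arc_in Y x y g"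
    and arc_unique: "arc_in Y x y g \<Longrightarrow> arc_in Y x y g' \<Longrightarrow> path_image g = path_image g'"
    and K: "1 \<le> K"
    and turning: "x \<in> Y \<Longrightarrow> y \<in> Y \<Longrightarrow>
       \<exists>E\<subseteq>Y. connected E \<and> x \<in> E \<and> y \<in> E \<and> (\<forall>e\<in>E. dist x e \<le> K * dist x y)"
    and doubling: "\<exists>M::nat. \<forall>z\<in>Y. \<forall>r>0. \<forall>F\<subseteq>Y. finite F \<longrightarrow> (\<forall>f\<in>F. dist f z \<le> L * r) \<longrightarrow>
                 (\<forall>f\<in>F. \<forall>g\<in>F. f \<noteq> g \<longrightarrow> r \<le> dist f g) \<longrightarrow> card F \<le> M"
    and nontriv: "\<exists>x\<in>Y. \<exists>y\<in>Y. x \<noteq> y"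
begin

definition seg where
  "seg x y = (if x = y then {x} else path_image (SOME g. arc_in Y x y g))"

lemma seg_eq: "arc_in Y x y g \<Longrightarrow> seg x y = path_image g"
  unfolding seg_def
  by (metis arc_distinct_ends arc_in_def arc_unique someI)

lemma arc_inD:
  assumes "arc_in Y x y g"
  shows "arc g" "path g" "path_image g \<subseteq> Y" "g 0 = x" "g 1 = y" "x \<noteq> y" "inj_on g {0..1}" "continuous_on {0..1} g"
  using assms arc_distinct_ends[of g] unfolding arc_in_def
  by (auto simp: arc_imp_path arc_imp_inj_on pathstart_def pathfinish_def arc_def path_def)

lemma seg_refl: "seg x x = {x}" by (simp add: seg_def)

lemma seg_path:
  assumes "x \<in> Y" "y \<in> Y"
  shows "\<exists>p. path p \<and> path_image p = seg x y \<and> path_image p \<subseteq> Y \<and> pathstart p = x \<and> pathfinish p = y"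
proof (cases "x = y")
  case True
  then show ?thesis using assms by (intro exI[of _ "linepath x x"]) (auto simp: seg_refl)
next
  case False
  then obtain g where "arc_in Y x y g" using arc_ex assms by blast
  then show ?thesis using seg_eq arc_inD(2) unfolding arc_in_def by (intro exI[of _ g]) auto
qed

lemma seg_facts:
  assumes "x \<in> Y" "y \<in> Y"
  shows "seg x y \<subseteq> Y" "x \<in> seg x y" "y \<in> seg x y" "compact (seg x y)" "connected (seg x y)"
  using seg_path[OF assms] pathstart_in_path_image pathfinish_in_path_image compact_path_image connected_path_image
  by metis+

text \<open>A path between distinct points contains an arc with the same ends, and by uniqueness
  this arc is \<open>seg x y\<close>. Symmetry and \<open>seg_tri\<close> are applications to a
  reversed and to a joined path.\<close>

lemma seg_sub_path:
  assumes "path p" "path_image p \<subseteq> Y" "pathstart p = x" "pathfinish p = y"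
  shows "seg x y \<subseteq> path_image p"
proof (cases "x = y")
  case True
  then show ?thesis using assms pathstart_in_path_image[of p] by (auto simp: seg_refl)
next
  case False
  obtain q where "arc q" "path_image q \<subseteq> path_image p" "pathstart q = x" "pathfinish q = y"
    using path_contains_arc[OF assms(1,3,4) False] .
  then show ?thesis using seg_eq[of x y q] assms(2) unfolding arc_in_def by auto
qed

lemma seg_sym_aux: "x \<in> Y \<Longrightarrow> y \<in> Y \<Longrightarrow> seg x y \<subseteq> seg y x"
proof -
  assume S: "x \<in> Y" "y \<in> Y"
  obtain p where "path p" "path_image p = seg y x" "path_image p \<subseteq> Y" "pathstart p = y" "pathfinish p = x"
    using seg_path[OF S(2,1)] by blast
  then show ?thesis using seg_sub_path[of "reversepath p" x y] by simp
qed

lemma seg_sym: "x \<in> Y \<Longrightarrow> y \<in> Y \<Longrightarrow> seg x y = seg y x"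
  using seg_sym_aux by blast

lemma seg_tri: "x \<in> Y \<Longrightarrow> y \<in> Y \<Longrightarrow> z \<in> Y \<Longrightarrow> seg x z \<subseteq> seg x y \<union> seg y z"
proof -
  assume S: "x \<in> Y" "y \<in> Y" "z \<in> Y"
  obtain p where p: "path p" "path_image p = seg x y" "path_image p \<subseteq> Y" "pathstart p = x" "pathfinish p = y"
    using seg_path[OF S(1,2)] by blast
  obtain q where q: "path q" "path_image q = seg y z" "path_image q \<subseteq> Y" "pathstart q = y" "pathfinish q = z"
    using seg_path[OF S(2,3)] by blast
  show ?thesis using seg_sub_path[of "p +++ q" x z] p q by (auto simp: path_image_join)
qed

lemma seg_subarc:
  assumes g: "arc_in Y x y g" and uv: "0 \<le> u" "u \<le> v" "v \<le> 1"
  shows "seg (g u) (g v) = g ` {u..v}"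
proof (cases "u = v")
  case True
  then show ?thesis by (simp add: seg_refl)
next
  case False
  have "arc (subpath u v g)" using arc_subpath_arc[of g u v] arc_inD(1)[OF g] uv False by auto
  moreover have im: "path_image (subpath u v g) = g ` {u..v}" using uv by (simp add: path_image_subpath)
  moreover have "g ` {u..v} \<subseteq> Y" using arc_inD(3)[OF g] uv unfolding path_image_def by auto
  ultimately have "arc_in Y (g u) (g v) (subpath u v g)" unfolding arc_in_def by simp
  then show ?thesis using seg_eq im by simp
qed

lemma seg_split:
  assumes S: "x \<in> Y" "y \<in> Y" and z: "z \<in> seg x y"
  shows "seg x y = seg x z \<union> seg z y" "seg x z \<inter> seg z y = {z}"
proof -
  have "seg x y = seg x z \<union> seg z y \<and> seg x z \<inter> seg z y = {z}"
  proof (cases "x = y")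
    case True
    then show ?thesis using z by (auto simp: seg_refl)
  next
    case False
    then obtain g where g: "arc_in Y x y g" using arc_ex S by blast
    note A = arc_inD[OF g]
    obtain t where t: "t \<in> {0..1}" "z = g t" using z seg_eq[OF g] unfolding path_image_def by auto
    have 1: "seg x z = g ` {0..t}" "seg z y = g ` {t..1}" "seg x y = g ` {0..1}"
      using seg_subarc[OF g, of 0 t] seg_subarc[OF g, of t 1] seg_subarc[OF g, of 0 1] t A(4,5) by auto
    have 2: "{0..1} = {0..t} \<union> {t..1}" "{0..t} \<inter> {t..1} = {t}" using t by auto
    have "g ` {0..t} \<inter> g ` {t..1} = g ` ({0..t} \<inter> {t..1})"
      using inj_on_image_Int[OF A(7), of "{0..t}" "{t..1}"] t by auto
    then show ?thesis unfolding 1 using 2 t(2) by (simp add: image_Un[symmetric])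
  qed
  then show "seg x y = seg x z \<union> seg z y" "seg x z \<inter> seg z y = {z}" by auto
qed

lemma seg_sub:
  assumes S: "x \<in> Y" "y \<in> Y" and z: "u \<in> seg x y" "v \<in> seg x y"
  shows "seg u v \<subseteq> seg x y"
proof (cases "x = y")
  case True
  then show ?thesis using z by (auto simp: seg_refl)
next
  case False
  then obtain g where g: "arc_in Y x y g" using arc_ex S by blast
  note A = arc_inD[OF g]
  obtain s where s: "s \<in> {0..1}" "u = g s" using z seg_eq[OF g] unfolding path_image_def by auto
  obtain t where t: "t \<in> {0..1}" "v = g t" using z seg_eq[OF g] unfolding path_image_def by auto
  have 1: "seg x y = g ` {0..1}" using seg_subarc[OF g, of 0 1] A(4,5) by simp
  have uv: "u \<in> Y" "v \<in> Y" using z seg_facts(1)[OF S] by auto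
  show ?thesis
  proof (cases "s \<le> t")
    case True
    then show ?thesis using seg_subarc[OF g, of s t] s t unfolding 1 by auto
  next
    case False
    then show ?thesis using seg_subarc[OF g, of t s] s t seg_sym[OF uv] unfolding 1 by auto
  qed
qed

section \<open>The diameter of the arc as a metric\<close>

definition D where "D x y = (if x \<in> Y \<and> y \<in> Y then diameter (seg x y) else 0)"

lemma seg_bounded: "x \<in> Y \<Longrightarrow> y \<in> Y \<Longrightarrow> bounded (seg x y)"
  using compact_imp_bounded seg_facts(4) by blast

lemma D_ge:
  assumes "x \<in> Y" "y \<in> Y" "u \<in> seg x y" "v \<in> seg x y"
  shows "dist u v \<le> D x y"
  using diameter_bounded_bound[OF seg_bounded[OF assms(1,2)] assms(3,4)] assms(1,2) by (simp add: D_def)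

lemma D_le:
  assumes "x \<in> Y" "y \<in> Y" "\<And>u v. u \<in> seg x y \<Longrightarrow> v \<in> seg x y \<Longrightarrow> dist u v \<le> e"
  shows "D x y \<le> e"
  using diameter_le[of "seg x y" e] seg_facts(2)[OF assms(1,2)] assms unfolding D_def
  by (auto simp: dist_norm)

lemma D_dist: "x \<in> Y \<Longrightarrow> y \<in> Y \<Longrightarrow> dist x y \<le> D x y"
  using D_ge seg_facts(2,3) by blast

lemma D_mono:
  assumes S: "x \<in> Y" "y \<in> Y" and z: "u \<in> seg x y" "v \<in> seg x y"
  shows "D u v \<le> D x y"
proof -
  have "u \<in> Y" "v \<in> Y" using z seg_facts(1)[OF S] by auto
  then show ?thesis using diameter_subset[OF seg_sub[OF assms] seg_bounded[OF S]] S by (simp add: D_def)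
qed

lemma D_nonneg: "0 \<le> D x y"
  unfolding D_def using diameter_ge_0 seg_bounded by auto

lemma D_sym: "D x y = D y x"
  unfolding D_def using seg_sym by auto

lemma D_zero: "x \<in> Y \<Longrightarrow> y \<in> Y \<Longrightarrow> D x y = 0 \<longleftrightarrow> x = y"
  using D_dist[of x y] by (auto simp: D_def seg_refl)

lemma D_tri:
  assumes S: "x \<in> Y" "y \<in> Y" "z \<in> Y"
  shows "D x z \<le> D x y + D y z"
proof (rule D_le[OF S(1,3)])
  fix u v assume "u \<in> seg x z" "v \<in> seg x z"
  then have uv: "u \<in> seg x y \<or> u \<in> seg y z" "v \<in> seg x y \<or> v \<in> seg y z" using seg_tri[OF S] by auto
  have a: "dist w y \<le> D x y" "dist y w \<le> D x y" if "w \<in> seg x y" for w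
    using D_ge[OF S(1,2) that seg_facts(3)[OF S(1,2)]] by (auto simp: dist_commute)
  have b: "dist w y \<le> D y z" "dist y w \<le> D y z" if "w \<in> seg y z" for w
    using D_ge[OF S(2,3) that seg_facts(2)[OF S(2,3)]] by (auto simp: dist_commute)
  have "dist u v \<le> D x y" if "u \<in> seg x y" "v \<in> seg x y" using D_ge[OF S(1,2) that] .
  moreover have "dist u v \<le> D y z" if "u \<in> seg y z" "v \<in> seg y z" using D_ge[OF S(2,3) that] .
  ultimately show "dist u v \<le> D x y + D y z"
    using uv a[of u] a[of v] b[of u] b[of v] dist_triangle[of u v y] D_nonneg[of x y] D_nonneg[of y z] by linarith
qed

text \<open>Bounded turning provides a connected set rather than a path. Doubling extracts from it a
  chain with a bounded number of steps of half the distance. Iterating such chains produces a path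
  of controlled diameter, and every path from \<open>x\<close> to \<open>y\<close> contains
  \<open>seg x y\<close>.\<close>

lemma D_comparable: "\<exists>C\<ge>1. \<forall>x\<in>Y. \<forall>y\<in>Y. D x y \<le> C * dist x y"
proof -
  obtain M :: nat where M0: "\<forall>z\<in>Y. \<forall>r>0. \<forall>F\<subseteq>Y. finite F \<longrightarrow> (\<forall>f\<in>F. dist f z \<le> (2 * K) * r) \<longrightarrow>
                 (\<forall>f\<in>F. \<forall>g\<in>F. f \<noteq> g \<longrightarrow> r \<le> dist f g) \<longrightarrow> card F \<le> M"
    using doubling[of "2 * K"] by (elim exE) (rule that)
  note M = M0[THEN bspec, THEN spec, THEN mp, THEN spec, THEN mp, THEN mp, THEN mp, THEN mp]
  \<comment> \<open>\<open>Suc\<close> makes \<open>N\<close> positive, as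
    \<open>path_from_chains\<close> requires.\<close>
  define N where "N = 2 * Suc M"
  have ch: "\<exists>c. c 0 = a \<and> c N = b \<and> (\<forall>j. c j \<in> Y) \<and>
       (\<forall>j<N. dist (c j) (c (Suc j)) \<le> dist a b / 2) \<and> (\<forall>j\<le>N. dist a (c j) \<le> K * dist a b)"
    if ab: "a \<in> Y" "b \<in> Y" for a b
  proof (cases "a = b")
    case True
    then show ?thesis using ab by (intro exI[of _ "\<lambda>_. a"]) auto
  next
    case False
    then have d: "0 < dist a b / 2" by simp
    obtain E where E: "E \<subseteq> Y" "connected E" "a \<in> E" "b \<in> E" "\<forall>e\<in>E. dist a e \<le> K * dist a b"
      using turning[OF ab] by blast
    have "card F \<le> Suc M" if F: "finite F" "F \<subseteq> E" "\<And>f g. f \<in> F \<Longrightarrow> g \<in> F \<Longrightarrow> f \<noteq> g \<Longrightarrow> dist a b / 2 \<le> dist f g" for F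
    proof -
      have "\<forall>f\<in>F. dist f a \<le> (2 * K) * (dist a b / 2)" using E(5) F(2) by (auto simp: dist_commute)
      then have "card F \<le> M"
        using F(3) by (intro M[OF ab(1) d order_trans[OF F(2) E(1)] F(1)]) auto
      then show ?thesis by simp
    qed
    then obtain c where c: "c 0 = a" "c N = b" "\<forall>j. c j \<in> E" "\<forall>j. dist (c j) (c (Suc j)) \<le> dist a b / 2"
      using bounded_chain[OF E(2-4) d, of "Suc M"] unfolding N_def by blast
    then show ?thesis using E(1,5) by (intro exI[of _ c]) auto
  qed
  have N0: "0 < N" unfolding N_def by simp
  have "D x y \<le> (2 * (2 * K + 1)) * dist x y" if S: "x \<in> Y" "y \<in> Y" for x y
  proof -
    obtain p where p: "path p" "path_image p \<subseteq> Y" "pathstart p = x" "pathfinish p = y"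
      "path_image p \<subseteq> cball x ((2 * K + 1) * dist x y)"
      using path_from_chains[OF compact_imp_closed[OF compact] N0 _ ch S] K by fastforce
    have sub: "seg x y \<subseteq> cball x ((2 * K + 1) * dist x y)" using seg_sub_path[OF p(1-4)] p(5) by blast
    show ?thesis
    proof (rule D_le[OF S])
      fix u v assume "u \<in> seg x y" "v \<in> seg x y"
      then have "dist x u \<le> (2 * K + 1) * dist x y" "dist x v \<le> (2 * K + 1) * dist x y" using sub by auto
      then show "dist u v \<le> (2 * (2 * K + 1)) * dist x y" using dist_triangle3[of u v x] by linarith
    qed
  qed
  then show ?thesis using K by (intro exI[of _ "2 * (2 * K + 1)"]) auto
qed

text \<open>By comparability with \<open>dist\<close>, the function \<open>D x\<close> is continuous
  on the connected set \<open>seg x y\<close>.\<close>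

lemma D_ivt:
  assumes S: "x \<in> Y" "y \<in> Y" and s: "0 \<le> s" "s \<le> D x y"
  shows "\<exists>z\<in>seg x y. D x z = s"
proof -
  obtain C where C: "1 \<le> C" "\<And>x y. x \<in> Y \<Longrightarrow> y \<in> Y \<Longrightarrow> D x y \<le> C * dist x y" using D_comparable by blast
  have "continuous_on (seg x y) (D x)"
  proof (rule continuous_on_iff[THEN iffD2], intro ballI allI impI)
    fix w e :: real and w' assume "w' \<in> seg x y" and e: "0 < e"
    then have w: "w' \<in> Y" using seg_facts(1)[OF S] by blast
    have "dist (D x v) (D x w') < e" if v: "v \<in> seg x y" "dist v w' < e / C" for v
    proof -
      have vY: "v \<in> Y" using v seg_facts(1)[OF S] by blast
      have "\<bar>D x v - D x w'\<bar> \<le> D v w'"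
        using D_tri[OF S(1) vY w] D_tri[OF S(1) w vY] D_sym[of v w'] by linarith
      also have "\<dots> \<le> C * dist v w'" using C(2)[OF vY w] .
      also have "\<dots> < e" using v(2) C(1) by (simp add: field_simps)
      finally show ?thesis by (simp add: dist_real_def)
    qed
    then show "\<exists>d>0. \<forall>v\<in>seg x y. dist v w' < d \<longrightarrow> dist (D x v) (D x w') < e"
      using e C(1) by (intro exI[of _ "e / C"]) auto
  qed
  then have "connected (D x ` seg x y)" using seg_facts(5)[OF S] by (rule connected_continuous_image)
  moreover have "D x x \<in> D x ` seg x y" "D x y \<in> D x ` seg x y" using seg_facts(2,3)[OF S] by auto
  moreover have "D x x = 0" using D_zero S by simp
  ultimately have "s \<in> D x ` seg x y" using s connected_contains_Icc[of "D x ` seg x y" 0 "D x y"] by auto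
  then show ?thesis by auto
qed

lemma D_doubling:
  "\<exists>M::nat. \<forall>z\<in>Y. \<forall>r>0. \<forall>F\<subseteq>Y. finite F \<longrightarrow> (\<forall>f\<in>F. D f z \<le> L * r) \<longrightarrow>
                 (\<forall>f\<in>F. \<forall>g\<in>F. f \<noteq> g \<longrightarrow> r \<le> D f g) \<longrightarrow> card F \<le> M"
proof -
  obtain C where C: "1 \<le> C" "\<And>x y. x \<in> Y \<Longrightarrow> y \<in> Y \<Longrightarrow> D x y \<le> C * dist x y" using D_comparable by blast
  obtain M :: nat where M0: "\<forall>z\<in>Y. \<forall>r>0. \<forall>F\<subseteq>Y. finite F \<longrightarrow> (\<forall>f\<in>F. dist f z \<le> (L * C) * r) \<longrightarrow>
                 (\<forall>f\<in>F. \<forall>g\<in>F. f \<noteq> g \<longrightarrow> r \<le> dist f g) \<longrightarrow> card F \<le> M"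
    using doubling[of "L * C"] by (elim exE) (rule that)
  note M = M0[THEN bspec, THEN spec, THEN mp, THEN spec, THEN mp, THEN mp, THEN mp, THEN mp]
  have "card F \<le> M" if z: "z \<in> Y" "0 < r" "F \<subseteq> Y" "finite F" "\<forall>f\<in>F. D f z \<le> L * r"
    "\<forall>f\<in>F. \<forall>g\<in>F. f \<noteq> g \<longrightarrow> r \<le> D f g" for z r F
  proof (rule M[OF z(1) _ z(3,4)])
    show "0 < r / C" using z(2) C(1) by simp
    show "\<forall>f\<in>F. dist f z \<le> (L * C) * (r / C)"
    proof
      fix f assume "f \<in> F"
      then have "dist f z \<le> L * r" using z D_dist[of f z] by force
      then show "dist f z \<le> (L * C) * (r / C)" using C(1) by simp
    qed
    show "\<forall>f\<in>F. \<forall>g\<in>F. f \<noteq> g \<longrightarrow> r / C \<le> dist f g"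
    proof (intro ballI impI)
      fix f g assume fg: "f \<in> F" "g \<in> F" "f \<noteq> g"
      then have "r \<le> C * dist f g" using z(3,6) C(2)[of f g] by force
      then show "r / C \<le> dist f g" using C(1) by (simp add: field_simps)
    qed
  qed
  then show ?thesis by blast
qed

section \<open>The order with root \<open>a0\<close>\<close>

definition le where "le a0 x y \<longleftrightarrow> x \<in> Y \<and> y \<in> Y \<and> x \<in> seg a0 y"

context
  fixes a0 :: 'b
  assumes a0: "a0 \<in> Y"
begin

lemma le_trans: "le a0 x y \<Longrightarrow> le a0 y z \<Longrightarrow> le a0 x z"
  unfolding le_def using seg_sub[OF a0, of z a0 y] seg_facts(2)[OF a0] by blast

lemma le_antisym: "le a0 x y \<Longrightarrow> le a0 y x \<Longrightarrow> x = y"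
proof -
  assume a: "le a0 x y" "le a0 y x"
  then have S: "x \<in> Y" "y \<in> Y" "x \<in> seg a0 y" "y \<in> seg a0 x" unfolding le_def by auto
  have "y \<in> seg a0 x \<inter> seg x y" using S(4) seg_facts(3)[OF S(1,2)] by blast
  then show "x = y" using seg_split(2)[OF a0 S(2,3)] by simp
qed

lemma le_chain: "le a0 x z \<Longrightarrow> le a0 y z \<Longrightarrow> le a0 x y \<or> le a0 y x"
proof -
  assume a: "le a0 x z" "le a0 y z"
  then have S: "x \<in> Y" "y \<in> Y" "z \<in> Y" unfolding le_def by auto
  show ?thesis
  proof (cases "a0 = z")
    case True
    then show ?thesis using a S seg_facts(2)[OF a0] unfolding le_def by (auto simp: seg_refl)
  next
    case False
    then obtain g where g: "arc_in Y a0 z g" using arc_ex[OF a0 S(3)] by blast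
    obtain s where s: "s \<in> {0..1}" "x = g s" using a seg_eq[OF g] unfolding path_image_def le_def by auto
    obtain t where t: "t \<in> {0..1}" "y = g t" using a seg_eq[OF g] unfolding path_image_def le_def by auto
    have "seg a0 x = g ` {0..s}" "seg a0 y = g ` {0..t}"
      using seg_subarc[OF g, of 0 s] seg_subarc[OF g, of 0 t] arc_inD(4)[OF g] s t by auto
    then show ?thesis using S s t unfolding le_def by (cases "s \<le> t") auto
  qed
qed

text \<open>The meet is the last point of the arc from \<open>a0\<close> to \<open>x\<close> that
  lies on \<open>seg a0 y\<close>; it exists because the parameters of common points form a compact
  set.\<close>

lemma meet_ex:
  assumes S: "x \<in> Y" "y \<in> Y"
  shows "\<exists>m. le a0 m x \<and> le a0 m y \<and> (\<forall>w. le a0 w x \<longrightarrow> le a0 w y \<longrightarrow> le a0 w m)"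
proof (cases "a0 = x")
  case True
  then show ?thesis using S seg_facts(2,3)[OF a0] unfolding le_def by (intro exI[of _ a0]) auto
next
  case False
  then obtain g where g: "arc_in Y a0 x g" using arc_ex[OF a0 S(1)] by blast
  note A = arc_inD[OF g]
  let ?T = "{t \<in> {0..1}. g t \<in> seg a0 y}"
  have "closedin (top_of_set {0..1}) ({0..1} \<inter> g -` seg a0 y)"
    using continuous_closedin_preimage[OF A(8)] compact_imp_closed[OF seg_facts(4)[OF a0 S(2)]] by blast
  then have "compact ({0..1} \<inter> g -` seg a0 y)" using closedin_compact[of "{0..1::real}"] by blast
  moreover have "{0..1} \<inter> g -` seg a0 y = ?T" by auto
  ultimately have cT: "compact ?T" by simp
  have "0 \<in> ?T" using A(4) seg_facts(2)[OF a0 S(2)] by simp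
  then obtain t where t: "t \<in> ?T" "\<forall>s\<in>?T. s \<le> t" using compact_attains_sup[OF cT] by blast
  have sg: "seg a0 (g s) = g ` {0..s}" if "s \<in> {0..1}" for s
    using seg_subarc[OF g, of 0 s] A(4) that by auto
  have sx: "seg a0 x = g ` {0..1}" using sg[of 1] A(5) by simp
  have gt: "g t \<in> Y" using t A(3) unfolding path_image_def by auto
  have 1: "le a0 (g t) x" "le a0 (g t) y" using t gt S sx unfolding le_def by auto
  have "le a0 w (g t)" if w: "le a0 w x" "le a0 w y" for w
  proof -
    obtain s where s: "s \<in> {0..1}" "w = g s" using w(1) sx unfolding le_def by auto
    then have "s \<le> t" using w(2) t(2) unfolding le_def by auto
    then show ?thesis using s w(1) gt sg[of t] t unfolding le_def by auto
  qed
  then show ?thesis using 1 by blast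
qed

definition meet where
  "meet x y = (SOME m. le a0 m x \<and> le a0 m y \<and> (\<forall>w. le a0 w x \<longrightarrow> le a0 w y \<longrightarrow> le a0 w m))"

lemma meet_props:
  assumes "x \<in> Y" "y \<in> Y"
  shows "le a0 (meet x y) x" "le a0 (meet x y) y" "\<And>w. le a0 w x \<Longrightarrow> le a0 w y \<Longrightarrow> le a0 w (meet x y)"
  using someI_ex[OF meet_ex[OF assms]] unfolding meet_def by blast+

lemma le_between:
  assumes "le a0 m x"
  shows "w \<in> seg m x \<longleftrightarrow> le a0 m w \<and> le a0 w x"
proof -
  have S: "m \<in> Y" "x \<in> Y" "m \<in> seg a0 x" using assms unfolding le_def by auto
  note sp = seg_split[OF a0 S(2,3)]
  show ?thesis
  proof
    assume w: "w \<in> seg m x"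
    then have wY: "w \<in> Y" using seg_facts(1)[OF S(1,2)] by blast
    have wx: "le a0 w x" using w sp(1) wY S unfolding le_def by blast
    have "le a0 m w"
    proof (rule ccontr)
      assume n: "\<not> le a0 m w"
      then have "le a0 w m" using le_chain[OF wx assms] by blast
      then have "w = m" using sp(2) w unfolding le_def by blast
      then show False using n S seg_facts(3)[OF a0 S(1)] unfolding le_def by blast
    qed
    then show "le a0 m w \<and> le a0 w x" using wx by simp
  next
    assume w: "le a0 m w \<and> le a0 w x"
    show "w \<in> seg m x"
    proof (cases "w \<in> seg a0 m")
      case True
      then have "le a0 w m" using w S unfolding le_def by blast
      then have "w = m" using le_antisym w by blast
      then show ?thesis using seg_facts(2)[OF S(1,2)] by simp
    next
      case False
      then show ?thesis using w sp(1) unfolding le_def by blast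
    qed
  qed
qed

text \<open>By maximality of the meet, the arcs from it to \<open>x\<close> and to \<open>y\<close>
  share no other point, so joining them gives an arc, and arcs are unique.\<close>

lemma seg_meet:
  assumes S: "x \<in> Y" "y \<in> Y"
  shows "seg x y = seg (meet x y) x \<union> seg (meet x y) y"
proof -
  let ?m = "meet x y"
  note P = meet_props[OF S]
  have m: "?m \<in> Y" using P unfolding le_def by blast
  show ?thesis
  proof (cases "x = ?m \<or> y = ?m")
    case True
    then show ?thesis using seg_sym[OF S] seg_facts(2,3)[OF S] seg_refl[of x] seg_refl[of y] by auto
  next
    case False
    obtain g1 where g1: "arc_in Y x ?m g1" using arc_ex[OF S(1) m] False by metis
    obtain g2 where g2: "arc_in Y ?m y g2" using arc_ex[OF m S(2)] False by metis
    have i: "path_image g1 = seg ?m x" "path_image g2 = seg ?m y"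
      using seg_eq[OF g1] seg_eq[OF g2] seg_sym[OF S(1) m] by auto
    have "path_image g1 \<inter> path_image g2 \<subseteq> {?m}"
      unfolding i using le_between[OF P(1)] le_between[OF P(2)] P(3) le_antisym by blast
    then have "arc (g1 +++ g2)" using arc_join[of g1 g2] g1 g2 unfolding arc_in_def by auto
    then have "arc_in Y x y (g1 +++ g2)" using g1 g2 unfolding arc_in_def by (auto simp: path_image_join)
    then show ?thesis using seg_eq path_image_join[of g1 g2] g1 g2 i unfolding arc_in_def by metis
  qed
qed

lemma rooted_tree: "rooted_tree Y (le a0) meet a0 D"
proof
  fix x y z u v w :: 'b and s L :: real
  show "le a0 x y \<Longrightarrow> x \<in> Y \<and> y \<in> Y" unfolding le_def by blast
  show "x \<in> Y \<Longrightarrow> le a0 x x" "x \<in> Y \<Longrightarrow> le a0 a0 x" unfolding le_def using seg_facts(2,3) a0 by blast+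
  show "le a0 x y \<Longrightarrow> le a0 y z \<Longrightarrow> le a0 x z" by (rule le_trans)
  show "le a0 x y \<Longrightarrow> le a0 y x \<Longrightarrow> x = y" by (rule le_antisym)
  show "a0 \<in> Y" by (rule a0)
  show "le a0 x z \<Longrightarrow> le a0 y z \<Longrightarrow> le a0 x y \<or> le a0 y x" by (rule le_chain)
  show "x \<in> Y \<Longrightarrow> y \<in> Y \<Longrightarrow> le a0 (meet x y) x" "x \<in> Y \<Longrightarrow> y \<in> Y \<Longrightarrow> le a0 (meet x y) y"
    by (rule meet_props; assumption)+
  show "le a0 w x \<Longrightarrow> le a0 w y \<Longrightarrow> le a0 w (meet x y)"
    using meet_props(3)[of x y w] unfolding le_def by blast
  show "0 \<le> D x y" by (rule D_nonneg)
  show "x \<in> Y \<Longrightarrow> y \<in> Y \<Longrightarrow> (D x y = 0) = (x = y)" by (rule D_zero)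
  show "D x y = D y x" by (rule D_sym)
  show "x \<in> Y \<Longrightarrow> y \<in> Y \<Longrightarrow> z \<in> Y \<Longrightarrow> D x z \<le> D x y + D y z" by (rule D_tri)
  show "D u v \<le> D x y" if "le a0 x u" "le a0 u v" "le a0 v y"
  proof -
    have "le a0 x y" "le a0 u y" "le a0 x v" using that le_trans by blast+
    then have "u \<in> seg x y" "v \<in> seg x y" "x \<in> Y" "y \<in> Y" using le_between that unfolding le_def by blast+
    then show ?thesis using D_mono by blast
  qed
  show "D u v \<le> D x y" if "x \<in> Y" "y \<in> Y" "le a0 (meet x y) u" "le a0 u x" "le a0 (meet x y) v" "le a0 v y"
  proof -
    have "u \<in> seg x y" "v \<in> seg x y"
      unfolding seg_meet[OF that(1,2)] using le_between[OF meet_props(1)[OF that(1,2)]]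
        le_between[OF meet_props(2)[OF that(1,2)]] that by blast+
    then show ?thesis using D_mono that by blast
  qed
  show "\<exists>z. le a0 x z \<and> le a0 z y \<and> D x z = s" if "le a0 x y" "0 \<le> s" "s \<le> D x y"
    using D_ivt[of x y s] that le_between[OF that(1)] unfolding le_def by blast
  show "\<exists>z. le a0 x z \<and> le a0 z y \<and> D z y = s" if st: "le a0 x y" "0 \<le> s" "s \<le> D x y"
  proof -
    have S: "x \<in> Y" "y \<in> Y" using st unfolding le_def by auto
    obtain z where "z \<in> seg y x" "D y z = s" using D_ivt[OF S(2,1), of s] st D_sym[of x y] by auto
    then show ?thesis using le_between[OF st(1)] seg_sym[OF S] D_sym[of y z] by auto
  qed
  show "\<exists>\<Delta>. \<forall>x\<in>Y. \<forall>y\<in>Y. D x y \<le> \<Delta>"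
  proof -
    have b: "bounded Y" using compact_imp_bounded[OF compact] .
    have "D x y \<le> diameter Y" if S: "x \<in> Y" "y \<in> Y" for x y
      by (rule D_le[OF S]) (use diameter_bounded_bound[OF b] seg_facts(1)[OF S] in blast)
    then show ?thesis by blast
  qed
  show "\<exists>M::nat. \<forall>z\<in>Y. \<forall>r>0. \<forall>F\<subseteq>Y. finite F \<longrightarrow> (\<forall>f\<in>F. D f z \<le> L * r) \<longrightarrow>
                 (\<forall>f\<in>F. \<forall>g\<in>F. f \<noteq> g \<longrightarrow> r \<le> D f g) \<longrightarrow> card F \<le> M"
    by (rule D_doubling)
  show "\<exists>x\<in>Y. x \<noteq> a0" using nontriv by metis
qed

end

theorem additive_metric_ex:
  "\<exists>\<rho> \<Theta>::real. (\<forall>x\<in>Y. \<forall>y\<in>Y. 0 \<le> \<rho> x y \<and> (\<rho> x y = 0 \<longleftrightarrow> x = y) \<and> \<rho> x y = \<rho> y x) \<and>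
    (\<forall>x\<in>Y. \<forall>y\<in>Y. \<forall>z\<in>Y. \<rho> x z \<le> \<rho> x y + \<rho> y z) \<and>
    (\<forall>x\<in>Y. \<forall>y\<in>Y. \<forall>z\<in>seg x y. \<rho> x y = \<rho> x z + \<rho> z y) \<and>
    (\<forall>x\<in>Y. \<forall>y\<in>Y. \<forall>z\<in>Y. x \<noteq> z \<longrightarrow> D x y \<le> 2 * D x z \<longrightarrow> \<rho> x y \<le> \<Theta> * \<rho> x z)"
proof -
  obtain a0 where a0: "a0 \<in> Y" using nontriv by blast
  interpret R: rooted_tree Y "le a0" "meet a0" a0 D using rooted_tree[OF a0] .
  obtain \<rho> and \<Theta> :: real where \<rho>: "\<forall>x\<in>Y. \<forall>y\<in>Y. 0 \<le> \<rho> x y \<and> (\<rho> x y = 0 \<longleftrightarrow> x = y) \<and> \<rho> x y = \<rho> y x"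
    "\<forall>x\<in>Y. \<forall>y\<in>Y. \<forall>z\<in>Y. \<rho> x z \<le> \<rho> x y + \<rho> y z"
    "\<forall>x\<in>Y. \<forall>y\<in>Y. \<forall>z. le a0 (meet a0 x y) z \<longrightarrow> le a0 z x \<or> le a0 z y \<longrightarrow> \<rho> x y = \<rho> x z + \<rho> z y"
    "\<forall>x\<in>Y. \<forall>y\<in>Y. \<forall>z\<in>Y. x \<noteq> z \<longrightarrow> D x y \<le> 2 * D x z \<longrightarrow> \<rho> x y \<le> \<Theta> * \<rho> x z"
    using R.geodesic_metric_ex by (elim exE conjE) (rule that)
  have "\<forall>x\<in>Y. \<forall>y\<in>Y. \<forall>z\<in>seg x y. \<rho> x y = \<rho> x z + \<rho> z y"
  proof (intro ballI)
    fix x y z assume S: "x \<in> Y" "y \<in> Y" and z: "z \<in> seg x y"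
    have "le a0 (meet a0 x y) z \<and> (le a0 z x \<or> le a0 z y)"
      using z le_between[OF a0 meet_props(1)[OF a0 S]] le_between[OF a0 meet_props(2)[OF a0 S]]
      unfolding seg_meet[OF a0 S] by blast
    then show "\<rho> x y = \<rho> x z + \<rho> z y" using \<rho>(3) S by blast
  qed
  then show ?thesis using \<rho>(1,2,4) by (intro exI[of _ \<rho>] exI[of _ \<Theta>] conjI)
qed

end

section \<open>Quasiconformal trees\<close>

lemma compact_metric_bounded:
  assumes "compact_space (mtopology_of X)"
  obtains \<Delta> where "\<And>x y. x \<in> mspace X \<Longrightarrow> y \<in> mspace X \<Longrightarrow> mdist X x y \<le> \<Delta>"
proof -
  interpret M: Metric_space "mspace X" "mdist X" by simp
  have "compactin M.mtopology (mspace X)"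
    using assms unfolding compact_space_def mtopology_of_def by simp
  then have "M.mbounded (mspace X)" by (rule M.compactin_imp_mbounded)
  then show ?thesis using that unfolding M.mbounded_alt by blast
qed

text \<open>
  On the type of discrete points every bounded function is continuous, so \<open>bcontfun\<close> is the space of
  all bounded functions.
\<close>

lemma Kuratowski_embedding_ex:
  fixes X :: "'a metric"
  assumes "compact_space (mtopology_of X)"
  obtains \<phi> :: "'a \<Rightarrow> 'a discrete \<Rightarrow>\<^sub>C real"
  where "\<And>x y. x \<in> mspace X \<Longrightarrow> y \<in> mspace X \<Longrightarrow> dist (\<phi> x) (\<phi> y) = mdist X x y"
proof -
  obtain \<Delta> where \<Delta>: "\<And>x y. x \<in> mspace X \<Longrightarrow> y \<in> mspace X \<Longrightarrow> mdist X x y \<le> \<Delta>"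
    using compact_metric_bounded[OF assms] by blast
  define f where "f x s = (if of_discrete s \<in> mspace X then mdist X x (of_discrete s) else 0)" for x s
  have f: "f x \<in> bcontfun" if "x \<in> mspace X" for x
  proof -
    have "continuous_on UNIV (f x)"
      unfolding continuous_on_open_vimage[OF open_UNIV] by (simp add: open_discrete)
    moreover have "norm (f x s) \<le> max \<Delta> 0" for s
      unfolding f_def using \<Delta>[OF that, of "of_discrete s"] by auto
    then have "bounded (range (f x))" unfolding bounded_iff by auto
    ultimately show ?thesis unfolding bcontfun_def by simp
  qed
  define \<phi> where "\<phi> x = Bcontfun (f x)" for x
  have ap: "apply_bcontfun (\<phi> x) = f x" if "x \<in> mspace X" for x
    unfolding \<phi>_def using f[OF that] by (rule Bcontfun_inverse)
  have "dist (\<phi> x) (\<phi> y) = mdist X x y" if xy: "x \<in> mspace X" "y \<in> mspace X" for x y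
  proof (rule antisym)
    show "dist (\<phi> x) (\<phi> y) \<le> mdist X x y"
    proof (rule dist_bound)
      fix s
      show "dist (\<phi> x s) (\<phi> y s) \<le> mdist X x y"
      proof (cases "of_discrete s \<in> mspace X")
        case True
        then show ?thesis
          using mdist_triangle[OF xy True] mdist_triangle[OF xy(2,1) True] mdist_commute[of X x y]
          unfolding ap[OF xy(1)] ap[OF xy(2)] f_def by (simp add: dist_real_def abs_le_iff)
      next
        case False
        then show ?thesis unfolding ap[OF xy(1)] ap[OF xy(2)] f_def by simp
      qed
    qed
    \<comment> \<open>The supremum of the coordinate differences is attained at the coordinate
      \<open>y\<close>.\<close>
    have "dist (\<phi> x (discrete y)) (\<phi> y (discrete y)) = mdist X x y"
      unfolding ap[OF xy(1)] ap[OF xy(2)] f_def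
      using xy mdist_zero[OF xy(2,2), THEN iffD2] by (simp add: discrete_inverse dist_real_def del: mdist_zero)
    then show "mdist X x y \<le> dist (\<phi> x) (\<phi> y)" using dist_bounded[of "\<phi> x" "discrete y" "\<phi> y"] by simp
  qed
  then show ?thesis using that by blast
qed

lemma isometry_homeomorphic_map:
  fixes \<phi> :: "'a \<Rightarrow> 'b::metric_space"
  assumes cpt: "compact_space (mtopology_of X)"
    and iso: "\<And>x y. x \<in> mspace X \<Longrightarrow> y \<in> mspace X \<Longrightarrow> dist (\<phi> x) (\<phi> y) = mdist X x y"
  shows "homeomorphic_map (mtopology_of X) (top_of_set (\<phi> ` mspace X)) \<phi>"
proof (rule continuous_imp_homeomorphic_map[OF _ cpt])
  interpret M: Metric_space "mspace X" "mdist X" by simp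
  have "continuous_map M.mtopology Met_TC.mtopology \<phi>"
    unfolding M.metric_continuous_map[OF Met_TC.Metric_space_axioms] using iso by fastforce
  then show "continuous_map (mtopology_of X) (top_of_set (\<phi> ` mspace X)) \<phi>"
    unfolding mtopology_of_def by (simp add: continuous_map_in_subtopology)
  show "inj_on \<phi> (topspace (mtopology_of X))"
    by (rule inj_onI) (metis iso dist_self mdist_zero topspace_mtopology_of)
qed (auto intro: Hausdorff_space_subtopology)

text \<open>Arcs correspond under \<phi> and its inverse. In the second direction the embedding
  property comes from injectivity and continuity on a compact interval into a Hausdorff
  space.\<close>

lemma arc_path_iff:
  fixes \<phi> :: "'a \<Rightarrow> 'b::metric_space"
  assumes h: "homeomorphic_map X (top_of_set (\<phi> ` topspace X)) \<phi>" and xy: "x \<in> topspace X" "y \<in> topspace X" "x \<noteq> y"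
  shows "arc_path X x y \<gamma> \<Longrightarrow> arc_in (\<phi> ` topspace X) (\<phi> x) (\<phi> y) (\<phi> \<circ> \<gamma>) \<and> \<gamma> ` {0..1} \<subseteq> topspace X"
    and "arc_in (\<phi> ` topspace X) (\<phi> x) (\<phi> y) g \<Longrightarrow> arc_path X x y (inv_into (topspace X) \<phi> \<circ> g)"
proof -
  let ?Y = "\<phi> ` topspace X" and ?\<psi> = "inv_into (topspace X) \<phi>"
  have inj: "inj_on \<phi> (topspace X)" using homeomorphic_imp_injective_map[OF h] .
  show "arc_in ?Y (\<phi> x) (\<phi> y) (\<phi> \<circ> \<gamma>) \<and> \<gamma> ` {0..1} \<subseteq> topspace X" if "arc_path X x y \<gamma>"
  proof -
    have e: "embedding_map (top_of_set {0..1}) X \<gamma>" "\<gamma> 0 = x" "\<gamma> 1 = y"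
      using that xy(3) unfolding arc_path_def by auto
    have hom: "homeomorphic_map (top_of_set {0..1}) (subtopology X (\<gamma> ` {0..1})) \<gamma>"
      using e(1) unfolding embedding_map_def by simp
    have c: "continuous_map (top_of_set {0..1}) X \<gamma>" "inj_on \<gamma> {0..1}"
      using homeomorphic_imp_continuous_map[OF hom] homeomorphic_imp_injective_map[OF hom]
      by (auto simp: continuous_map_in_subtopology)
    have sub: "\<gamma> ` {0..1} \<subseteq> topspace X" using continuous_map_image_subset_topspace[OF c(1)] by simp
    have "continuous_map (top_of_set {0..1}) (top_of_set ?Y) (\<phi> \<circ> \<gamma>)"
      using continuous_map_compose[OF c(1) homeomorphic_imp_continuous_map[OF h]] .
    then have "continuous_on {0..1} (\<phi> \<circ> \<gamma>)" by (simp add: continuous_map_in_subtopology)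
    moreover have "inj_on (\<phi> \<circ> \<gamma>) {0..1}" using c(2) inj_on_subset[OF inj sub] by (rule comp_inj_on)
    ultimately show ?thesis using e sub
      unfolding arc_in_def arc_def path_def path_image_def pathstart_def pathfinish_def by auto
  qed
  show "arc_path X x y (?\<psi> \<circ> g)" if "arc_in ?Y (\<phi> x) (\<phi> y) g"
  proof -
    have g: "continuous_on {0..1} g" "inj_on g {0..1}" "g ` {0..1} \<subseteq> ?Y" "g 0 = \<phi> x" "g 1 = \<phi> y"
      using that unfolding arc_in_def arc_def path_def path_image_def pathstart_def pathfinish_def by auto
    obtain \<psi>' where \<psi>': "homeomorphic_maps X (top_of_set ?Y) \<phi> \<psi>'" using h homeomorphic_map_maps by blast
    have eq: "\<psi>' w = ?\<psi> w" if "w \<in> ?Y" for w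
      using \<psi>' that inj inv_into_f_f[OF inj] unfolding homeomorphic_maps_def by auto
    have "continuous_map (top_of_set {0..1}) (top_of_set ?Y) g"
      using g by (simp add: continuous_map_in_subtopology image_subset_iff_funcset)
    moreover have "continuous_map (top_of_set ?Y) X \<psi>'" using \<psi>' unfolding homeomorphic_maps_def by blast
    ultimately have "continuous_map (top_of_set {0..1}) X (\<psi>' \<circ> g)" by (rule continuous_map_compose)
    then have c: "continuous_map (top_of_set {0..1}) X (?\<psi> \<circ> g)"
    proof (rule continuous_map_eq)
      fix t assume "t \<in> topspace (top_of_set {0..1::real})"
      then have "g t \<in> ?Y" using g(3) by auto
      then show "(\<psi>' \<circ> g) t = (?\<psi> \<circ> g) t" using eq by simp
    qed
    have "inj_on (?\<psi> \<circ> g) {0..1}"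
      using g(2) inj_on_subset[OF inj_on_inv_into[OF order_refl] g(3)] by (rule comp_inj_on)
    moreover have "Hausdorff_space X"
      using homeomorphic_Hausdorff_space[OF homeomorphic_map_imp_homeomorphic_space[OF h]]
      using Hausdorff_space_subtopology[OF Hausdorff_space_euclidean] by blast
    ultimately have "embedding_map (top_of_set {0..1}) X (?\<psi> \<circ> g)"
      using continuous_imp_embedding_map[OF c] by (simp add: compact_space_subtopology)
    then show ?thesis unfolding arc_path_def using xy g inv_into_f_f[OF inj] by simp
  qed
qed

text \<open>Iterating the covering property gives boundedly many balls of radius below
  \<open>r / 2\<close>, each of which contains at most one point of an \<open>r\<close>-separated
  set.\<close>

lemma doubling_separated:
  assumes "doubling_metric X"
  shows "\<exists>M::nat. \<forall>z\<in>mspace X. \<forall>r>0. \<forall>F\<subseteq>mspace X. finite F \<longrightarrow> (\<forall>f\<in>F. mdist X f z \<le> L * r) \<longrightarrow>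
                 (\<forall>f\<in>F. \<forall>g\<in>F. f \<noteq> g \<longrightarrow> r \<le> mdist X f g) \<longrightarrow> card F \<le> M"
proof -
  obtain N :: nat where N: "\<And>x R. x \<in> mspace X \<Longrightarrow> 0 < R \<Longrightarrow> \<exists>C\<subseteq>mspace X.
        finite C \<and> card C \<le> N \<and> mball_of X x R \<subseteq> (\<Union>c\<in>C. mball_of X c (R/2))"
    using assms unfolding doubling_metric_def by blast
  have cover: "\<exists>C\<subseteq>mspace X. finite C \<and> card C \<le> N ^ k \<and> mball_of X x R \<subseteq> (\<Union>c\<in>C. mball_of X c (R / 2 ^ k))"
    if "x \<in> mspace X" "0 < R" for x R k
  proof (induction k)
    case 0
    then show ?case using that by (intro exI[of _ "{x}"]) auto
  next
    case (Suc k)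
    then obtain C where C: "C \<subseteq> mspace X" "finite C" "card C \<le> N ^ k" "mball_of X x R \<subseteq> (\<Union>c\<in>C. mball_of X c (R / 2 ^ k))"
      by blast
    have "\<forall>c\<in>C. \<exists>C'\<subseteq>mspace X. finite C' \<and> card C' \<le> N \<and> mball_of X c (R / 2 ^ k) \<subseteq> (\<Union>c'\<in>C'. mball_of X c' (R / 2 ^ k / 2))"
    proof
      fix c assume "c \<in> C"
      then have "c \<in> mspace X" "0 < R / 2 ^ k" using C(1) that(2) by auto
      then show "\<exists>C'\<subseteq>mspace X. finite C' \<and> card C' \<le> N \<and> mball_of X c (R / 2 ^ k) \<subseteq> (\<Union>c'\<in>C'. mball_of X c' (R / 2 ^ k / 2))"
        by (rule N)
    qed
    from bchoice[OF this] obtain E where E: "\<And>c. c \<in> C \<Longrightarrow> E c \<subseteq> mspace X \<and> finite (E c) \<and> card (E c) \<le> N \<and>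
        mball_of X c (R / 2 ^ k) \<subseteq> (\<Union>c'\<in>E c. mball_of X c' (R / 2 ^ k / 2))" by blast
    have "card (\<Union>c\<in>C. E c) \<le> (\<Sum>c\<in>C. card (E c))" using C(2) by (rule card_UN_le)
    also have "\<dots> \<le> card C * N" using sum_bounded_above[of C "\<lambda>c. card (E c)" N] E by simp
    also have "\<dots> \<le> N ^ Suc k" using C(3) by (simp add: mult.commute)
    finally have "card (\<Union>c\<in>C. E c) \<le> N ^ Suc k" .
    moreover have "mball_of X x R \<subseteq> (\<Union>c'\<in>(\<Union>c\<in>C. E c). mball_of X c' (R / 2 ^ Suc k))"
    proof
      fix w assume "w \<in> mball_of X x R"
      then obtain c where c: "c \<in> C" "w \<in> mball_of X c (R / 2 ^ k)" using C(4) by blast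
      then obtain c' where "c' \<in> E c" "w \<in> mball_of X c' (R / 2 ^ k / 2)" using E by blast
      then show "w \<in> (\<Union>c'\<in>(\<Union>c\<in>C. E c). mball_of X c' (R / 2 ^ Suc k))"
        using c by (auto simp: field_simps)
    qed
    ultimately show ?case using C(2) E by (intro exI[of _ "\<Union>c\<in>C. E c"]) auto
  qed
  obtain k :: nat where k: "2 * (\<bar>L\<bar> + 1) < 2 ^ k" using real_arch_pow[of 2 "2 * (\<bar>L\<bar> + 1)"] by auto
  have "card F \<le> N ^ k" if z: "z \<in> mspace X" and r: "0 < r" and F: "F \<subseteq> mspace X" "finite F"
    "\<forall>f\<in>F. mdist X f z \<le> L * r" "\<forall>f\<in>F. \<forall>g\<in>F. f \<noteq> g \<longrightarrow> r \<le> mdist X f g" for z r F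
  proof -
    \<comment> \<open>The absolute value covers negative \<open>L\<close>, and the added 1 fits the
      closed condition into an open ball.\<close>
    define R where "R = (\<bar>L\<bar> + 1) * r"
    have R: "0 < R" unfolding R_def using r by (intro mult_pos_pos) auto
    have "R / 2 ^ k < r / 2"
    proof -
      have "2 * (\<bar>L\<bar> + 1) * r < 2 ^ k * r" using k r by (rule mult_strict_right_mono)
      then show ?thesis unfolding R_def by (simp add: field_simps)
    qed
    obtain C where C: "C \<subseteq> mspace X" "finite C" "card C \<le> N ^ k" "mball_of X z R \<subseteq> (\<Union>c\<in>C. mball_of X c (R / 2 ^ k))"
      using cover[OF z R] by blast
    have "\<forall>f\<in>F. \<exists>c\<in>C. f \<in> mball_of X c (R / 2 ^ k)"
    proof
      fix f assume f: "f \<in> F"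
      have "L * r \<le> \<bar>L\<bar> * r" using r by (intro mult_right_mono) auto
      moreover have "mdist X f z \<le> L * r" using F(3) f by blast
      moreover have "R = \<bar>L\<bar> * r + r" unfolding R_def by (simp add: distrib_right)
      ultimately have "mdist X z f < R" using r mdist_commute[of X f z] by linarith
      then have "f \<in> mball_of X z R" using z f F(1) by auto
      then show "\<exists>c\<in>C. f \<in> mball_of X c (R / 2 ^ k)" using C(4) by blast
    qed
    then obtain q where q: "\<And>f. f \<in> F \<Longrightarrow> q f \<in> C \<and> f \<in> mball_of X (q f) (R / 2 ^ k)" by metis
    have "inj_on q F"
    proof (rule inj_onI, rule ccontr)
      fix f g assume fg: "f \<in> F" "g \<in> F" "q f = q g" "f \<noteq> g"
      have "f \<in> mball_of X (q f) (R / 2 ^ k)" "g \<in> mball_of X (q f) (R / 2 ^ k)" using q[OF fg(1)] q[OF fg(2)] fg(3) by auto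
      then have "mdist X (q f) f < R / 2 ^ k" "mdist X (q f) g < R / 2 ^ k"
        "mdist X f g \<le> mdist X f (q f) + mdist X (q f) g"
        using mdist_triangle[of f X "q f" g] by auto
      then have "mdist X f g < r" using mdist_commute[of X f "q f"] \<open>R / 2 ^ k < r / 2\<close> by linarith
      then show False using F(4) fg by force
    qed
    then have "card F \<le> card C" using q C(2) by (intro card_inj_on_le[of q]) auto
    then show ?thesis using C(3) by simp
  qed
  then show ?thesis by blast
qed

section \<open>Quasiconformal trees as uniquely arcwise connected compacta\<close>

lemma metric_diameter_ge:
  assumes "\<And>x y. x \<in> E \<Longrightarrow> y \<in> E \<Longrightarrow> mdist X x y \<le> \<Delta>" "x \<in> E" "y \<in> E"
  shows "mdist X x y \<le> metric_diameter X E"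
proof -
  have "bdd_above ((\<lambda>(x, y). mdist X x y) ` (E \<times> E))" using assms(1) by (intro bdd_aboveI[of _ \<Delta>]) auto
  then show ?thesis using assms cSUP_upper[of "(x, y)" "E \<times> E" "\<lambda>(x, y). mdist X x y"]
    unfolding metric_diameter_def by auto
qed

lemma quasiconformal_tree_unique_arcs:
  fixes \<phi> :: "'a \<Rightarrow> 'b::{complete_space,real_normed_vector}"
  assumes X: "quasiconformal_tree X"
    and iso: "\<And>x y. x \<in> mspace X \<Longrightarrow> y \<in> mspace X \<Longrightarrow> dist (\<phi> x) (\<phi> y) = mdist X x y"
  shows "\<exists>K. unique_arcs (\<phi> ` mspace X) K"
proof -
  have cpt: "compact_space (mtopology_of X)" using X unfolding quasiconformal_tree_def metric_tree_def by blast
  note h = isometry_homeomorphic_map[OF cpt iso]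
  have h': "homeomorphic_map (mtopology_of X) (top_of_set (\<phi> ` topspace (mtopology_of X))) \<phi>" using h by simp
  note ap = arc_path_iff[OF h', simplified]
  obtain \<Delta> where \<Delta>: "\<And>x y. x \<in> mspace X \<Longrightarrow> y \<in> mspace X \<Longrightarrow> mdist X x y \<le> \<Delta>"
    using compact_metric_bounded[OF cpt] by blast
  obtain K where K: "1 \<le> K" "\<And>x y. x \<in> mspace X \<Longrightarrow> y \<in> mspace X \<Longrightarrow> \<exists>E.
        compactin (mtopology_of X) E \<and> connectedin (mtopology_of X) E \<and>
        x \<in> E \<and> y \<in> E \<and> metric_diameter X E \<le> K * mdist X x y"
    using X unfolding quasiconformal_tree_def bounded_turning_def by blast
  have arcs: "\<And>x y. x \<in> mspace X \<Longrightarrow> y \<in> mspace X \<Longrightarrow> \<exists>!A. arc_between (mtopology_of X) x y A"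
    using X unfolding quasiconformal_tree_def metric_tree_def by blast
  have neq: "x \<noteq> y \<longleftrightarrow> \<phi> x \<noteq> \<phi> y" if "x \<in> mspace X" "y \<in> mspace X" for x y
    using iso[OF that] mdist_zero[OF that] by (metis dist_eq_0_iff)
  have cont: "continuous_map (mtopology_of X) euclidean \<phi>"
    using homeomorphic_imp_continuous_map[OF h] by (simp add: continuous_map_in_subtopology)
  have "unique_arcs (\<phi> ` mspace X) K"
  proof
    have "compactin (mtopology_of X) (mspace X)" using cpt unfolding compact_space_def by simp
    then show "compact (\<phi> ` mspace X)" using image_compactin[OF _ cont] by (metis compactin_euclidean_iff)
    show "\<exists>g. arc_in (\<phi> ` mspace X) a b g" if ab: "a \<in> \<phi> ` mspace X" "b \<in> \<phi> ` mspace X" "a \<noteq> b" for a b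
    proof -
      obtain x y where xy: "x \<in> mspace X" "y \<in> mspace X" "a = \<phi> x" "b = \<phi> y" using ab by blast
      then obtain \<gamma> where \<gamma>: "arc_path (mtopology_of X) x y \<gamma>" using arcs unfolding arc_between_def by blast
      have "x \<noteq> y" using ab(3) xy(3,4) by auto
      then show ?thesis using ap(1)[OF xy(1,2) _ \<gamma>] unfolding xy(3,4) by blast
    qed
    show "path_image g = path_image g'" if g: "arc_in (\<phi> ` mspace X) a b g" "arc_in (\<phi> ` mspace X) a b g'" for a b g g'
    proof -
      have ab: "a \<in> \<phi> ` mspace X" "b \<in> \<phi> ` mspace X" "a \<noteq> b"
        using g(1) pathstart_in_path_image[of g] pathfinish_in_path_image[of g] arc_distinct_ends[of g] unfolding arc_in_def by auto
      obtain x y where xy: "x \<in> mspace X" "y \<in> mspace X" "a = \<phi> x" "b = \<phi> y" using ab by blast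
      have ne: "x \<noteq> y" using ab(3) xy(3,4) by auto
      let ?\<psi> = "inv_into (mspace X) \<phi>"
      have "arc_between (mtopology_of X) x y ((?\<psi> \<circ> g) ` {0..1})" "arc_between (mtopology_of X) x y ((?\<psi> \<circ> g') ` {0..1})"
        unfolding arc_between_def using ap(2)[OF xy(1,2) ne] g unfolding xy by blast+
      then have e: "(?\<psi> \<circ> g) ` {0..1} = (?\<psi> \<circ> g') ` {0..1}" using arcs[OF xy(1,2)] by blast
      have im: "path_image f = \<phi> ` ((?\<psi> \<circ> f) ` {0..1})" if "path_image f \<subseteq> \<phi> ` mspace X" for f
      proof -
        have "\<phi> (?\<psi> (f t)) = f t" if "t \<in> {0..1}" for t
          using f_inv_into_f[of "f t" \<phi> "mspace X"] \<open>path_image f \<subseteq> \<phi> ` mspace X\<close> that unfolding path_image_def by blast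
        then show ?thesis unfolding path_image_def image_image comp_def by simp
      qed
      show ?thesis using im[of g] im[of g'] e g unfolding arc_in_def by simp
    qed
    show "1 \<le> K" by (rule K)
    show "\<exists>E\<subseteq>\<phi> ` mspace X. connected E \<and> a \<in> E \<and> b \<in> E \<and> (\<forall>e\<in>E. dist a e \<le> K * dist a b)"
      if ab: "a \<in> \<phi> ` mspace X" "b \<in> \<phi> ` mspace X" for a b
    proof -
      obtain x y where xy: "x \<in> mspace X" "y \<in> mspace X" "a = \<phi> x" "b = \<phi> y" using ab by blast
      obtain E where E: "connectedin (mtopology_of X) E" "x \<in> E" "y \<in> E" "metric_diameter X E \<le> K * mdist X x y"
        using K(2)[OF xy(1,2)] by blast
      have EM: "E \<subseteq> mspace X" using connectedin_subset_topspace[OF E(1)] by simp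
      have "connectedin euclidean (\<phi> ` E)" using connectedin_continuous_map_image[OF cont E(1)] .
      then have "connected (\<phi> ` E)" by simp
      moreover have "dist a (\<phi> e) \<le> K * dist a b" if e: "e \<in> E" for e
      proof -
        have "mdist X x e \<le> metric_diameter X E"
          by (rule metric_diameter_ge[where \<Delta> = \<Delta>]) (use \<Delta> EM E(2) e in auto)
        moreover have "dist a (\<phi> e) = mdist X x e" "dist a b = mdist X x y" using iso xy e EM by auto
        ultimately show ?thesis using E(4) by simp
      qed
      ultimately show ?thesis using E EM xy by (intro exI[of _ "\<phi> ` E"]) auto
    qed
    show "\<exists>M::nat. \<forall>z\<in>\<phi> ` mspace X. \<forall>r>0. \<forall>F\<subseteq>\<phi> ` mspace X. finite F \<longrightarrow> (\<forall>f\<in>F. dist f z \<le> L * r) \<longrightarrow>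
                 (\<forall>f\<in>F. \<forall>g\<in>F. f \<noteq> g \<longrightarrow> r \<le> dist f g) \<longrightarrow> card F \<le> M" for L
    proof -
      have dX: "doubling_metric X" using X unfolding quasiconformal_tree_def by blast
      obtain M :: nat where M: "\<forall>z\<in>mspace X. \<forall>r>0. \<forall>F\<subseteq>mspace X. finite F \<longrightarrow> (\<forall>f\<in>F. mdist X f z \<le> L * r) \<longrightarrow>
                 (\<forall>f\<in>F. \<forall>g\<in>F. f \<noteq> g \<longrightarrow> r \<le> mdist X f g) \<longrightarrow> card F \<le> M"
        using doubling_separated[OF dX, of L] by (elim exE) (rule that)
      have "card F \<le> M" if F: "z \<in> \<phi> ` mspace X" "0 < r" "F \<subseteq> \<phi> ` mspace X" "finite F" "\<forall>f\<in>F. dist f z \<le> L * r"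
        "\<forall>f\<in>F. \<forall>g\<in>F. f \<noteq> g \<longrightarrow> r \<le> dist f g" for z r F
      proof -
        obtain G where G: "G \<subseteq> mspace X" "finite G" "F = \<phi> ` G" using finite_subset_image[OF F(4,3)] by blast
        obtain w where w: "w \<in> mspace X" "z = \<phi> w" using F by blast
        have inj: "inj_on \<phi> G" using neq G(1) by (intro inj_onI) blast
        have "card G \<le> M"
        proof (rule M[THEN bspec, THEN spec, THEN mp, THEN spec, THEN mp, THEN mp, THEN mp, THEN mp, OF w(1) F(2) G(1,2)])
          show "\<forall>f\<in>G. mdist X f w \<le> L * r"
          proof
            fix f assume f: "f \<in> G"
            then have "dist (\<phi> f) (\<phi> w) \<le> L * r" using F(5) w(2) G(3) by simp
            moreover have "dist (\<phi> f) (\<phi> w) = mdist X f w" using f G(1) w(1) by (intro iso) auto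
            ultimately show "mdist X f w \<le> L * r" by simp
          qed
          show "\<forall>f\<in>G. \<forall>g\<in>G. f \<noteq> g \<longrightarrow> r \<le> mdist X f g"
          proof (intro ballI impI)
            fix f g assume fg: "f \<in> G" "g \<in> G" "f \<noteq> g"
            then have X': "f \<in> mspace X" "g \<in> mspace X" using G(1) by auto
            have "r \<le> dist (\<phi> f) (\<phi> g)"
              using F(6) fg(1,2) neq[OF X', THEN iffD1, OF fg(3)] unfolding G(3) by blast
            then show "r \<le> mdist X f g" unfolding iso[OF X'] .
          qed
        qed
        then show ?thesis using card_image[OF inj] G(3) by simp
      qed
      then show ?thesis by (intro exI[of _ M] ballI allI impI)
    qed
    have "\<exists>x\<in>mspace X. \<exists>y\<in>mspace X. x \<noteq> y"
      using X unfolding quasiconformal_tree_def metric_tree_def by (elim conjE)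
    then show "\<exists>x\<in>\<phi> ` mspace X. \<exists>y\<in>\<phi> ` mspace X. x \<noteq> y"
      by (elim bexE) (intro bexI[OF _ imageI] neq[THEN iffD1])
  qed
  then show ?thesis by blast
qed

text \<open>Partition sums telescope to the distance of the extreme partition points, which
  additivity bounds by the distance of the ends of the curve.\<close>

lemma curve_length_additive:
  assumes add: "\<And>s t u. 0 \<le> s \<Longrightarrow> s \<le> t \<Longrightarrow> t \<le> u \<Longrightarrow> u \<le> 1 \<Longrightarrow>
      mdist X (\<gamma> s) (\<gamma> u) = mdist X (\<gamma> s) (\<gamma> t) + mdist X (\<gamma> t) (\<gamma> u)"
  shows "curve_length X \<gamma> = ereal (mdist X (\<gamma> 0) (\<gamma> 1))"
proof (rule antisym)
  have tele: "(\<Sum>i<n. mdist X (\<gamma> (t i)) (\<gamma> (t (Suc i)))) = mdist X (\<gamma> (t 0)) (\<gamma> (t n)) \<and> t 0 \<le> t n"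
    if "\<forall>i\<le>n. t i \<in> {0..1}" "\<forall>i<n. t i \<le> t (Suc i)" for n and t :: "nat \<Rightarrow> real"
    using that
  proof (induction n)
    case 0
    have "0 \<le> t 0" "t 0 \<le> 1" using 0 by auto
    then show ?case using add[of "t 0" "t 0" "t 0"] by simp
  next
    case (Suc n)
    then have IH: "(\<Sum>i<n. mdist X (\<gamma> (t i)) (\<gamma> (t (Suc i)))) = mdist X (\<gamma> (t 0)) (\<gamma> (t n))" "t 0 \<le> t n" by auto
    have "0 \<le> t 0" "t n \<le> t (Suc n)" "t (Suc n) \<le> 1" using Suc.prems by auto
    then show ?case using add[of "t 0" "t n" "t (Suc n)"] IH by simp
  qed
  show "curve_length X \<gamma> \<le> ereal (mdist X (\<gamma> 0) (\<gamma> 1))"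
    unfolding curve_length_def
  proof (rule SUP_least, clarify)
    fix n and t :: "nat \<Rightarrow> real" assume t: "\<forall>i\<le>n. t i \<in> {0..1}" "\<forall>i<n. t i \<le> t (Suc i)"
    note T = tele[OF t]
    have "0 \<le> t 0" "t n \<le> 1" using t by auto
    then have "mdist X (\<gamma> (t 0)) (\<gamma> (t n)) \<le> mdist X (\<gamma> 0) (\<gamma> 1)"
      using T add[of 0 "t 0" 1] add[of "t 0" "t n" 1] mdist_nonneg[of X "\<gamma> 0" "\<gamma> (t 0)"]
        mdist_nonneg[of X "\<gamma> (t n)" "\<gamma> 1"] by linarith
    then show "ereal (\<Sum>i<n. mdist X (\<gamma> (t i)) (\<gamma> (t (Suc i)))) \<le> ereal (mdist X (\<gamma> 0) (\<gamma> 1))" using T by simp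
  qed
  show "ereal (mdist X (\<gamma> 0) (\<gamma> 1)) \<le> curve_length X \<gamma>"
    unfolding curve_length_def
    by (rule SUP_upper2[of "(1, \<lambda>i. real i)"]) (auto simp: le_Suc_eq)
qed

text \<open>The geodesic tree has the same points as \<open>X\<close>, and the quasisymmetry is the
  identity. The quasisymmetric estimate already shows that both metrics induce the same topology, so
  the tree properties carry over, and additivity makes the arcs of \<open>X\<close>
  geodesics.\<close>

theorem theorem1p2:
  fixes X :: "'a metric"
  assumes "quasiconformal_tree X"
  shows "\<exists>(T :: 'a metric) f. geodesic_tree T \<and> quasisymmetry X T f"
proof -
  have mt: "metric_tree X" using assms unfolding quasiconformal_tree_def by blast
  then have cpt: "compact_space (mtopology_of X)" unfolding metric_tree_def by blast
  obtain \<phi> :: "'a \<Rightarrow> 'a discrete \<Rightarrow>\<^sub>C real"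
    where iso: "\<And>x y. x \<in> mspace X \<Longrightarrow> y \<in> mspace X \<Longrightarrow> dist (\<phi> x) (\<phi> y) = mdist X x y"
    using Kuratowski_embedding_ex[OF cpt] by blast
  define M where "M = mspace X"
  define Y where "Y = \<phi> ` M"
  have isoM: "dist (\<phi> x) (\<phi> y) = mdist X x y" if "x \<in> M" "y \<in> M" for x y using iso that unfolding M_def by blast
  have \<phi>Y: "\<phi> x \<in> Y" if "x \<in> M" for x using that unfolding Y_def by blast
  have neq: "\<phi> x = \<phi> y \<longleftrightarrow> x = y" if "x \<in> M" "y \<in> M" for x y
    using isoM[OF that] mdist_zero[of x X y] that unfolding M_def by (metis dist_eq_0_iff)
  obtain K where "unique_arcs Y K"
    using quasiconformal_tree_unique_arcs[OF assms iso] unfolding Y_def M_def by blast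
  then interpret U: unique_arcs Y K .
  obtain \<rho> and \<Theta> :: real where \<rho>: "\<forall>x\<in>Y. \<forall>y\<in>Y. 0 \<le> \<rho> x y \<and> (\<rho> x y = 0 \<longleftrightarrow> x = y) \<and> \<rho> x y = \<rho> y x"
    "\<forall>x\<in>Y. \<forall>y\<in>Y. \<forall>z\<in>Y. \<rho> x z \<le> \<rho> x y + \<rho> y z"
    "\<forall>x\<in>Y. \<forall>y\<in>Y. \<forall>z\<in>U.seg x y. \<rho> x y = \<rho> x z + \<rho> z y"
    "\<forall>x\<in>Y. \<forall>y\<in>Y. \<forall>z\<in>Y. x \<noteq> z \<longrightarrow> U.D x y \<le> 2 * U.D x z \<longrightarrow> \<rho> x y \<le> \<Theta> * \<rho> x z"
    using U.additive_metric_ex by (elim exE conjE) (rule that)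
  have "\<exists>A \<alpha> \<beta>. 0 < A \<and> 0 < \<alpha> \<and> 0 < \<beta> \<and> (\<forall>x\<in>Y. \<forall>y\<in>Y. \<forall>z\<in>Y. x \<noteq> z \<longrightarrow>
      \<rho> x y \<le> A * max ((U.D x y / U.D x z) powr \<alpha>) ((U.D x y / U.D x z) powr \<beta>) * \<rho> x z)"
  proof (rule weak_imp_power_quasisymmetry)
    show "0 \<le> U.D x y \<and> (U.D x y = 0 \<longleftrightarrow> x = y) \<and> U.D x y = U.D y x" if "x \<in> Y" "y \<in> Y" for x y
      using U.D_nonneg U.D_zero[OF that] U.D_sym by blast
    show "\<exists>z\<in>Y. U.D x z = s \<and> \<rho> x y = \<rho> x z + \<rho> z y" if "x \<in> Y" "y \<in> Y" "0 \<le> s" "s \<le> U.D x y" for x y s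
      using U.D_ivt[OF that] \<rho>(3) U.seg_facts(1)[OF that(1,2)] that(1,2) by blast
    show "U.D x z \<le> U.D x y + U.D y z" if "x \<in> Y" "y \<in> Y" "z \<in> Y" for x y z using U.D_tri[OF that] .
    show "0 \<le> \<rho> x y \<and> \<rho> x y = \<rho> y x" if "x \<in> Y" "y \<in> Y" for x y
      using bspec[OF bspec[OF \<rho>(1) that(1)] that(2)] by blast
    show "\<rho> x y \<le> \<Theta> * \<rho> x z" if "x \<in> Y" "y \<in> Y" "z \<in> Y" "x \<noteq> z" "U.D x y \<le> 2 * U.D x z" for x y z
      using bspec[OF bspec[OF bspec[OF \<rho>(4) that(1)] that(2)] that(3)] that(4,5) by blast
  qed
  then obtain A \<alpha> \<beta> :: real where qs: "0 < A" "0 < \<alpha>" "0 < \<beta>" "\<forall>x\<in>Y. \<forall>y\<in>Y. \<forall>z\<in>Y. x \<noteq> z \<longrightarrow>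
      \<rho> x y \<le> A * max ((U.D x y / U.D x z) powr \<alpha>) ((U.D x y / U.D x z) powr \<beta>) * \<rho> x z"
    by (elim exE conjE) (rule that)
  obtain C where C: "1 \<le> C" "\<And>x y. x \<in> Y \<Longrightarrow> y \<in> Y \<Longrightarrow> U.D x y \<le> C * dist x y"
    using U.D_comparable by blast
  \<comment> \<open>\<open>C\<close> converts ratios of \<open>U.D\<close> into ratios of
    \<open>mdist X\<close>.\<close>
  define \<eta> where "\<eta> t = A * max ((C * t) powr \<alpha>) ((C * t) powr \<beta>)" for t :: real
  have \<eta>: "homeomorphic_map (top_of_set {0..}) (top_of_set {0..}) \<eta>"
    unfolding \<eta>_def using homeomorphic_max_powr[of A C \<alpha> \<beta>] qs C(1) by simp
  \<comment> \<open>Outside the carrier \<open>d\<close> is 0, because nonnegativity and symmetry of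
    a \<open>Metric_space\<close> are required for all arguments.\<close>
  define d where "d x y = (if x \<in> M \<and> y \<in> M then \<rho> (\<phi> x) (\<phi> y) else 0)" for x y
  have mpos: "0 < mdist X x z" if "x \<in> M" "z \<in> M" "x \<noteq> z" for x z
    using that mdist_zero[of x X z] mdist_nonneg[of X x z] unfolding M_def by (simp add: less_le)
  have dqs: "d x y \<le> \<eta> (mdist X x y / mdist X x z) * d x z" if S: "x \<in> M" "y \<in> M" "z \<in> M" and xz: "x \<noteq> z" for x y z
  proof -
    let ?t = "U.D (\<phi> x) (\<phi> y) / U.D (\<phi> x) (\<phi> z)" and ?s = "C * (mdist X x y / mdist X x z)"
    have p: "0 < mdist X x z" using mpos S xz by blast
    have "?t \<le> (C * mdist X x y) / mdist X x z"
      using C(2)[OF \<phi>Y[OF S(1)] \<phi>Y[OF S(2)]] U.D_dist[OF \<phi>Y[OF S(1)] \<phi>Y[OF S(3)]] isoM S p C(1)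
      by (intro frac_le) auto
    then have t: "0 \<le> ?t" "?t \<le> ?s" using U.D_nonneg by auto
    have "A * max (?t powr \<alpha>) (?t powr \<beta>) \<le> \<eta> (mdist X x y / mdist X x z)"
      unfolding \<eta>_def using t qs(1-3)
      by (intro mult_left_mono max.mono powr_mono2) auto
    moreover have "0 \<le> \<rho> (\<phi> x) (\<phi> z)" using \<rho>(1) \<phi>Y S by blast
    ultimately have "A * max (?t powr \<alpha>) (?t powr \<beta>) * \<rho> (\<phi> x) (\<phi> z) \<le> \<eta> (mdist X x y / mdist X x z) * \<rho> (\<phi> x) (\<phi> z)"
      by (rule mult_right_mono)
    moreover have "\<phi> x \<noteq> \<phi> z" using neq S xz by blast
    ultimately show ?thesis
      using qs(4)[THEN bspec, THEN bspec, THEN bspec, THEN mp, OF \<phi>Y[OF S(1)] \<phi>Y[OF S(2)] \<phi>Y[OF S(3)]] S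
      unfolding d_def by simp
  qed
  interpret T: Metric_space M d
  proof
    fix x y z
    show "0 \<le> d x y" "d x y = d y x" unfolding d_def using \<rho>(1) \<phi>Y by auto
    show "d x y = 0 \<longleftrightarrow> x = y" if "x \<in> M" "y \<in> M" unfolding d_def using \<rho>(1) \<phi>Y that neq by auto
    show "d x z \<le> d x y + d y z" if "x \<in> M" "y \<in> M" "z \<in> M" unfolding d_def using \<rho>(2) \<phi>Y that by auto
  qed
  define T where "T = metric (M, d)"
  have Td: "mspace T = M" "mdist T = d" "mtopology_of T = T.mtopology" unfolding T_def by auto
  have top: "mtopology_of T = mtopology_of X"
  proof -
    interpret MX: Metric_space M "mdist X" unfolding M_def by simp
    have mX: "mtopology_of X = MX.mtopology" unfolding mtopology_of_def M_def by simp
    \<comment> \<open>Continuity at \<open>x\<close> follows by comparing with one fixed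
      \<open>z \<noteq> x\<close>, since \<eta> is continuous and vanishes at 0. Compactness of
      \<open>X\<close> then makes the identity a homeomorphism.\<close>
    have "continuous_map MX.mtopology T.mtopology id"
      unfolding MX.metric_continuous_map[OF T.Metric_space_axioms]
    proof (intro conjI ballI allI impI)
      fix a e :: real and x assume x: "x \<in> M" and e: "0 < e"
      obtain z where z: "z \<in> M" "x \<noteq> z" using mt x unfolding metric_tree_def M_def by metis
      have p: "0 < mdist X x z" using mpos x z by blast
      have ce: "continuous_on {0..} \<eta>" using homeomorphic_imp_continuous_map[OF \<eta>] by (simp add: continuous_map_in_subtopology)
      have dp: "0 < d x z + 1" by (rule add_nonneg_pos[OF T.nonneg zero_less_one])
      have e': "0 < e / (d x z + 1)" using e dp by simp
      from ce e' obtain \<delta> where \<delta>: "0 < \<delta>" "\<And>t. 0 \<le> t \<Longrightarrow> dist t 0 < \<delta> \<Longrightarrow> dist (\<eta> t) (\<eta> 0) < e / (d x z + 1)"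
        using ce[unfolded continuous_on_iff, rule_format, of 0, OF _ e'] by auto
      have \<eta>0: "\<eta> 0 = 0" unfolding \<eta>_def using qs by simp
      have "d x y < e" if y: "y \<in> M" "mdist X x y < \<delta> * mdist X x z" for y
      proof -
        have "mdist X x y / mdist X x z < \<delta>" using y p by (simp add: field_simps)
        then have "\<eta> (mdist X x y / mdist X x z) < e / (d x z + 1)"
          using \<delta>(2)[of "mdist X x y / mdist X x z"] \<eta>0 by (simp add: dist_real_def)
        then have "\<eta> (mdist X x y / mdist X x z) * d x z \<le> e / (d x z + 1) * d x z"
          by (intro mult_right_mono) auto
        also have "\<dots> < e" using e dp by (simp add: field_simps)
        finally show ?thesis using dqs[OF x y(1) z] by linarith
      qed
      then show "\<exists>\<delta>>0. \<forall>y. y \<in> M \<and> mdist X x y < \<delta> \<longrightarrow> d (id x) (id y) < e"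
        using \<delta>(1) p by (intro exI[of _ "\<delta> * mdist X x z"]) auto
    qed simp
    then have "homeomorphic_map MX.mtopology T.mtopology id"
      using cpt T.Hausdorff_space_mtopology unfolding mX by (intro continuous_imp_homeomorphic_map) auto
    then show ?thesis unfolding Td(3) mX by simp
  qed
  have "metric_tree T" using mt top Td(1) unfolding metric_tree_def M_def by simp
  moreover have "geodesic_metric T"
    unfolding geodesic_metric_def
  proof (intro ballI)
    fix x y assume "x \<in> mspace T" "y \<in> mspace T"
    then have S: "x \<in> M" "y \<in> M" using Td by auto
    obtain \<gamma> where \<gamma>: "arc_path (mtopology_of X) x y \<gamma>"
      using mt S unfolding metric_tree_def M_def arc_between_def by blast
    have ends: "\<gamma> 0 = x" "\<gamma> 1 = y" using \<gamma> unfolding arc_path_def by auto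
    have "d (\<gamma> s) (\<gamma> u) = d (\<gamma> s) (\<gamma> t) + d (\<gamma> t) (\<gamma> u)" if st: "0 \<le> s" "s \<le> t" "t \<le> u" "u \<le> 1" for s t u
    proof (cases "x = y")
      case True
      then have "\<gamma> s = x" "\<gamma> t = x" "\<gamma> u = x" using \<gamma> st unfolding arc_path_def by auto
      then show ?thesis using T.zero S by simp
    next
      case False
      have h: "homeomorphic_map (mtopology_of X) (top_of_set (\<phi> ` topspace (mtopology_of X))) \<phi>"
        using isometry_homeomorphic_map[OF cpt iso] by simp
      have g: "arc_in Y (\<phi> x) (\<phi> y) (\<phi> \<circ> \<gamma>)" "\<gamma> ` {0..1} \<subseteq> M"
        using arc_path_iff(1)[OF h _ _ False \<gamma>] S unfolding Y_def M_def by auto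
      have "U.seg (\<phi> (\<gamma> s)) (\<phi> (\<gamma> u)) = (\<phi> \<circ> \<gamma>) ` {s..u}" using U.seg_subarc[OF g(1), of s u] st by simp
      then have "\<phi> (\<gamma> t) \<in> U.seg (\<phi> (\<gamma> s)) (\<phi> (\<gamma> u))" using st by auto
      moreover have "\<gamma> s \<in> M" "\<gamma> t \<in> M" "\<gamma> u \<in> M" using g(2) st by auto
      ultimately show ?thesis using \<rho>(3) \<phi>Y unfolding d_def by simp
    qed
    then have "curve_length T \<gamma> = ereal (mdist T (\<gamma> 0) (\<gamma> 1))"
      unfolding Td(2)[symmetric] by (rule curve_length_additive)
    then have "curve_length T \<gamma> = ereal (mdist T x y)" unfolding ends .
    then show "\<exists>\<gamma>. arc_path (mtopology_of T) x y \<gamma> \<and> curve_length T \<gamma> = ereal (mdist T x y)"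
      using \<gamma> top by auto
  qed
  moreover have "quasisymmetry X T id"
    unfolding quasisymmetry_def
  proof (intro conjI exI[of _ \<eta>] ballI impI)
    show "homeomorphic_map (mtopology_of X) (mtopology_of T) id" using top by simp
    fix x y z assume S: "x \<in> mspace X" "y \<in> mspace X" "z \<in> mspace X" and xz: "x \<noteq> z"
    have "0 < d x z" using T.mdist_pos_less[OF xz] S unfolding M_def by blast
    then show "mdist T (id x) (id y) / mdist T (id x) (id z) \<le> \<eta> (mdist X x y / mdist X x z)"
      using dqs[of x y z] S xz Td(2) unfolding M_def by (simp add: divide_le_eq)
  qed (rule \<eta>)
  ultimately show ?thesis unfolding geodesic_tree_def by blast
qed

end
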